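(* Let $\Gamma$ be a group with a non-amenable, a-normal subgroup $\Lambda$. (1) Let $\pi_0:\Lambda\to\mathcal U(H_0)$ be a factorial unitary representation which is not weakly contained in the left regular representation of $\Lambda$. Then the induced representation $\pi:=\operatorname{Ind}_\Lambda^\Gamma(\pi_0)$, acting on $\ell^2(\Gamma/\Lambda)\otimes H_0$, is factorial, and $\pi(\Gamma)''$ is naturally isomorphic with $B(\ell^2(\Gamma/\Lambda))\,\overline{\otimes}\,\pi_0(\Lambda)''$ (that is, $\pi(\Gamma)''=B(\ell^2(\Gamma/\Lambda))\,\overline{\otimes}\,\pi_0(\Lambda)''$ as von Neumann algebras on $\ell^2(\Gamma/\Lambda)\otimes H_0$). Moreover, there exist a non-zero $x\in C^*(\pi(\Gamma))$ and a rank one projection $p_0\in B(\ell^2(\Gamma/\Lambda))$ such that $x(p_0\otimes 1)=x$. (2) Let $\pi_0,\pi_0'$ be two unitary representations of $\Lambda$, and let $\pi:=\operatorname{Ind}_\Lambda^\Gamma(\pi_0)$ and $\pi':=\operatorname{Ind}_\Lambda^\Gamma(\pi_0')$. If $\pi$ is weakly contained in $\pi'$, then $\pi_0$ is weakly contained in $\pi_0'\oplus\lambda$, where $\lambda$ is the left regular representation of $\Lambda$. If moreover $\pi_0$ is factorial, then $\pi_0$ is weakly contained in $\pi_0'$ or in $\lambda$.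
   Context: Groups are discrete. A subgroup $\Lambda<\Gamma$ is a-normal if $\Lambda\cap g\Lambda g^{-1}$ is amenable for every $g\in\Gamma\setminus\Lambda$. A unitary representation $\pi$ of a group $\Gamma$ is factorial if the von Neumann algebra $\pi(\Gamma)''$ is a factor. $C^*(\pi(\Gamma))$ is the C*-algebra generated by $\pi(\Gamma)$. A unitary representation $\pi$ is weakly contained in $\pi'$ if $\pi'(g)\mapsto\pi(g)$ extends to a C*-morphism $C^*(\pi'(\Gamma))\to C^*(\pi(\Gamma))$; equivalently, for every $x$ in the universal C*-algebra $C^*(\Gamma)$, $\pi'(x)=0$ implies $\pi(x)=0$. Induced representation: fix a section $s:\Gamma/\Lambda\to\Gamma$ of the quotient map and put $c(g,x)=s(gx)^{-1}gs(x)\in\Lambda$ for $g\in\Gamma$, $x\in\Gamma/\Lambda$. For a unitary representation $\pi_0$ of $\Lambda$ on $H_0$, $\operatorname{Ind}_\Lambda^\Gamma(\pi_0)$ is the unitary representation of $\Gamma$ on $\ell^2(\Gamma/\Lambda)\otimes H_0$ given by $\pi_g(\delta_x\otimes\xi)=\delta_{gx}\otimes(\pi_0)_{c(g,x)}\xi$. *)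

theory Defs
  imports "HOL-Analysis.Analysis" "HOL-Algebra.Left_Coset"
begin

section \<open>Complex Hilbert spaces\<close>

text \<open>A complex Hilbert space is a real one (so that the norm, the topology and the operator type
  \<open>'a \<Rightarrow>\<^sub>L 'b\<close> of the library apply) with a compatible complex structure.
  The complex inner product is antilinear in its first argument.\<close>

class complex_hilbert = real_inner + banach +
  fixes scaleC :: "complex \<Rightarrow> 'a \<Rightarrow> 'a"  (infixr \<open>*\<^sub>C\<close> 75)
    and cinner :: "'a \<Rightarrow> 'a \<Rightarrow> complex"
  assumes scaleC_add_right: "c *\<^sub>C (x + y) = c *\<^sub>C x + c *\<^sub>C y"
    and scaleC_add_left: "(c + d) *\<^sub>C x = c *\<^sub>C x + d *\<^sub>C x"
    and scaleC_scaleC: "c *\<^sub>C d *\<^sub>C x = (c * d) *\<^sub>C x"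
    and scaleC_of_real: "complex_of_real r *\<^sub>C x = r *\<^sub>R x"
    and cinner_commute: "cinner x y = cnj (cinner y x)"
    and cinner_add_right: "cinner x (y + z) = cinner x y + cinner x z"
    and cinner_scaleC_right: "cinner x (c *\<^sub>C y) = c * cinner x y"
    and Re_cinner: "Re (cinner x y) = inner x y"

lemma cinner_self:
  fixes x :: "'a :: complex_hilbert"
  shows "cinner x x = complex_of_real ((norm x)\<^sup>2)"
proof -
  have "Im (cinner x x) = 0"
    using cinner_commute[of x x] by (metis Reals_cnj_iff complex_is_Real_iff)
  then show ?thesis
    by (simp add: complex_eq_iff Re_cinner power2_norm_eq_inner)
qed

lemma cinner_scaleC_left:
  fixes x :: "'a :: complex_hilbert"
  shows "cinner (c *\<^sub>C x) y = cnj c * cinner x y"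
  by (metis cinner_commute cinner_scaleC_right complex_cnj_mult)

lemma norm_scaleC:
  fixes x :: "'a :: complex_hilbert"
  shows "norm (c *\<^sub>C x) = cmod c * norm x"
proof -
  have "complex_of_real ((norm (c *\<^sub>C x))\<^sup>2) = complex_of_real ((cmod c * norm x)\<^sup>2)"
    unfolding cinner_self[symmetric] cinner_scaleC_left cinner_scaleC_right
    by (simp add: cinner_self power_mult_distrib complex_norm_square mult_ac flip: of_real_power)
  then have "(norm (c *\<^sub>C x))\<^sup>2 = (cmod c * norm x)\<^sup>2"
    using of_real_eq_iff by blast
  then show ?thesis
    by (simp add: power2_eq_iff_nonneg)
qed

lemma cinner_i_right:
  fixes x :: "'a :: complex_hilbert"
  shows "cinner x y = Complex (inner x y) (- inner x (\<i> *\<^sub>C y))"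
proof -
  have "inner x (\<i> *\<^sub>C y) = Re (\<i> * cinner x y)"
    by (metis Re_cinner cinner_scaleC_right)
  then show ?thesis
    by (simp add: complex_eq_iff Re_cinner)
qed

instantiation complex :: complex_hilbert
begin

definition "c *\<^sub>C (z::complex) = c * z"
definition "cinner (w::complex) z = cnj w * z"

instance
  by standard
    (auto simp: scaleC_complex_def cinner_complex_def algebra_simps inner_complex_def scaleR_conv_of_real)

end

instantiation prod :: (complex_hilbert, complex_hilbert) complex_hilbert
begin

definition "c *\<^sub>C (p :: 'a \<times> 'b) = (c *\<^sub>C fst p, c *\<^sub>C snd p)"
definition "cinner (p :: 'a \<times> 'b) q = cinner (fst p) (fst q) + cinner (snd p) (snd q)"

instance
proof
  fix p q :: "'a \<times> 'b"
  show "cinner p q = cnj (cinner q p)"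
    by (simp add: cinner_prod_def cinner_commute[of "fst p"] cinner_commute[of "snd p"])
qed (simp_all add: scaleC_prod_def cinner_prod_def scaleC_add_right scaleC_add_left scaleC_scaleC
      scaleC_of_real cinner_add_right cinner_scaleC_right Re_cinner inner_prod_def scaleR_prod_def
      algebra_simps)

end


section \<open>The Hilbert spaces of square-summable families\<close>

typedef (overloaded) ('i, 'h::complex_hilbert) ell2 =
    "{f :: 'i \<Rightarrow> 'h. (\<lambda>i. (norm (f i))\<^sup>2) summable_on UNIV}"
  morphisms ell2_nth Abs_ell2
  by (rule exI[of _ "\<lambda>_. 0"]) simp

setup_lifting type_definition_ell2

lemma ell2_ext: "(\<And>i. ell2_nth f i = ell2_nth g i) \<Longrightarrow> f = g"
  by (simp add: ell2_nth_inject[symmetric] fun_eq_iff)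

lemma ell2_summable: "(\<lambda>i. (norm (ell2_nth f i))\<^sup>2) summable_on UNIV"
  using ell2_nth[of f] by simp

lemma summable_on_le_real:
  fixes f g :: "'i \<Rightarrow> real"
  assumes "g summable_on A" "\<And>x. x \<in> A \<Longrightarrow> 0 \<le> f x" "\<And>x. x \<in> A \<Longrightarrow> f x \<le> g x"
  shows "f summable_on A"
  by (rule summable_on_comparison_test[of g]) (use assms in auto)

lemma sq_summable_add:
  fixes f g :: "'i \<Rightarrow> 'h::complex_hilbert"
  assumes "(\<lambda>i. (norm (f i))\<^sup>2) summable_on UNIV" "(\<lambda>i. (norm (g i))\<^sup>2) summable_on UNIV"
  shows "(\<lambda>i. (norm (f i + g i))\<^sup>2) summable_on UNIV"
proof (rule summable_on_le_real)
  show "(\<lambda>i. 2 * ((norm (f i))\<^sup>2 + (norm (g i))\<^sup>2)) summable_on UNIV"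
    by (intro summable_on_cmult_right summable_on_add assms)
  fix i
  have "(norm (f i + g i))\<^sup>2 \<le> (norm (f i) + norm (g i))\<^sup>2"
    by (intro power_mono norm_triangle_ineq) simp
  also have "\<dots> \<le> 2 * ((norm (f i))\<^sup>2 + (norm (g i))\<^sup>2)"
    using sum_squares_bound[of "norm (f i)" "norm (g i)"] by (simp add: power2_sum)
  finally show "(norm (f i + g i))\<^sup>2 \<le> 2 * ((norm (f i))\<^sup>2 + (norm (g i))\<^sup>2)" .
qed simp

lemma sq_summable_scaleC:
  fixes f :: "'i \<Rightarrow> 'h::complex_hilbert"
  assumes "(\<lambda>i. (norm (f i))\<^sup>2) summable_on UNIV"
  shows "(\<lambda>i. (norm (c *\<^sub>C f i))\<^sup>2) summable_on UNIV"
  unfolding norm_scaleC power_mult_distrib by (intro summable_on_cmult_right assms)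

lemma inner_ell2_summable:
  fixes f g :: "('i, 'h::complex_hilbert) ell2"
  shows "(\<lambda>i. inner (ell2_nth f i) (ell2_nth g i)) summable_on UNIV"
proof (rule abs_summable_summable, rule summable_on_le_real)
  show "(\<lambda>i. (norm (ell2_nth f i))\<^sup>2 + (norm (ell2_nth g i))\<^sup>2) summable_on UNIV"
    by (intro summable_on_add ell2_summable)
  fix i
  have "norm (inner (ell2_nth f i) (ell2_nth g i)) \<le> norm (ell2_nth f i) * norm (ell2_nth g i)"
    by (simp add: Cauchy_Schwarz_ineq2)
  also have "\<dots> \<le> (norm (ell2_nth f i))\<^sup>2 + (norm (ell2_nth g i))\<^sup>2"
    using sum_squares_bound[of "norm (ell2_nth f i)" "norm (ell2_nth g i)"]
      mult_nonneg_nonneg[OF norm_ge_zero norm_ge_zero, of "ell2_nth f i" "ell2_nth g i"]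
    by linarith
  finally show "norm (inner (ell2_nth f i) (ell2_nth g i))
    \<le> (norm (ell2_nth f i))\<^sup>2 + (norm (ell2_nth g i))\<^sup>2" .
qed simp

instantiation ell2 :: (type, complex_hilbert) real_inner
begin

lift_definition zero_ell2 :: "('a, 'b) ell2" is "\<lambda>_. 0" by simp
lift_definition plus_ell2 :: "('a, 'b) ell2 \<Rightarrow> ('a, 'b) ell2 \<Rightarrow> ('a, 'b) ell2"
  is "\<lambda>f g i. f i + g i" by (rule sq_summable_add)
lift_definition uminus_ell2 :: "('a, 'b) ell2 \<Rightarrow> ('a, 'b) ell2"
  is "\<lambda>f i. - f i" by simp
lift_definition minus_ell2 :: "('a, 'b) ell2 \<Rightarrow> ('a, 'b) ell2 \<Rightarrow> ('a, 'b) ell2"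
  is "\<lambda>f g i. f i - g i"
  subgoal for f g using sq_summable_add[of f "\<lambda>i. - g i"] by simp
  done
lift_definition scaleR_ell2 :: "real \<Rightarrow> ('a, 'b) ell2 \<Rightarrow> ('a, 'b) ell2"
  is "\<lambda>r f i. r *\<^sub>R f i"
  subgoal for r f using sq_summable_scaleC[of f "complex_of_real r"] by (simp add: scaleC_of_real)
  done
definition inner_ell2 :: "('a, 'b) ell2 \<Rightarrow> ('a, 'b) ell2 \<Rightarrow> real"
  where "inner_ell2 f g = (\<Sum>\<^sub>\<infinity>i. inner (ell2_nth f i) (ell2_nth g i))"
definition norm_ell2 :: "('a, 'b) ell2 \<Rightarrow> real"
  where "norm_ell2 f = sqrt (inner f f)"
definition sgn_ell2 :: "('a, 'b) ell2 \<Rightarrow> ('a, 'b) ell2"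
  where "sgn_ell2 f = inverse (norm f) *\<^sub>R f"
definition dist_ell2 :: "('a, 'b) ell2 \<Rightarrow> ('a, 'b) ell2 \<Rightarrow> real"
  where "dist_ell2 f g = norm (f - g)"
definition uniformity_ell2 :: "(('a, 'b) ell2 \<times> ('a, 'b) ell2) filter"
  where "uniformity_ell2 = (INF e\<in>{0<..}. principal {(f, g). dist f g < e})"
definition open_ell2 :: "('a, 'b) ell2 set \<Rightarrow> bool"
  where "open_ell2 U = (\<forall>x\<in>U. \<forall>\<^sub>F (x', y) in uniformity. x' = x \<longrightarrow> y \<in> U)"

instance
proof
  fix f g h :: "('a, 'b) ell2" and r s :: real
  show "f + g + h = f + (g + h)" "f + g = g + f" "0 + f = f" "- f + f = 0" "f - g = f + - g"
    "r *\<^sub>R (f + g) = r *\<^sub>R f + r *\<^sub>R g" "(r + s) *\<^sub>R f = r *\<^sub>R f + s *\<^sub>R f"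
    "r *\<^sub>R s *\<^sub>R f = (r * s) *\<^sub>R f" "1 *\<^sub>R f = f"
    by (transfer; simp add: fun_eq_iff algebra_simps)+
  show "inner f g = inner g f"
    by (simp add: inner_ell2_def inner_commute)
  show "inner (f + g) h = inner f h + inner g h"
    by (simp add: inner_ell2_def plus_ell2.rep_eq inner_add_left infsum_add inner_ell2_summable)
  show "inner (r *\<^sub>R f) g = r * inner f g"
    by (simp add: inner_ell2_def scaleR_ell2.rep_eq infsum_cmult_right')
  show "0 \<le> inner f f"
    by (simp add: inner_ell2_def infsum_nonneg)
  show "inner f f = 0 \<longleftrightarrow> f = 0"
  proof
    assume "inner f f = 0"
    then have "inner (ell2_nth f i) (ell2_nth f i) = 0" for i
      using nonneg_infsum_le_0D[OF _ inner_ell2_summable[of f f]]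
      by (simp add: inner_ell2_def)
    then show "f = 0"
      by (intro ell2_ext) (simp add: zero_ell2.rep_eq)
  next
    assume "f = 0"
    then show "inner f f = 0"
      by (simp add: inner_ell2_def zero_ell2.rep_eq)
  qed
qed (simp_all add: norm_ell2_def sgn_ell2_def dist_ell2_def uniformity_ell2_def open_ell2_def)

end

lemma ell2_norm_sq:
  "(norm f)\<^sup>2 = (\<Sum>\<^sub>\<infinity>i. (norm (ell2_nth f i))\<^sup>2)"
  by (simp only: power2_norm_eq_inner inner_ell2_def)

lemma ell2_sum_le_norm_sq:
  "finite F \<Longrightarrow> (\<Sum>i\<in>F. (norm (ell2_nth f i))\<^sup>2) \<le> (norm f)\<^sup>2"
  unfolding ell2_norm_sq by (rule finite_sum_le_infsum[OF ell2_summable]) auto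

lemma ell2_nth_norm_le: "norm (ell2_nth f i) \<le> norm f"
  using ell2_sum_le_norm_sq[of "{i}" f] by (simp add: power2_le_iff_abs_le)

instance ell2 :: (type, complex_hilbert) banach
proof
  fix X :: "nat \<Rightarrow> ('a, 'b) ell2"
  assume X: "Cauchy X"
  have "Cauchy (\<lambda>n. ell2_nth (X n) i)" for i
  proof (rule CauchyI)
    fix e :: real assume "0 < e"
    then obtain M where M: "\<And>m n. m \<ge> M \<Longrightarrow> n \<ge> M \<Longrightarrow> norm (X m - X n) < e"
      using CauchyD[OF X] by blast
    have "norm (ell2_nth (X m) i - ell2_nth (X n) i) < e" if "m \<ge> M" "n \<ge> M" for m n
      using ell2_nth_norm_le[of "X m - X n" i] M[OF that] by (simp add: minus_ell2.rep_eq)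
    then show "\<exists>M. \<forall>m\<ge>M. \<forall>n\<ge>M. norm (ell2_nth (X m) i - ell2_nth (X n) i) < e"
      by blast
  qed
  then have "\<forall>i. \<exists>l. (\<lambda>n. ell2_nth (X n) i) \<longlonglongrightarrow> l"
    using Cauchy_convergent unfolding convergent_def by blast
  then obtain f where f: "\<And>i. (\<lambda>n. ell2_nth (X n) i) \<longlonglongrightarrow> f i"
    by metis
  have fin: "(\<Sum>i\<in>F. (norm (ell2_nth (X n) i - f i))\<^sup>2) \<le> e\<^sup>2"
    if F: "finite F" and M: "\<And>m n. m \<ge> M \<Longrightarrow> n \<ge> M \<Longrightarrow> norm (X m - X n) < e" and n: "n \<ge> M"
    for F M n and e :: real
  proof (rule LIMSEQ_le_const2)
    show "(\<lambda>m. \<Sum>i\<in>F. (norm (ell2_nth (X n) i - ell2_nth (X m) i))\<^sup>2)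
        \<longlonglongrightarrow> (\<Sum>i\<in>F. (norm (ell2_nth (X n) i - f i))\<^sup>2)"
      by (intro tendsto_intros f)
    have "(\<Sum>i\<in>F. (norm (ell2_nth (X n) i - ell2_nth (X m) i))\<^sup>2) \<le> e\<^sup>2" if "m \<ge> M" for m
    proof -
      have "(\<Sum>i\<in>F. (norm (ell2_nth (X n) i - ell2_nth (X m) i))\<^sup>2) \<le> (norm (X n - X m))\<^sup>2"
        using ell2_sum_le_norm_sq[OF F, of "X n - X m"] by (simp add: minus_ell2.rep_eq)
      also have "\<dots> \<le> e\<^sup>2"
        using M[OF n that] by (intro power_mono) auto
      finally show ?thesis .
    qed
    then show "\<exists>N. \<forall>m\<ge>N. (\<Sum>i\<in>F. (norm (ell2_nth (X n) i - ell2_nth (X m) i))\<^sup>2) \<le> e\<^sup>2"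
      by blast
  qed
  have diff: "(\<lambda>i. (norm (ell2_nth (X n) i - f i))\<^sup>2) summable_on UNIV"
    if "\<And>m n. m \<ge> M \<Longrightarrow> n \<ge> M \<Longrightarrow> norm (X m - X n) < e" "n \<ge> M" for M n and e :: real
  proof (rule nonneg_bdd_above_summable_on)
    have "sum (\<lambda>i. (norm (ell2_nth (X n) i - f i))\<^sup>2) F \<le> e\<^sup>2" if "finite F" for F
      by (rule fin[OF that]) fact+
    then show "bdd_above (sum (\<lambda>i. (norm (ell2_nth (X n) i - f i))\<^sup>2) ` {F. F \<subseteq> UNIV \<and> finite F})"
      by (intro bdd_aboveI2[where M = "e\<^sup>2"]) simp
  qed simp
  obtain M where M: "\<And>m n. m \<ge> M \<Longrightarrow> n \<ge> M \<Longrightarrow> norm (X m - X n) < 1"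
    using CauchyD[OF X, of 1] by auto
  have "(\<lambda>i. (norm (ell2_nth (X M) i + - (ell2_nth (X M) i - f i)))\<^sup>2) summable_on UNIV"
    by (rule sq_summable_add[OF ell2_summable])
      (use diff[OF M order_refl] in \<open>simp add: norm_minus_commute\<close>)
  then have f_mem: "(\<lambda>i. (norm (f i))\<^sup>2) summable_on UNIV"
    by simp
  define L where "L = Abs_ell2 f"
  have L: "ell2_nth L i = f i" for i
    using f_mem by (simp add: L_def Abs_ell2_inverse)
  have "X \<longlonglongrightarrow> L"
  proof (rule LIMSEQ_I)
    fix e :: real assume e: "0 < e"
    then obtain N where N: "\<And>m n. m \<ge> N \<Longrightarrow> n \<ge> N \<Longrightarrow> norm (X m - X n) < e / 2"
      using CauchyD[OF X, of "e / 2"] by auto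
    have "norm (X n - L) < e" if "n \<ge> N" for n
    proof -
      have "(norm (X n - L))\<^sup>2 \<le> (e / 2)\<^sup>2"
        unfolding ell2_norm_sq minus_ell2.rep_eq L
        by (rule infsum_le_finite_sums[OF diff[OF N that] fin[OF _ N that]])
      then have "norm (X n - L) \<le> e / 2"
        using e by (simp add: power2_le_iff_abs_le)
      then show ?thesis
        using e by simp
    qed
    then show "\<exists>N. \<forall>n\<ge>N. norm (X n - L) < e"
      by blast
  qed
  then show "convergent X"
    by (rule convergentI)
qed

instantiation ell2 :: (type, complex_hilbert) complex_hilbert
begin

lift_definition scaleC_ell2 :: "complex \<Rightarrow> ('a, 'b) ell2 \<Rightarrow> ('a, 'b) ell2"
  is "\<lambda>c f i. c *\<^sub>C f i" by (rule sq_summable_scaleC)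
definition cinner_ell2 :: "('a, 'b) ell2 \<Rightarrow> ('a, 'b) ell2 \<Rightarrow> complex"
  where "cinner_ell2 f g = (\<Sum>\<^sub>\<infinity>i. cinner (ell2_nth f i) (ell2_nth g i))"

lemma cinner_ell2_summable:
  fixes f g :: "('a, 'b) ell2"
  shows "(\<lambda>i. cinner (ell2_nth f i) (ell2_nth g i)) summable_on UNIV"
proof -
  have "(\<lambda>i. complex_of_real (inner (ell2_nth f i) (ell2_nth g i))
      + (- \<i>) * complex_of_real (inner (ell2_nth f i) (ell2_nth (\<i> *\<^sub>C g) i))) summable_on UNIV"
    by (intro summable_on_add summable_on_cmult_right summable_on_of_real inner_ell2_summable)
  also have "(\<lambda>i. complex_of_real (inner (ell2_nth f i) (ell2_nth g i))
      + (- \<i>) * complex_of_real (inner (ell2_nth f i) (ell2_nth (\<i> *\<^sub>C g) i)))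
      = (\<lambda>i. cinner (ell2_nth f i) (ell2_nth g i))"
    by (simp add: fun_eq_iff cinner_i_right scaleC_ell2.rep_eq complex_eq_iff)
  finally show ?thesis .
qed

instance
proof
  fix f g h :: "('a, 'b) ell2" and c d :: complex and r :: real
  show "c *\<^sub>C (f + g) = c *\<^sub>C f + c *\<^sub>C g" "(c + d) *\<^sub>C f = c *\<^sub>C f + d *\<^sub>C f"
    "c *\<^sub>C d *\<^sub>C f = (c * d) *\<^sub>C f" "complex_of_real r *\<^sub>C f = r *\<^sub>R f"
    by (transfer; simp add: fun_eq_iff scaleC_add_right scaleC_add_left scaleC_scaleC scaleC_of_real)+
  show "cinner f g = cnj (cinner g f)"
    unfolding cinner_ell2_def infsum_cnj[symmetric] by (subst cinner_commute) simp
  show "cinner f (g + h) = cinner f g + cinner f h"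
    by (simp add: cinner_ell2_def plus_ell2.rep_eq cinner_add_right infsum_add cinner_ell2_summable)
  show "cinner f (c *\<^sub>C g) = c * cinner f g"
    by (simp add: cinner_ell2_def scaleC_ell2.rep_eq cinner_scaleC_right infsum_cmult_right')
  show "Re (cinner f g) = inner f g"
    unfolding cinner_ell2_def inner_ell2_def infsum_Re[OF cinner_ell2_summable, symmetric]
    by (simp add: Re_cinner)
qed

end

definition ell2_on :: "'i set \<Rightarrow> ('i, 'h::complex_hilbert) ell2 set" where
  "ell2_on X = {f. \<forall>i. i \<notin> X \<longrightarrow> ell2_nth f i = 0}"

lift_definition delta :: "'i \<Rightarrow> ('i, complex) ell2" is "\<lambda>x i. if i = x then 1 else 0"
  by (rule finite_nonzero_values_imp_summable_on) (simp add: if_distrib cong: if_cong)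

text \<open>\<open>ell2_on X :: ('i, 'h) ell2 set\<close> is the model of \<open>\<ell>\<^sup>2(X) \<otimes> 'h\<close>, the elementary
  tensors being the following ones.\<close>

lift_definition etensor :: "('i, complex) ell2 \<Rightarrow> 'h::complex_hilbert \<Rightarrow> ('i, 'h) ell2"
  is "\<lambda>f \<xi> i. f i *\<^sub>C \<xi>"
  by (simp add: norm_scaleC power_mult_distrib summable_on_cmult_left)


section \<open>Operators\<close>

text \<open>Hilbert spaces which depend on terms, such as \<open>\<ell>\<^sup>2(X)\<close> for a set \<open>X\<close>, are
  closed subspaces \<open>V\<close> of a type of class \<open>complex_hilbert\<close>. A bounded operator on \<open>V\<close> is
  represented by its extension by \<open>0\<close> on the orthogonal complement of \<open>V\<close>; the sums, products,
  adjoints and norms of operators on \<open>V\<close> are then those of the ambient space, while the unit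
  of \<open>B(V)\<close> is the orthogonal projection onto \<open>V\<close>.\<close>

definition closed_csubspace :: "'a::complex_hilbert set \<Rightarrow> bool" where
  "closed_csubspace V \<longleftrightarrow> closed V \<and> 0 \<in> V \<and> (\<forall>x\<in>V. \<forall>y\<in>V. x + y \<in> V) \<and> (\<forall>c. \<forall>x\<in>V. c *\<^sub>C x \<in> V)"

definition ops :: "'a::complex_hilbert set \<Rightarrow> ('a \<Rightarrow>\<^sub>L 'a) set" where
  "ops V = {T :: 'a \<Rightarrow>\<^sub>L 'a. (\<forall>c x. T (c *\<^sub>C x) = c *\<^sub>C T x) \<and> (\<forall>x. T x \<in> V) \<and>
               (\<forall>x. (\<forall>v\<in>V. cinner v x = 0) \<longrightarrow> T x = 0)}"

definition adj :: "('a::complex_hilbert \<Rightarrow>\<^sub>L 'a) \<Rightarrow> ('a \<Rightarrow>\<^sub>L 'a)" where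
  "adj T = (THE S :: 'a \<Rightarrow>\<^sub>L 'a. \<forall>x y. cinner (S x) y = cinner x (T y))"

definition scaleC_op :: "complex \<Rightarrow> ('a::complex_hilbert \<Rightarrow>\<^sub>L 'a) \<Rightarrow> ('a \<Rightarrow>\<^sub>L 'a)" where
  "scaleC_op c T = Blinfun (\<lambda>x. c *\<^sub>C T x)"

definition rank_one_projection :: "'a::complex_hilbert set \<Rightarrow> ('a \<Rightarrow>\<^sub>L 'a) \<Rightarrow> bool" where
  "rank_one_projection V p \<longleftrightarrow> p \<in> ops V \<and> p o\<^sub>L p = p \<and> adj p = p \<and>
     (\<exists>e. e \<noteq> 0 \<and> range (blinfun_apply p) = range (\<lambda>c. c *\<^sub>C e))"

text \<open>C*-algebras; they act on \<open>V\<close> but need not contain the unit of \<open>B(V)\<close>.\<close>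

definition star_subalgebra :: "'a::complex_hilbert set \<Rightarrow> ('a \<Rightarrow>\<^sub>L 'a) set \<Rightarrow> bool" where
  "star_subalgebra V A \<longleftrightarrow> A \<subseteq> ops V \<and> 0 \<in> A \<and> (\<forall>S\<in>A. \<forall>T\<in>A. S + T \<in> A \<and> S o\<^sub>L T \<in> A) \<and>
     (\<forall>T\<in>A. adj T \<in> A) \<and> (\<forall>c. \<forall>T\<in>A. scaleC_op c T \<in> A)"

definition cstar_generated :: "'a::complex_hilbert set \<Rightarrow> ('a \<Rightarrow>\<^sub>L 'a) set \<Rightarrow> ('a \<Rightarrow>\<^sub>L 'a) set" where
  "cstar_generated V S = \<Inter>{A. S \<subseteq> A \<and> star_subalgebra V A \<and> closed A}"

definition star_hom ::
  "('a::complex_hilbert \<Rightarrow>\<^sub>L 'a) set \<Rightarrow> ('b::complex_hilbert \<Rightarrow>\<^sub>L 'b) set \<Rightarrow>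
    (('a \<Rightarrow>\<^sub>L 'a) \<Rightarrow> ('b \<Rightarrow>\<^sub>L 'b)) \<Rightarrow> bool" where
  "star_hom A B \<phi> \<longleftrightarrow> (\<forall>T\<in>A. \<phi> T \<in> B) \<and>
     (\<forall>S\<in>A. \<forall>T\<in>A. \<phi> (S + T) = \<phi> S + \<phi> T \<and> \<phi> (S o\<^sub>L T) = \<phi> S o\<^sub>L \<phi> T) \<and>
     (\<forall>T\<in>A. \<phi> (adj T) = adj (\<phi> T)) \<and> (\<forall>c. \<forall>T\<in>A. \<phi> (scaleC_op c T) = scaleC_op c (\<phi> T))"

text \<open>Von Neumann algebras.\<close>

definition commutant :: "'a::complex_hilbert set \<Rightarrow> ('a \<Rightarrow>\<^sub>L 'a) set \<Rightarrow> ('a \<Rightarrow>\<^sub>L 'a) set" where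
  "commutant V S = {T \<in> ops V. \<forall>A\<in>S. T o\<^sub>L A = A o\<^sub>L T}"

abbreviation bicommutant :: "'a::complex_hilbert set \<Rightarrow> ('a \<Rightarrow>\<^sub>L 'a) set \<Rightarrow> ('a \<Rightarrow>\<^sub>L 'a) set" where
  "bicommutant V S \<equiv> commutant V (commutant V S)"

definition factor :: "'a::complex_hilbert set \<Rightarrow> ('a \<Rightarrow>\<^sub>L 'a) set \<Rightarrow> bool" where
  "factor V M \<longleftrightarrow> bicommutant V M = M \<and>
     M \<inter> commutant V M = {T :: 'a \<Rightarrow>\<^sub>L 'a. T \<in> ops V \<and>
       (\<exists>c. \<forall>v\<in>V. T v = c *\<^sub>C v)}"

text \<open>The operator \<open>a \<otimes> b\<close> on \<open>\<ell>\<^sup>2(X) \<otimes> 'h\<close>.\<close>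

definition tensor_op :: "'i set \<Rightarrow> (('i, complex) ell2 \<Rightarrow>\<^sub>L ('i, complex) ell2) \<Rightarrow>
    ('h::complex_hilbert \<Rightarrow>\<^sub>L 'h) \<Rightarrow> (('i, 'h) ell2 \<Rightarrow>\<^sub>L ('i, 'h) ell2)" where
  "tensor_op X a b =
    (THE T :: ('i, 'h) ell2 \<Rightarrow>\<^sub>L ('i, 'h) ell2. T \<in> ops (ell2_on X) \<and>
     (\<forall>f\<in>ell2_on X. \<forall>\<xi>. T (etensor f \<xi>) = etensor (a f) (b \<xi>)))"

definition vn_tensor :: "'i set \<Rightarrow> (('i, complex) ell2 \<Rightarrow>\<^sub>L ('i, complex) ell2) set \<Rightarrow>
    ('h::complex_hilbert \<Rightarrow>\<^sub>L 'h) set \<Rightarrow> (('i, 'h) ell2 \<Rightarrow>\<^sub>L ('i, 'h) ell2) set" where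
  "vn_tensor X N M = bicommutant (ell2_on X) {tensor_op X a b | a b. a \<in> N \<and> b \<in> M}"


section \<open>Groups and unitary representations\<close>

definition amenable :: "('g, 'b) monoid_scheme \<Rightarrow> bool" where
  "amenable G \<longleftrightarrow> (\<exists>\<mu> :: 'g set \<Rightarrow> real.
     \<mu> (carrier G) = 1 \<and> (\<forall>A\<subseteq>carrier G. 0 \<le> \<mu> A) \<and>
     (\<forall>A B. A \<subseteq> carrier G \<longrightarrow> B \<subseteq> carrier G \<longrightarrow> A \<inter> B = {} \<longrightarrow> \<mu> (A \<union> B) = \<mu> A + \<mu> B) \<and>
     (\<forall>g\<in>carrier G. \<forall>A\<subseteq>carrier G. \<mu> (g <#\<^bsub>G\<^esub> A) = \<mu> A))"

definition a_normal :: "('g, 'b) monoid_scheme \<Rightarrow> 'g set \<Rightarrow> bool" where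
  "a_normal G H \<longleftrightarrow> (\<forall>g\<in>carrier G - H.
     amenable (G\<lparr>carrier := H \<inter> (g <#\<^bsub>G\<^esub> (H #>\<^bsub>G\<^esub> inv\<^bsub>G\<^esub> g))\<rparr>))"

definition unitary_rep :: "('g, 'b) monoid_scheme \<Rightarrow> 'a::complex_hilbert set \<Rightarrow>
    ('g \<Rightarrow> 'a \<Rightarrow>\<^sub>L 'a) \<Rightarrow> bool" where
  "unitary_rep G V \<pi> \<longleftrightarrow> closed_csubspace V \<and>
     (\<forall>g\<in>carrier G. \<pi> g \<in> ops V \<and> (\<forall>\<xi>\<in>V. \<forall>\<eta>\<in>V. cinner (\<pi> g \<xi>) (\<pi> g \<eta>) = cinner \<xi> \<eta>)) \<and>
     (\<forall>\<xi>\<in>V. \<pi> \<one>\<^bsub>G\<^esub> \<xi> = \<xi>) \<and>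
     (\<forall>g\<in>carrier G. \<forall>h\<in>carrier G. \<pi> (g \<otimes>\<^bsub>G\<^esub> h) = \<pi> g o\<^sub>L \<pi> h)"

definition rep_cstar :: "('g, 'b) monoid_scheme \<Rightarrow> 'a::complex_hilbert set \<Rightarrow>
    ('g \<Rightarrow> 'a \<Rightarrow>\<^sub>L 'a) \<Rightarrow> ('a \<Rightarrow>\<^sub>L 'a) set" where
  "rep_cstar G V \<pi> = cstar_generated V (\<pi> ` carrier G)"

definition rep_vn :: "('g, 'b) monoid_scheme \<Rightarrow> 'a::complex_hilbert set \<Rightarrow>
    ('g \<Rightarrow> 'a \<Rightarrow>\<^sub>L 'a) \<Rightarrow> ('a \<Rightarrow>\<^sub>L 'a) set" where
  "rep_vn G V \<pi> = bicommutant V (\<pi> ` carrier G)"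

definition factorial_rep :: "('g, 'b) monoid_scheme \<Rightarrow> 'a::complex_hilbert set \<Rightarrow>
    ('g \<Rightarrow> 'a \<Rightarrow>\<^sub>L 'a) \<Rightarrow> bool" where
  "factorial_rep G V \<pi> \<longleftrightarrow> unitary_rep G V \<pi> \<and> factor V (rep_vn G V \<pi>)"

text \<open>The representation \<open>\<pi>\<close> on \<open>V\<close> is weakly contained in \<open>\<pi>'\<close> on \<open>V'\<close>.\<close>

definition weakly_contained :: "('g, 'b) monoid_scheme \<Rightarrow>
    'a::complex_hilbert set \<Rightarrow> ('g \<Rightarrow> 'a \<Rightarrow>\<^sub>L 'a) \<Rightarrow>
    'c::complex_hilbert set \<Rightarrow> ('g \<Rightarrow> 'c \<Rightarrow>\<^sub>L 'c) \<Rightarrow> bool" where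
  "weakly_contained G V \<pi> V' \<pi>' \<longleftrightarrow>
     (\<exists>\<phi>. star_hom (rep_cstar G V' \<pi>') (rep_cstar G V \<pi>) \<phi> \<and> (\<forall>g\<in>carrier G. \<phi> (\<pi>' g) = \<pi> g))"

definition left_regular :: "('g, 'b) monoid_scheme \<Rightarrow>
    'g \<Rightarrow> ('g, complex) ell2 \<Rightarrow>\<^sub>L ('g, complex) ell2" where
  "left_regular G g =
    (THE T :: ('g, complex) ell2 \<Rightarrow>\<^sub>L ('g, complex) ell2. T \<in> ops (ell2_on (carrier G)) \<and>
       (\<forall>h\<in>carrier G. T (delta h) = delta (g \<otimes>\<^bsub>G\<^esub> h)))"

text \<open>If \<open>\<pi>\<close> acts on \<open>V\<close> and \<open>\<sigma>\<close> on \<open>W\<close>, then \<open>direct_sum_rep \<pi> \<sigma>\<close> acts on \<open>V \<times> W\<close>.\<close>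

definition direct_sum_rep :: "('g \<Rightarrow> 'a::complex_hilbert \<Rightarrow>\<^sub>L 'a) \<Rightarrow>
    ('g \<Rightarrow> 'c::complex_hilbert \<Rightarrow>\<^sub>L 'c) \<Rightarrow> 'g \<Rightarrow> ('a \<times> 'c) \<Rightarrow>\<^sub>L ('a \<times> 'c)" where
  "direct_sum_rep \<pi> \<sigma> g = Blinfun (\<lambda>p. (\<pi> g (fst p), \<sigma> g (snd p)))"

definition is_section :: "('g, 'b) monoid_scheme \<Rightarrow> 'g set \<Rightarrow> ('g set \<Rightarrow> 'g) \<Rightarrow> bool" where
  "is_section G H s \<longleftrightarrow> (\<forall>x \<in> lcosets\<^bsub>G\<^esub> H. s x \<in> x)"

definition coset_cocycle :: "('g, 'b) monoid_scheme \<Rightarrow> ('g set \<Rightarrow> 'g) \<Rightarrow> 'g \<Rightarrow> 'g set \<Rightarrow> 'g" where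
  "coset_cocycle G s g x = inv\<^bsub>G\<^esub> (s (g <#\<^bsub>G\<^esub> x)) \<otimes>\<^bsub>G\<^esub> g \<otimes>\<^bsub>G\<^esub> s x"

text \<open>The representation of \<open>G\<close> on \<open>ell2_on (lcosets H)\<close> induced from a representation
  of \<open>H\<close> on the whole type \<open>'h\<close>.\<close>

definition induced_rep :: "('g, 'b) monoid_scheme \<Rightarrow> 'g set \<Rightarrow> ('g set \<Rightarrow> 'g) \<Rightarrow>
    ('g \<Rightarrow> 'h::complex_hilbert \<Rightarrow>\<^sub>L 'h) \<Rightarrow> 'g \<Rightarrow> ('g set, 'h) ell2 \<Rightarrow>\<^sub>L ('g set, 'h) ell2" where
  "induced_rep G H s \<pi>0 g =
    (THE T :: ('g set, 'h) ell2 \<Rightarrow>\<^sub>L ('g set, 'h) ell2. T \<in> ops (ell2_on (lcosets\<^bsub>G\<^esub> H)) \<and>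
     (\<forall>x\<in>lcosets\<^bsub>G\<^esub> H. \<forall>\<xi>. T (etensor (delta x) \<xi>) =
        etensor (delta (g <#\<^bsub>G\<^esub> x)) (\<pi>0 (coset_cocycle G s g x) \<xi>)))"

end

theory Submission
  imports Defs
begin

text \<open>
  Write \<open>L\<close> for the subgroup, \<open>\<lambda>\<close> for its left regular representation and \<open>\<pi>\<close> for the
  representation induced from \<open>\<pi>0\<close>. Everything rests on the restriction of \<open>\<pi>\<close> to \<open>L\<close>. It contains
  \<open>\<pi>0\<close>, at the base coset, and the complement is a sum of representations induced from the
  stabilizers in \<open>L\<close> of the other cosets. By a-normality these stabilizers are amenable, so that
  the complement is weakly contained in \<open>\<lambda>\<close>. Hence
  \<open>\<parallel>\<pi>0(a)\<parallel> \<le> \<parallel>\<pi>(a)\<parallel> \<le> max (\<parallel>\<pi>0(a)\<parallel>) (\<parallel>\<lambda>(a)\<parallel>)\<close> for every \<open>a\<close> in the group algebra of \<open>L\<close>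
  (\<open>base_norm_le\<close>, \<open>induced_norm_le\<close>).

  Weak containment is the domination of one such norm by another (\<open>weakly_containedD\<close>,
  \<open>weakly_containedI\<close>). The forward direction is the contractivity of star homomorphisms, proved
  from the identity \<open>1 - a\<^sup>2 = (1 - Y)\<^sup>2\<close> for self-adjoint contractions \<open>a\<close>; the same square root
  provides positive parts, and thereby elements \<open>x\<close> of \<open>C*(\<pi>(L))\<close> which vanish on one invariant
  subspace and not on another (\<open>separating_element\<close>).

  For the bound on the complement (\<open>off_base_bound\<close>), an invariant mean on a stabilizer is turned
  into almost invariant unit vectors of \<open>\<ell>\<^sup>2(L)\<close>: if convolution with a finite symmetric set \<open>S\<close> had
  norm less than \<open>card S\<close>, its resolvent would give a positive function \<open>h\<close> with
  \<open>\<Sum>\<^sub>s h(s k) \<le> c h(k)\<close> for some \<open>c < card S\<close>, which \<open>amenable_superharmonic\<close> excludes by averaging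
  the ratios \<open>h(s k) / h(k)\<close>. Translates of these vectors form almost equivariant fields over the
  cosets, which embed the complement almost equivariantly into its tensor product with \<open>\<lambda>\<close>, and
  Fell absorption bounds the norm there by that of \<open>\<lambda>\<close>.

  If \<open>\<pi>0\<close> is a factor representation not weakly contained in \<open>\<lambda>\<close>, some nonzero \<open>x\<close> in
  \<open>C*(\<pi>(L))\<close> is supported on the base coset. Since \<open>x\<close> kills no orbit of \<open>\<pi>0\<close>
  (\<open>factorial_rep_orbit\<close>), every operator commuting with \<open>\<pi>\<close> preserves the base copy of \<open>\<pi>0\<close> and is
  determined there. The commutant of \<open>\<pi>\<close> therefore consists of the operators \<open>1 \<otimes> T\<close> with \<open>T\<close> in the
  commutant of \<open>\<pi>0\<close>, which is also the commutant of all \<open>a \<otimes> b\<close> with \<open>b\<close> in \<open>\<pi>0(L)''\<close>.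

  If \<open>\<pi>\<close> is weakly contained in \<open>\<pi>'\<close>, the norm inequalities for \<open>\<pi>0\<close> and \<open>\<pi>0'\<close> combine to the
  weak containment of \<open>\<pi>0\<close> in \<open>\<pi>0' \<oplus> \<lambda>\<close>. For a factor representation one of the summands suffices,
  because its kernel is a prime ideal (\<open>factorial_rep_prime\<close>).
\<close>


section \<open>Hilbert space preliminaries\<close>

lemma cinner_add_left: "cinner (x + y) z = cinner x z + cinner y (z::'a::complex_hilbert)"
  by (metis cinner_add_right cinner_commute complex_cnj_add)

lemma cinner_zero_right [simp]: "cinner x (0::'a::complex_hilbert) = 0"
  using cinner_add_right[of x 0 0] by simp

lemma cinner_zero_left [simp]: "cinner (0::'a::complex_hilbert) x = 0"
  using cinner_add_left[of 0 0 x] by simp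

lemma cinner_minus_right: "cinner x (- y) = - cinner x (y::'a::complex_hilbert)"
  using cinner_add_right[of x y "- y"] by (simp add: eq_neg_iff_add_eq_0 add.commute)

lemma cinner_minus_left: "cinner (- x) y = - cinner x (y::'a::complex_hilbert)"
  by (metis cinner_commute cinner_minus_right complex_cnj_minus)

lemma cinner_diff_right: "cinner x (y - z) = cinner x y - cinner x (z::'a::complex_hilbert)"
  using cinner_add_right[of x y "- z"] by (simp add: cinner_minus_right)

lemma cinner_diff_left: "cinner (x - y) z = cinner x z - cinner y (z::'a::complex_hilbert)"
  using cinner_add_left[of x "- y" z] by (simp add: cinner_minus_left)

lemma cinner_sum_right: "cinner x (\<Sum>i\<in>I. f i) = (\<Sum>i\<in>I. cinner x (f i :: 'a::complex_hilbert))"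
  by (induction I rule: infinite_finite_induct) (auto simp: cinner_add_right)

lemma cinner_sum_left: "cinner (\<Sum>i\<in>I. f i) x = (\<Sum>i\<in>I. cinner (f i) (x :: 'a::complex_hilbert))"
  by (induction I rule: infinite_finite_induct) (auto simp: cinner_add_left)

lemma scaleC_zero_left [simp]: "0 *\<^sub>C x = (0::'a::complex_hilbert)"
  using scaleC_of_real[of 0 x] by simp

lemma scaleC_one [simp]: "1 *\<^sub>C x = (x::'a::complex_hilbert)"
  using scaleC_of_real[of 1 x] by simp

lemma scaleC_zero_right [simp]: "c *\<^sub>C 0 = (0::'a::complex_hilbert)"
  using scaleC_add_right[of c 0 "0::'a"] by simp

lemma scaleC_minus_right: "c *\<^sub>C (- x) = - (c *\<^sub>C (x::'a::complex_hilbert))"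
  using scaleC_add_right[of c x "- x"] by (simp add: eq_neg_iff_add_eq_0 add.commute)

lemma scaleC_minus_one: "(- 1) *\<^sub>C x = - (x::'a::complex_hilbert)"
  using scaleC_of_real[of "-1" x] by simp

lemma scaleC_diff_right: "c *\<^sub>C (x - y) = c *\<^sub>C x - c *\<^sub>C (y::'a::complex_hilbert)"
  using scaleC_add_right[of c x "- y"] by (simp add: scaleC_minus_right)

lemma scaleC_scaleR: "c *\<^sub>C (r *\<^sub>R x) = r *\<^sub>R (c *\<^sub>C (x::'a::complex_hilbert))"
  by (simp add: scaleC_of_real[symmetric] scaleC_scaleC mult.commute)

lemma cinner_scaleR_right: "cinner x (r *\<^sub>R y) = of_real r * cinner x (y::'a::complex_hilbert)"
  by (simp add: scaleC_of_real[symmetric] cinner_scaleC_right)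

lemma cinner_scaleR_left: "cinner (r *\<^sub>R x) y = of_real r * cinner x (y::'a::complex_hilbert)"
  by (simp add: scaleC_of_real[symmetric] cinner_scaleC_left)

lemma cinner_self_eq_0 [simp]: "cinner x x = 0 \<longleftrightarrow> x = (0::'a::complex_hilbert)"
  by (simp add: cinner_self)

lemma cinner_eq_0_commute: "cinner x y = 0 \<longleftrightarrow> cinner y (x::'a::complex_hilbert) = 0"
  by (metis cinner_commute complex_cnj_zero)

lemma cinner_eqI_left: "(\<And>y. cinner x y = cinner x' y) \<Longrightarrow> x = (x'::'a::complex_hilbert)"
  by (metis cinner_diff_left cinner_self_eq_0 eq_iff_diff_eq_0)

lemma cinner_eqI_right: "(\<And>x. cinner x y = cinner x y') \<Longrightarrow> y = (y'::'a::complex_hilbert)"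
  by (metis cinner_diff_right cinner_self_eq_0 eq_iff_diff_eq_0)

lemma cmod_cinner_le: "cmod (cinner x y) \<le> norm x * norm (y::'a::complex_hilbert)"
proof (cases "cinner x y = 0")
  case False
  define u where "u = cnj (sgn (cinner x y))"
  have u: "cmod u = 1"
    using False by (simp add: u_def norm_sgn)
  have "u * cinner x y = of_real (cmod (cinner x y))"
    using False by (simp add: u_def sgn_div_norm complex_norm_square[symmetric] power2_eq_square
        scaleR_conv_of_real field_simps)
  then have "cmod (cinner x y) = inner x (u *\<^sub>C y)"
    by (metis Re_cinner Re_complex_of_real cinner_scaleC_right)
  also have "\<dots> \<le> norm x * norm (u *\<^sub>C y)"
    by (rule norm_cauchy_schwarz)
  finally show ?thesis
    by (simp add: norm_scaleC u)
qed simp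

lemma bounded_linear_cinner_right: "bounded_linear (\<lambda>y. cinner x (y::'a::complex_hilbert))"
  by (rule bounded_linear_intro[where K = "norm x"])
    (auto simp: cinner_add_right cinner_scaleR_right scaleR_conv_of_real cmod_cinner_le mult.commute[of _ "norm x"])

lemma bounded_linear_cinner_left: "bounded_linear (\<lambda>x. cinner x (y::'a::complex_hilbert))"
  by (rule bounded_linear_intro[where K = "norm y"])
    (auto simp: cinner_add_left cinner_scaleR_left scaleR_conv_of_real cmod_cinner_le)

lemma bounded_linear_scaleC: "bounded_linear (\<lambda>x. c *\<^sub>C (x::'a::complex_hilbert))"
  by (rule bounded_linear_intro[where K = "cmod c"])
    (auto simp: scaleC_add_right scaleC_scaleR norm_scaleC)

lemmas tendsto_scaleC = bounded_linear.tendsto[OF bounded_linear_scaleC]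

lemma norm_add_orthogonal:
  "cinner x y = 0 \<Longrightarrow> (norm (x + y))\<^sup>2 = (norm x)\<^sup>2 + (norm (y::'a::complex_hilbert))\<^sup>2"
proof -
  assume "cinner x y = 0"
  then have "inner x y = 0"
    by (simp add: Re_cinner[symmetric])
  then show ?thesis
    by (simp add: power2_norm_eq_inner inner_add_left inner_add_right inner_commute)
qed

lemma norm_sum_orthogonal:
  assumes "finite I" "\<And>i j. i \<in> I \<Longrightarrow> j \<in> I \<Longrightarrow> i \<noteq> j \<Longrightarrow> cinner (v i) (v j) = 0"
  shows "(norm (\<Sum>i\<in>I. v i))\<^sup>2 = (\<Sum>i\<in>I. (norm (v i :: 'a::complex_hilbert))\<^sup>2)"
  using assms
proof (induction I rule: finite_induct)
  case (insert i I)
  have "cinner (v i) (\<Sum>j\<in>I. v j) = 0"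
    unfolding cinner_sum_right using insert.hyps insert.prems by (intro sum.neutral) auto
  then show ?case
    using insert by (simp add: norm_add_orthogonal)
qed simp


subsection \<open>Closed subspaces\<close>

lemma closed_csubspaceD:
  assumes "closed_csubspace V"
  shows "closed V" "0 \<in> V" "x \<in> V \<Longrightarrow> y \<in> V \<Longrightarrow> x + y \<in> V" "x \<in> V \<Longrightarrow> c *\<^sub>C x \<in> V"
    "x \<in> V \<Longrightarrow> r *\<^sub>R x \<in> V" "x \<in> V \<Longrightarrow> - x \<in> V" "x \<in> V \<Longrightarrow> y \<in> V \<Longrightarrow> x - y \<in> V"
proof -
  show *: "closed V" "0 \<in> V" "\<And>x y. x \<in> V \<Longrightarrow> y \<in> V \<Longrightarrow> x + y \<in> V" "\<And>x c. x \<in> V \<Longrightarrow> c *\<^sub>C x \<in> V"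
    using assms by (auto simp: closed_csubspace_def)
  show "x \<in> V \<Longrightarrow> r *\<^sub>R x \<in> V"
    using *(4)[of x "of_real r"] by (simp add: scaleC_of_real)
  show neg: "x \<in> V \<Longrightarrow> - x \<in> V" for x
    using *(4)[of x "- 1"] by (simp add: scaleC_minus_one)
  show "x \<in> V \<Longrightarrow> y \<in> V \<Longrightarrow> x - y \<in> V"
    using *(3)[of x "- y"] neg[of y] by simp
qed

lemma closed_csubspace_sum:
  "closed_csubspace V \<Longrightarrow> (\<And>i. i \<in> I \<Longrightarrow> f i \<in> V) \<Longrightarrow> (\<Sum>i\<in>I. f i) \<in> V"
  by (induction I rule: infinite_finite_induct) (auto simp: closed_csubspaceD)

lemma closed_csubspace_UNIV [simp]: "closed_csubspace UNIV"
  by (simp add: closed_csubspace_def)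

lemma closed_csubspace_Times:
  "closed_csubspace V \<Longrightarrow> closed_csubspace W \<Longrightarrow> closed_csubspace (V \<times> W)"
  by (auto simp: closed_csubspace_def closed_Times scaleC_prod_def zero_prod_def)

text \<open>The distance from a point to a closed subspace is attained, because by the parallelogram
  law every minimising sequence is a Cauchy sequence.\<close>

lemma closest_point_exists:
  fixes V :: "'a::complex_hilbert set"
  assumes V: "closed_csubspace V"
  obtains p where "p \<in> V" "\<And>v. v \<in> V \<Longrightarrow> norm (x - p) \<le> norm (x - v)"
proof -
  note Vs = closed_csubspaceD[OF V]
  define d where "d = (INF v\<in>V. norm (x - v))"
  have bdd: "bdd_below ((\<lambda>v. norm (x - v)) ` V)"
    by (rule bdd_belowI2[of _ 0]) simp
  have d_le: "d \<le> norm (x - v)" if "v \<in> V" for v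
    unfolding d_def by (rule cINF_lower[OF bdd that])
  have d0: "0 \<le> d"
    unfolding d_def using Vs(2) by (intro cINF_greatest) auto
  have "\<exists>v\<in>V. norm (x - v) < d + inverse (real (Suc n))" for n
    using cInf_lessD[of "(\<lambda>v. norm (x - v)) ` V" "d + inverse (real (Suc n))"] Vs(2)
    by (auto simp: d_def)
  then obtain v where v: "\<And>n. v n \<in> V" "\<And>n. norm (x - v n) < d + inverse (real (Suc n))"
    by metis
  have par: "(norm (v m - v n))\<^sup>2 \<le> 2 * (norm (x - v m))\<^sup>2 + 2 * (norm (x - v n))\<^sup>2 - 4 * d\<^sup>2" for m n
  proof -
    have "d \<le> norm (x - (1/2) *\<^sub>R (v m + v n))"
      by (intro d_le Vs v)
    also have "x - (1/2) *\<^sub>R (v m + v n) = (1/2) *\<^sub>R ((x - v m) + (x - v n))"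
    proof -
      have "(1/2) *\<^sub>R ((x - v m) + (x - v n)) = (1/2) *\<^sub>R (x + x) - (1/2) *\<^sub>R (v m + v n)"
        by (simp only: algebra_simps)
      then show ?thesis by simp
    qed
    also have "norm \<dots> = norm ((x - v m) + (x - v n)) / 2"
      by simp
    finally have "(2 * d)\<^sup>2 \<le> (norm ((x - v m) + (x - v n)))\<^sup>2"
      using d0 by (intro power_mono) auto
    moreover have "(norm ((x - v m) + (x - v n)))\<^sup>2 + (norm (v m - v n))\<^sup>2
        = 2 * (norm (x - v m))\<^sup>2 + 2 * (norm (x - v n))\<^sup>2"
    proof -
      have "v m - v n = (x - v n) - (x - v m)" by simp
      then show ?thesis
        by (simp only: power2_norm_eq_inner inner_add_left inner_add_right inner_diff_left
            inner_diff_right inner_commute[of "x - v n" "x - v m"])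
          (simp add: algebra_simps inner_commute)
    qed
    ultimately show ?thesis
      by (simp add: power_mult_distrib)
  qed
  have small: "(\<lambda>n. (d + inverse (real (Suc n)))\<^sup>2 - d\<^sup>2) \<longlonglongrightarrow> (d + 0)\<^sup>2 - d\<^sup>2"
    by (intro tendsto_intros LIMSEQ_inverse_real_of_nat)
  have "Cauchy v"
  proof (rule CauchyI)
    fix e :: real assume e: "0 < e"
    then have "\<forall>\<^sub>F n in sequentially. (d + inverse (real (Suc n)))\<^sup>2 - d\<^sup>2 < e\<^sup>2 / 4"
      using order_tendstoD(2)[OF small, of "e\<^sup>2 / 4"] by simp
    then obtain M where M: "\<And>n. n \<ge> M \<Longrightarrow> (d + inverse (real (Suc n)))\<^sup>2 - d\<^sup>2 < e\<^sup>2 / 4"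
      by (auto simp: eventually_sequentially)
    have "norm (v m - v n) < e" if "m \<ge> M" "n \<ge> M" for m n
    proof -
      have le: "(norm (x - v k))\<^sup>2 \<le> (d + inverse (real (Suc k)))\<^sup>2" for k
        using v(2)[of k] by (intro power_mono) auto
      then have "(norm (v m - v n))\<^sup>2 < e\<^sup>2"
        using par[of m n] M[OF that(1)] M[OF that(2)] le[of m] le[of n] by linarith
      then show ?thesis
        using e by (simp add: power_less_imp_less_base)
    qed
    then show "\<exists>M. \<forall>m\<ge>M. \<forall>n\<ge>M. norm (v m - v n) < e"
      by blast
  qed
  then obtain p where p: "v \<longlonglongrightarrow> p"
    using Cauchy_convergent convergent_def by blast
  have "p \<in> V"
    using closed_sequentially[OF Vs(1)] v(1) p by blast
  moreover have "norm (x - p) \<le> norm (x - w)" if "w \<in> V" for w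
  proof -
    have "norm (x - p) \<le> d + 0"
      by (rule LIMSEQ_le[of "\<lambda>n. norm (x - v n)" _ "\<lambda>n. d + inverse (real (Suc n))"])
        (intro tendsto_intros p LIMSEQ_inverse_real_of_nat | use v(2) in \<open>auto intro: less_imp_le\<close>)+
    then show ?thesis
      using d_le[OF that] by simp
  qed
  ultimately show thesis
    using that by blast
qed

lemma orthogonal_decomposition:
  fixes V :: "'a::complex_hilbert set"
  assumes V: "closed_csubspace V"
  obtains p where "p \<in> V" "\<And>v. v \<in> V \<Longrightarrow> cinner v (x - p) = 0"
proof -
  note Vs = closed_csubspaceD[OF V]
  obtain p where p: "p \<in> V" "\<And>v. v \<in> V \<Longrightarrow> norm (x - p) \<le> norm (x - v)"
    using closest_point_exists[OF V] by blast
  have "cinner v (x - p) = 0" if v: "v \<in> V" for v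
  proof (rule ccontr)
    assume nz: "cinner v (x - p) \<noteq> 0"
    then have v0: "v \<noteq> 0" by auto
    define c where "c = cinner v (x - p) / of_real ((norm v)\<^sup>2)"
    have "cinner v (x - p - c *\<^sub>C v) = 0"
      using v0 by (simp add: cinner_diff_right[of v "x - p"] cinner_scaleC_right cinner_self c_def)
    then have "cinner (x - p - c *\<^sub>C v) (c *\<^sub>C v) = 0"
      by (simp add: cinner_scaleC_right cinner_eq_0_commute)
    then have "(norm (x - p))\<^sup>2 = (norm (x - p - c *\<^sub>C v))\<^sup>2 + (norm (c *\<^sub>C v))\<^sup>2"
      using norm_add_orthogonal[of "x - p - c *\<^sub>C v" "c *\<^sub>C v"] by simp
    moreover have "norm (c *\<^sub>C v) > 0"
      using nz v0 by (simp add: norm_scaleC c_def)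
    moreover have "norm (x - p) \<le> norm (x - p - c *\<^sub>C v)"
      using p(2)[of "p + c *\<^sub>C v"] Vs p(1) v by (simp add: diff_diff_eq)
    ultimately show False
      using power_mono[of "norm (x - p)" "norm (x - p - c *\<^sub>C v)" 2]
        zero_less_power[of "norm (c *\<^sub>C v)" 2] by simp
  qed
  then show thesis
    using that p(1) by blast
qed

lemma in_closed_csubspaceI:
  assumes V: "closed_csubspace V" and x: "\<And>w. (\<And>v. v \<in> V \<Longrightarrow> cinner v w = 0) \<Longrightarrow> cinner x w = 0"
  shows "x \<in> V"
proof -
  obtain p where p: "p \<in> V" "\<And>v. v \<in> V \<Longrightarrow> cinner v (x - p) = 0"
    using orthogonal_decomposition[OF V] by blast
  have "cinner x (x - p) = 0" "cinner p (x - p) = 0"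
    using x p by auto
  then have "cinner (x - p) (x - p) = 0"
    by (simp add: cinner_diff_left)
  then show ?thesis
    using p by simp
qed


subsection \<open>Riesz representation and adjoints\<close>

lemma riesz_representation:
  fixes f :: "'a::complex_hilbert \<Rightarrow> complex"
  assumes bl: "bounded_linear f" and hom: "\<And>c x. f (c *\<^sub>C x) = c * f x"
  obtains z where "\<And>y. f y = cinner z y"
proof (cases "\<forall>y. f y = 0")
  case True
  then show thesis using that[of 0] by simp
next
  case False
  interpret bounded_linear f by (rule bl)
  have "closed {y. f y = 0}"
    by (intro closed_Collect_eq continuous_on continuous_on_const continuous_on_id)
  then have K: "closed_csubspace {y. f y = 0}"
    unfolding closed_csubspace_def by (auto simp: add hom zero)
  obtain u where u: "f u \<noteq> 0" using False by blast
  obtain p where p: "f p = 0" "\<And>v. f v = 0 \<Longrightarrow> cinner v (u - p) = 0"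
    using orthogonal_decomposition[OF K, of u] by auto
  define q where "q = u - p"
  have fq: "f q \<noteq> 0" using u p by (simp add: q_def diff)
  then have q0: "q \<noteq> 0" using zero by auto
  have "f y = cinner ((cnj (f q) / of_real ((norm q)\<^sup>2)) *\<^sub>C q) y" for y
  proof -
    have "f (y - (f y / f q) *\<^sub>C q) = 0"
      using fq by (simp add: diff hom)
    then have "cinner q (y - (f y / f q) *\<^sub>C q) = 0"
      using p(2) q_def cinner_eq_0_commute by blast
    then have "cinner q y = (f y / f q) * of_real ((norm q)\<^sup>2)"
      by (simp add: cinner_diff_right cinner_scaleC_right cinner_self)
    then show ?thesis
      using fq q0 by (simp add: cinner_scaleC_left)
  qed
  then show thesis using that by blast
qed

text \<open>Complex-linearity of a real-linear bounded operator.\<close>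

definition clin :: "('a::complex_hilbert \<Rightarrow>\<^sub>L 'b::complex_hilbert) \<Rightarrow> bool" where
  "clin T \<longleftrightarrow> (\<forall>c x. T (c *\<^sub>C x) = c *\<^sub>C T x)"

lemma clinD: "clin T \<Longrightarrow> T (c *\<^sub>C x) = c *\<^sub>C T x"
  by (simp add: clin_def)

lemma ops_clin: "T \<in> ops V \<Longrightarrow> clin T"
  by (simp add: ops_def clin_def)

lemma ops_UNIV: "ops UNIV = {T. clin T}"
proof -
  have "T x = 0" if "\<forall>v. cinner v x = 0" for T :: "'a \<Rightarrow>\<^sub>L 'a" and x
    using that[rule_format, of x] by (simp add: blinfun.zero_right)
  then show ?thesis by (auto simp: ops_def clin_def)
qed

lemma adjoint_exists:
  fixes T :: "'a::complex_hilbert \<Rightarrow>\<^sub>L 'b::complex_hilbert"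
  assumes T: "clin T"
  obtains S :: "'b \<Rightarrow>\<^sub>L 'a" where "\<And>x y. cinner (S x) y = cinner x (T y)"
proof -
  have "\<exists>z. \<forall>y. cinner x (T y) = cinner z y" for x
  proof -
    have "bounded_linear (\<lambda>y. cinner x (T y))"
      by (intro bounded_linear_compose[OF bounded_linear_cinner_right] blinfun.bounded_linear_right)
    then show ?thesis
      using riesz_representation[of "\<lambda>y. cinner x (T y)"] clinD[OF T]
      by (metis cinner_scaleC_right)
  qed
  then obtain s where s: "\<And>x y. cinner (s x) y = cinner x (T y)"
    by metis
  have "bounded_linear s"
  proof (rule bounded_linear_intro[where K = "norm T"])
    show "s (x + y) = s x + s y" for x y
      by (rule cinner_eqI_left) (simp add: s cinner_add_left)
    show "s (r *\<^sub>R x) = r *\<^sub>R s x" for r x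
      by (rule cinner_eqI_left) (simp add: s cinner_scaleR_left)
    show "norm (s x) \<le> norm x * norm T" for x
    proof (cases "s x = 0")
      case False
      have "(norm (s x))\<^sup>2 = cmod (cinner x (T (s x)))"
        using s[of x "s x"] by (simp add: cinner_self norm_power flip: s)
      also have "\<dots> \<le> norm x * norm (T (s x))"
        by (rule cmod_cinner_le)
      also have "\<dots> \<le> norm x * (norm T * norm (s x))"
        by (intro mult_left_mono norm_blinfun) simp
      finally show ?thesis
        using False by (simp add: power2_eq_square)
    qed simp
  qed
  then show thesis
    using that[of "Blinfun s"] s by (simp add: bounded_linear_Blinfun_apply)
qed

lemma adj_eqI:
  fixes S T :: "'a::complex_hilbert \<Rightarrow>\<^sub>L 'a"
  assumes "\<And>x y. cinner (S x) y = cinner x (T y)"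
  shows "adj T = S"
  unfolding adj_def
proof (rule the_equality)
  show "S' = S" if "\<forall>x y. cinner (S' x) y = cinner x (T y)" for S' :: "'a \<Rightarrow>\<^sub>L 'a"
    by (rule blinfun_eqI, rule cinner_eqI_left) (simp add: that assms)
qed (use assms in auto)

lemma cinner_adj_left: "clin T \<Longrightarrow> cinner (adj T x) y = cinner x (T y)"
  for T :: "'a::complex_hilbert \<Rightarrow>\<^sub>L 'a"
  using adjoint_exists[of T] adj_eqI[of _ T] by metis

lemma cinner_adj_right: "clin T \<Longrightarrow> cinner x (adj T y) = cinner (T x) y"
  for T :: "'a::complex_hilbert \<Rightarrow>\<^sub>L 'a"
  by (metis cinner_adj_left cinner_commute)

lemma scaleC_op_apply [simp]: "scaleC_op c T x = c *\<^sub>C T x"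
  unfolding scaleC_op_def
  by (subst bounded_linear_Blinfun_apply)
    (auto intro!: bounded_linear_compose[OF bounded_linear_scaleC] blinfun.bounded_linear_right)

lemma scaleC_op_of_real: "scaleC_op (of_real r) T = r *\<^sub>R T"
  by (rule blinfun_eqI) (simp add: scaleC_of_real blinfun.scaleR_left)

lemma clin_simps [intro, simp]:
  "clin 0" "clin id_blinfun" "clin S \<Longrightarrow> clin T \<Longrightarrow> clin (S + T)" "clin S \<Longrightarrow> clin T \<Longrightarrow> clin (S - T)"
  "clin T \<Longrightarrow> clin (- T)" "clin T \<Longrightarrow> clin (r *\<^sub>R T)"
  by (auto simp: clin_def blinfun.add_left blinfun.diff_left blinfun.minus_left blinfun.scaleR_left
      scaleC_add_right scaleC_diff_right scaleC_minus_right scaleC_scaleR)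

lemma clin_compose [intro, simp]: "clin S \<Longrightarrow> clin T \<Longrightarrow> clin (S o\<^sub>L T)"
  by (auto simp: clin_def)

lemma clin_scaleC_op [intro, simp]: "clin T \<Longrightarrow> clin (scaleC_op c T)"
  by (auto simp: clin_def scaleC_scaleC mult.commute)

lemma clin_adj [intro, simp]: "clin T \<Longrightarrow> clin (adj T)"
  unfolding clin_def[of "adj T"]
  by (intro allI, rule cinner_eqI_left) (simp add: cinner_adj_left cinner_scaleC_left)

lemma adj_adj: "clin T \<Longrightarrow> adj (adj T) = T"
  by (rule adj_eqI) (simp add: cinner_adj_right)

lemma adj_add: "clin S \<Longrightarrow> clin T \<Longrightarrow> adj (S + T) = adj S + adj T"
  by (rule adj_eqI) (simp add: cinner_adj_left blinfun.add_left cinner_add_left cinner_add_right)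

lemma adj_diff: "clin S \<Longrightarrow> clin T \<Longrightarrow> adj (S - T) = adj S - adj T"
  by (rule adj_eqI) (simp add: cinner_adj_left blinfun.diff_left cinner_diff_left cinner_diff_right)

lemma adj_compose: "clin S \<Longrightarrow> clin T \<Longrightarrow> adj (S o\<^sub>L T) = adj T o\<^sub>L adj S"
  by (rule adj_eqI) (simp add: cinner_adj_left)

lemma adj_scaleC_op: "clin T \<Longrightarrow> adj (scaleC_op c T) = scaleC_op (cnj c) (adj T)"
  by (rule adj_eqI) (simp add: cinner_adj_left cinner_scaleC_left cinner_scaleC_right)

lemma adj_scaleR: "clin T \<Longrightarrow> adj (r *\<^sub>R T) = r *\<^sub>R adj T"
  by (rule adj_eqI)
    (simp add: cinner_adj_left blinfun.scaleR_left cinner_scaleR_left cinner_scaleR_right)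

lemma adj_zero [simp]: "adj 0 = 0"
  by (rule adj_eqI) simp

lemma norm_blinfun_le_iff:
  "norm T \<le> b \<longleftrightarrow> 0 \<le> b \<and> (\<forall>x. norm (T x) \<le> b * norm x)" for T :: "'a::real_normed_vector \<Rightarrow>\<^sub>L 'b::real_normed_vector"
  by (meson mult_right_mono norm_blinfun norm_blinfun_bound norm_ge_zero order_trans)

lemma norm_adj_compose: "clin T \<Longrightarrow> norm (adj T o\<^sub>L T) = (norm T)\<^sup>2"
proof (rule antisym)
  assume T: "clin T"
  have sq: "(norm (T x))\<^sup>2 \<le> norm (adj T o\<^sub>L T) * (norm x)\<^sup>2" for x
  proof -
    have "(norm (T x))\<^sup>2 = cmod (cinner x ((adj T o\<^sub>L T) x))"
      using T by (simp add: cinner_adj_right cinner_self norm_power)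
    also have "\<dots> \<le> norm x * (norm (adj T o\<^sub>L T) * norm x)"
      by (rule order_trans[OF cmod_cinner_le]) (intro mult_left_mono norm_blinfun norm_ge_zero)
    finally show ?thesis
      by (simp add: power2_eq_square mult_ac)
  qed
  have "norm T \<le> sqrt (norm (adj T o\<^sub>L T))"
    unfolding norm_blinfun_le_iff
  proof (intro conjI allI)
    fix x
    show "norm (T x) \<le> sqrt (norm (adj T o\<^sub>L T)) * norm x"
      using real_sqrt_le_mono[OF sq[of x]] by (simp add: real_sqrt_mult)
  qed simp
  then show "(norm T)\<^sup>2 \<le> norm (adj T o\<^sub>L T)"
    by (metis norm_ge_zero real_sqrt_ge_0_iff real_sqrt_le_iff real_sqrt_unique)
  have "norm (adj T) \<le> norm T"
    unfolding norm_blinfun_le_iff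
  proof (intro conjI allI norm_ge_zero)
    fix x
    have "(norm (adj T x))\<^sup>2 = cmod (cinner x (T (adj T x)))"
      using T by (simp add: cinner_adj_left[symmetric] cinner_self norm_power)
    also have "\<dots> \<le> norm x * (norm T * norm (adj T x))"
      by (rule order_trans[OF cmod_cinner_le]) (intro mult_left_mono norm_blinfun norm_ge_zero)
    finally show "norm (adj T x) \<le> norm T * norm x"
      by (cases "adj T x = 0") (auto simp: power2_eq_square mult_ac)
  qed
  then show "norm (adj T o\<^sub>L T) \<le> (norm T)\<^sup>2"
    using order_trans[OF norm_blinfun_compose[of "adj T" T]]
    by (simp add: power2_eq_square mult_right_mono)
qed

lemma norm_adj: assumes T: "clin T" shows "norm (adj T) = norm T"
proof -
  have le: "norm S \<le> norm (adj S)" if "clin S" for S :: "'a \<Rightarrow>\<^sub>L 'a"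
  proof (cases "S = 0")
    case False
    have "norm S * norm S \<le> norm (adj S) * norm S"
      using norm_adj_compose[OF that] norm_blinfun_compose[of "adj S" S] by (simp add: power2_eq_square)
    then show ?thesis using False by simp
  qed simp
  show ?thesis
    using le[OF T] le[OF clin_adj[OF T]] by (simp add: adj_adj T)
qed

lemma bounded_linear_adj_limit:
  assumes "f \<longlonglongrightarrow> T" "\<And>n. clin (f n)" "clin T"
  shows "(\<lambda>n. adj (f n)) \<longlonglongrightarrow> adj T"
proof -
  have "norm (adj (f n) - adj T) = norm (f n - T)" for n
    using assms by (simp add: adj_diff[symmetric] norm_adj)
  then show ?thesis
    using tendsto_norm_zero[OF LIM_zero[OF assms(1)]]
    by (auto intro: LIM_zero_cancel[OF tendsto_norm_zero_cancel])
qed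


subsection \<open>Operators on a closed subspace\<close>

lemma opsD:
  fixes T :: "'a::complex_hilbert \<Rightarrow>\<^sub>L 'a"
  assumes "T \<in> ops V"
  shows "T (c *\<^sub>C x) = c *\<^sub>C T x" "T x \<in> V" "(\<And>v. v \<in> V \<Longrightarrow> cinner v x = 0) \<Longrightarrow> T x = 0"
  using assms by (auto simp: ops_def)

lemma opsI:
  fixes T :: "'a::complex_hilbert \<Rightarrow>\<^sub>L 'a"
  assumes "\<And>c x. T (c *\<^sub>C x) = c *\<^sub>C T x" "\<And>x. T x \<in> V"
    "\<And>x. (\<And>v. v \<in> V \<Longrightarrow> cinner v x = 0) \<Longrightarrow> T x = 0"
  shows "T \<in> ops V"
  using assms by (auto simp: ops_def)

text \<open>An operator on \<open>V\<close> sees a vector only through its component in \<open>V\<close>.\<close>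

lemma ops_decompose:
  fixes V :: "'a::complex_hilbert set"
  assumes V: "closed_csubspace V"
  shows "\<exists>p. p \<in> V \<and> norm p \<le> norm x \<and> (\<forall>v\<in>V. cinner v (x - p) = 0) \<and> (\<forall>T\<in>ops V. T x = T p)"
proof -
  obtain p where p: "p \<in> V" "\<And>v. v \<in> V \<Longrightarrow> cinner v (x - p) = 0"
    using orthogonal_decomposition[OF V] by blast
  have "T x = T p" if "T \<in> ops V" for T
    using opsD(3)[OF that p(2)] by (simp add: blinfun.diff_right)
  moreover have "norm p \<le> norm x"
  proof -
    have "(norm x)\<^sup>2 = (norm p)\<^sup>2 + (norm (x - p))\<^sup>2"
      using norm_add_orthogonal[OF p(2)[OF p(1)]] by simp
    then show ?thesis
      by (intro power2_le_imp_le[OF _ norm_ge_zero]) simp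
  qed
  ultimately show ?thesis
    using p by blast
qed

lemma ops_eqI:
  fixes S T :: "'a::complex_hilbert \<Rightarrow>\<^sub>L 'a"
  assumes "closed_csubspace V" "S \<in> ops V" "T \<in> ops V" "\<And>v. v \<in> V \<Longrightarrow> S v = T v"
  shows "S = T"
proof (rule blinfun_eqI)
  fix x
  obtain p where "p \<in> V" "\<forall>T\<in>ops V. T x = T p"
    using ops_decompose[OF assms(1), of x] by (elim exE conjE)
  then show "S x = T x"
    using assms(2-4) by simp
qed

lemma ops_simps:
  fixes S T :: "'a::complex_hilbert \<Rightarrow>\<^sub>L 'a"
  assumes "closed_csubspace V"
  shows "0 \<in> ops V" "S \<in> ops V \<Longrightarrow> T \<in> ops V \<Longrightarrow> S + T \<in> ops V"
    "S \<in> ops V \<Longrightarrow> T \<in> ops V \<Longrightarrow> S o\<^sub>L T \<in> ops V" "T \<in> ops V \<Longrightarrow> scaleC_op c T \<in> ops V"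
    "T \<in> ops V \<Longrightarrow> adj T \<in> ops V"
proof -
  note Vs = closed_csubspaceD[OF assms]
  show "0 \<in> ops V" "S \<in> ops V \<Longrightarrow> T \<in> ops V \<Longrightarrow> S + T \<in> ops V"
    "S \<in> ops V \<Longrightarrow> T \<in> ops V \<Longrightarrow> S o\<^sub>L T \<in> ops V" "T \<in> ops V \<Longrightarrow> scaleC_op c T \<in> ops V"
    by (auto simp: ops_def Vs blinfun.add_left scaleC_add_right scaleC_scaleC mult.commute blinfun.zero_right)
  assume T: "T \<in> ops V"
  show "adj T \<in> ops V"
  proof (rule opsI)
    show "adj T (c *\<^sub>C x) = c *\<^sub>C adj T x" for c x
      using clin_adj[OF ops_clin[OF T]] by (simp add: clin_def)
    show "adj T x \<in> V" for x
      by (rule in_closed_csubspaceI[OF assms]) (simp add: cinner_adj_left ops_clin[OF T] opsD(3)[OF T])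
    show "adj T x = 0" if "\<And>v. v \<in> V \<Longrightarrow> cinner v x = 0" for x
    proof (rule cinner_eqI_left)
      fix y
      have "cinner (T y) x = 0" using that opsD(2)[OF T] by blast
      then show "cinner (adj T x) y = cinner 0 y"
        by (simp add: cinner_adj_left ops_clin[OF T] cinner_eq_0_commute)
    qed
  qed
qed

lemma closed_ops:
  assumes "closed V"
  shows "closed (ops V :: ('a::complex_hilbert \<Rightarrow>\<^sub>L 'a) set)"
proof (unfold closed_sequential_limits, intro allI impI, elim conjE)
  fix f and T :: "'a \<Rightarrow>\<^sub>L 'a" assume f: "\<forall>n. f n \<in> ops V" and lim: "f \<longlonglongrightarrow> T"
  have lx: "(\<lambda>n. f n x) \<longlonglongrightarrow> T x" for x
    by (intro tendsto_intros lim)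
  show "T \<in> ops V"
  proof (rule opsI)
    fix c x
    have "f n (c *\<^sub>C x) = c *\<^sub>C f n x" for n
      using f opsD(1) by blast
    then have "(\<lambda>n. f n (c *\<^sub>C x)) \<longlonglongrightarrow> c *\<^sub>C T x"
      by (simp add: tendsto_scaleC lx)
    then show "T (c *\<^sub>C x) = c *\<^sub>C T x"
      using LIMSEQ_unique lx by blast
    show "T x \<in> V"
      using closed_sequentially[OF assms _ lx[of x]] f opsD(2) by blast
    assume "\<And>v. v \<in> V \<Longrightarrow> cinner v x = 0"
    then have "f n x = 0" for n using f opsD(3) by blast
    then show "T x = 0" using lx[of x] by (simp add: LIMSEQ_const_iff)
  qed
qed

text \<open>The orthogonal projection onto a closed subspace.\<close>

definition projection :: "'a::complex_hilbert set \<Rightarrow> 'a \<Rightarrow>\<^sub>L 'a" where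
  "projection V = Blinfun (\<lambda>x. SOME p. p \<in> V \<and> (\<forall>v\<in>V. cinner v (x - p) = 0))"

lemma projection:
  assumes V: "closed_csubspace V"
  shows projection_ops: "projection V \<in> ops V" and projection_fix: "x \<in> V \<Longrightarrow> projection V x = x"
    and projection_orthogonal: "v \<in> V \<Longrightarrow> cinner v (x - projection V x) = 0"
    and adj_projection: "adj (projection V) = projection V"
proof -
  note Vs = closed_csubspaceD[OF V]
  have "\<forall>x. \<exists>p. p \<in> V \<and> (\<forall>v\<in>V. cinner v (x - p) = 0)"
  proof
    fix x
    show "\<exists>p. p \<in> V \<and> (\<forall>v\<in>V. cinner v (x - p) = 0)"
      by (rule orthogonal_decomposition[OF V, of x]) blast
  qed
  from choice[OF this] obtain q where q': "\<forall>x. q x \<in> V \<and> (\<forall>v\<in>V. cinner v (x - q x) = 0)"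
    by (elim exE)
  have q: "q x \<in> V" "v \<in> V \<Longrightarrow> cinner v (x - q x) = 0" for x v
    using q' by simp_all
  have uniq: "q x = p" if "p \<in> V" "\<And>v. v \<in> V \<Longrightarrow> cinner v (x - p) = 0" for x p
  proof -
    have "q x - p \<in> V" by (intro Vs(7) q that(1))
    then have "cinner (q x - p) (x - p) = 0" "cinner (q x - p) (x - q x) = 0"
      using q that by blast+
    then have "cinner (q x - p) ((x - p) - (x - q x)) = 0"
      by (simp only: cinner_diff_right[of _ "x - p" "x - q x"] diff_self)
    then show ?thesis by simp
  qed
  have bl: "bounded_linear q"
  proof (rule bounded_linear_intro[where K = 1])
    show "q (x + y) = q x + q y" for x y
    proof (rule uniq)
      show "cinner v (x + y - (q x + q y)) = 0" if "v \<in> V" for v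
        using q(2)[OF that, of x] q(2)[OF that, of y]
        by (simp add: cinner_diff_right cinner_add_right)
    qed (intro Vs q)
    show "q (r *\<^sub>R x) = r *\<^sub>R q x" for r x
    proof (rule uniq)
      show "cinner v (r *\<^sub>R x - r *\<^sub>R q x) = 0" if "v \<in> V" for v
        using q(2)[OF that, of x] by (simp add: cinner_diff_right cinner_scaleR_right)
    qed (intro Vs q)
    show "norm (q x) \<le> norm x * 1" for x
    proof -
      have "(norm x)\<^sup>2 = (norm (q x))\<^sup>2 + (norm (x - q x))\<^sup>2"
        using norm_add_orthogonal[OF q(2)[OF q(1)], of x x] by simp
      then show ?thesis
        by (simp add: power2_le_imp_le)
    qed
  qed
  moreover have "(SOME p. p \<in> V \<and> (\<forall>v\<in>V. cinner v (x - p) = 0)) = q x" for x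
    by (rule some_equality) (use q uniq in auto)
  ultimately have app: "projection V x = q x" for x
    by (simp add: projection_def bounded_linear_Blinfun_apply)
  show "projection V \<in> ops V"
  proof (rule opsI)
    show "projection V (c *\<^sub>C x) = c *\<^sub>C projection V x" for c x
      unfolding app
    proof (rule uniq)
      show "cinner v (c *\<^sub>C x - c *\<^sub>C q x) = 0" if "v \<in> V" for v
        using q(2)[OF that, of x] by (simp add: cinner_diff_right cinner_scaleC_right)
    qed (intro Vs q)
    show "projection V x = 0" if "\<And>v. v \<in> V \<Longrightarrow> cinner v x = 0" for x
      unfolding app by (rule uniq) (use that Vs(2) in auto)
  qed (simp add: app q)
  show "projection V x = x" if "x \<in> V"
    using that by (auto simp: app intro!: uniq)
  show "cinner v (x - projection V x) = 0" if "v \<in> V"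
    using q that by (simp add: app)
  show "adj (projection V) = projection V"
  proof (rule adj_eqI)
    fix x y
    have "cinner (q x) (y - q y) = 0" "cinner (q y) (x - q x) = 0"
      using q by auto
    then have "cinner (q x) y = cinner (q x) (q y)" "cinner (q y) x = cinner (q y) (q x)"
      by (auto simp: cinner_diff_right)
    then show "cinner (projection V x) y = cinner x (projection V y)"
      unfolding app by (metis cinner_commute)
  qed
qed


section \<open>Square roots, contractivity and positive parts\<close>

subsection \<open>Closed star algebras\<close>

lemma cstar_generated_star_subalgebra:
  assumes V: "closed_csubspace V" and S: "S \<subseteq> ops V"
  shows "star_subalgebra V (cstar_generated V S)" "closed (cstar_generated V S)"
    "S \<subseteq> cstar_generated V S"
proof -
  have top: "star_subalgebra V (ops V)" "closed (ops V)"
    using ops_simps[OF V] closed_ops[OF closed_csubspaceD(1)[OF V]] by (auto simp: star_subalgebra_def)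
  then have "cstar_generated V S \<subseteq> ops V"
    using S by (auto simp: cstar_generated_def)
  then show "star_subalgebra V (cstar_generated V S)"
    by (auto simp: star_subalgebra_def cstar_generated_def)
  show "closed (cstar_generated V S)"
    unfolding cstar_generated_def by (rule closed_Inter) auto
  show "S \<subseteq> cstar_generated V S"
    by (auto simp: cstar_generated_def)
qed

lemma star_subalgebraD:
  fixes A :: "('a::complex_hilbert \<Rightarrow>\<^sub>L 'a) set"
  assumes A: "star_subalgebra V A"
  shows "T \<in> A \<Longrightarrow> T \<in> ops V" "T \<in> A \<Longrightarrow> clin T" "0 \<in> A"
    "S \<in> A \<Longrightarrow> T \<in> A \<Longrightarrow> S + T \<in> A" "S \<in> A \<Longrightarrow> T \<in> A \<Longrightarrow> S o\<^sub>L T \<in> A"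
    "T \<in> A \<Longrightarrow> adj T \<in> A" "T \<in> A \<Longrightarrow> scaleC_op c T \<in> A" "T \<in> A \<Longrightarrow> r *\<^sub>R T \<in> A"
    "S \<in> A \<Longrightarrow> T \<in> A \<Longrightarrow> S - T \<in> A"
proof -
  show *: "T \<in> A \<Longrightarrow> T \<in> ops V" "0 \<in> A" "S \<in> A \<Longrightarrow> T \<in> A \<Longrightarrow> S + T \<in> A"
    "S \<in> A \<Longrightarrow> T \<in> A \<Longrightarrow> S o\<^sub>L T \<in> A" "T \<in> A \<Longrightarrow> adj T \<in> A" "T \<in> A \<Longrightarrow> scaleC_op c T \<in> A" for S T c
    using A by (auto simp: star_subalgebra_def)
  show "T \<in> A \<Longrightarrow> clin T"
    using *(1) ops_clin by blast
  show sR: "T \<in> A \<Longrightarrow> r *\<^sub>R T \<in> A" for r T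
    using *(6)[of T "of_real r"] by (simp add: scaleC_op_of_real)
  show "S \<in> A \<Longrightarrow> T \<in> A \<Longrightarrow> S - T \<in> A"
    using *(3)[of S "(- 1) *\<^sub>R T"] sR[of T "- 1"] by simp
qed


subsection \<open>The square root iteration\<close>

text \<open>For a self-adjoint \<open>D\<close> with \<open>\<parallel>D\<parallel> \<le> 1\<close>, the iteration \<open>Y \<mapsto> (D + Y\<^sup>2) / 2\<close> starting at \<open>0\<close>
  converges to the solution \<open>Y = 1 - (1 - D)\<^bsup>1/2\<^esup>\<close> of \<open>Y = (D + Y\<^sup>2) / 2\<close>. It takes place in any
  algebra containing \<open>D\<close>, with or without unit. Its increments are dominated in norm by those of
  the scalar iteration with \<open>D = 1\<close>, which increases and is bounded by \<open>1\<close>.\<close>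

fun sq_iter :: "('a::real_normed_vector \<Rightarrow>\<^sub>L 'a) \<Rightarrow> nat \<Rightarrow> ('a \<Rightarrow>\<^sub>L 'a)" where
  "sq_iter D 0 = 0"
| "sq_iter D (Suc n) = (1/2) *\<^sub>R (D + (sq_iter D n o\<^sub>L sq_iter D n))"

fun sq_scalar :: "nat \<Rightarrow> real" where
  "sq_scalar 0 = 0"
| "sq_scalar (Suc n) = (1 + (sq_scalar n)\<^sup>2) / 2"

lemma blinfun_compose_bilinear:
  "(S + T) o\<^sub>L U = (S o\<^sub>L U) + (T o\<^sub>L U)" "U o\<^sub>L (S + T) = (U o\<^sub>L S) + (U o\<^sub>L T)"
  "(S - T) o\<^sub>L U = (S o\<^sub>L U) - (T o\<^sub>L U)" "U o\<^sub>L (S - T) = (U o\<^sub>L S) - (U o\<^sub>L T)"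
  "(r *\<^sub>R S) o\<^sub>L U = r *\<^sub>R (S o\<^sub>L U)" "U o\<^sub>L (r *\<^sub>R S) = r *\<^sub>R (U o\<^sub>L S)"
  "(- S) o\<^sub>L U = - (S o\<^sub>L U)" "U o\<^sub>L (- S) = - (U o\<^sub>L S)" "0 o\<^sub>L U = 0" "U o\<^sub>L 0 = 0"
  for S T U :: "'a::real_normed_vector \<Rightarrow>\<^sub>L 'a"
  by (rule blinfun_eqI; simp add: blinfun.bilinear_simps)+

lemma blinfun_compose_assoc: "(S o\<^sub>L T) o\<^sub>L U = S o\<^sub>L (T o\<^sub>L U)"
  by (rule blinfun_eqI) simp

lemma sq_iter_commute:
  assumes "S o\<^sub>L D = D o\<^sub>L S"
  shows "S o\<^sub>L sq_iter D n = sq_iter D n o\<^sub>L S"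
proof (induction n)
  case (Suc n)
  have "S o\<^sub>L (sq_iter D n o\<^sub>L sq_iter D n) = (sq_iter D n o\<^sub>L sq_iter D n) o\<^sub>L S"
    by (metis Suc blinfun_compose_assoc)
  then show ?case
    by (simp add: blinfun_compose_bilinear assms)
qed (simp add: blinfun_compose_bilinear)

lemma sq_scalar_bounds: "0 \<le> sq_scalar n \<and> sq_scalar n \<le> 1 \<and> sq_scalar n \<le> sq_scalar (Suc n)"
proof (induction n)
  case (Suc n)
  then have "(sq_scalar n)\<^sup>2 \<le> (sq_scalar (Suc n))\<^sup>2" "(sq_scalar (Suc n))\<^sup>2 \<le> 1" if "sq_scalar (Suc n) \<le> 1"
    using that by (auto intro!: power_mono simp del: sq_scalar.simps simp: power_le_one)
  moreover have "sq_scalar (Suc n) \<le> 1"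
    using Suc by (simp add: power_le_one)
  moreover have "sq_scalar (Suc (Suc n)) = (1 + (sq_scalar (Suc n))\<^sup>2) / 2"
    "sq_scalar (Suc n) = (1 + (sq_scalar n)\<^sup>2) / 2"
    by simp_all
  ultimately show ?case
    using Suc by (smt (verit) divide_right_mono)
qed simp

lemma sq_iter_norm:
  assumes D: "norm D \<le> 1"
  shows "norm (sq_iter D n) \<le> sq_scalar n \<and>
    norm (sq_iter D (Suc n) - sq_iter D n) \<le> sq_scalar (Suc n) - sq_scalar n"
proof (induction n)
  case 0
  then show ?case using D by simp
next
  case (Suc n)
  let ?Y = "sq_iter D" and ?y = sq_scalar
  have n1: "norm (?Y (Suc n)) \<le> ?y (Suc n)"
  proof -
    have "norm (?Y (Suc n)) \<le> norm (?Y n) + norm (?Y (Suc n) - ?Y n)"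
      by (metis add.commute diff_add_cancel norm_triangle_ineq)
    then show ?thesis using Suc by linarith
  qed
  have comm: "?Y n o\<^sub>L ?Y (Suc n) = ?Y (Suc n) o\<^sub>L ?Y n"
    by (intro sq_iter_commute sq_iter_commute[symmetric] refl)
  have "?Y (Suc (Suc n)) - ?Y (Suc n)
      = (1/2) *\<^sub>R ((?Y (Suc n) o\<^sub>L ?Y (Suc n)) - (?Y n o\<^sub>L ?Y n))"
    by (simp add: scaleR_right_distrib scaleR_right_diff_distrib)
  also have "(?Y (Suc n) o\<^sub>L ?Y (Suc n)) - (?Y n o\<^sub>L ?Y n)
      = (?Y (Suc n) - ?Y n) o\<^sub>L (?Y (Suc n) + ?Y n)"
    by (simp only: blinfun_compose_bilinear comm) simp
  finally have "norm (?Y (Suc (Suc n)) - ?Y (Suc n))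
      \<le> norm (?Y (Suc n) - ?Y n) * norm (?Y (Suc n) + ?Y n) / 2"
    using norm_blinfun_compose[of "?Y (Suc n) - ?Y n" "?Y (Suc n) + ?Y n"] by simp
  also have "\<dots> \<le> (?y (Suc n) - ?y n) * (?y (Suc n) + ?y n) / 2"
    using Suc n1 norm_triangle_ineq[of "?Y (Suc n)" "?Y n"] sq_scalar_bounds[of n]
    by (intro divide_right_mono mult_mono) (auto simp del: sq_iter.simps sq_scalar.simps)
  also have "\<dots> = ?y (Suc (Suc n)) - ?y (Suc n)"
    by (simp add: field_simps power2_eq_square)
  finally show ?case using n1 by blast
qed

lemma sq_iter_Cauchy:
  assumes D: "norm D \<le> 1"
  shows "Cauchy (sq_iter (D :: 'a::banach \<Rightarrow>\<^sub>L 'a))"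
proof -
  have inc: "incseq sq_scalar"
    by (rule incseq_SucI) (use sq_scalar_bounds in blast)
  have "convergent sq_scalar"
    by (rule Bseq_mono_convergent)
      (use sq_scalar_bounds inc in \<open>auto intro!: BseqI'[where K = 1] simp: incseq_def\<close>)
  then have C: "Cauchy sq_scalar"
    by (simp add: convergent_Cauchy)
  have le: "norm (sq_iter D (n + k) - sq_iter D n) \<le> sq_scalar (n + k) - sq_scalar n" for n k
  proof (induction k)
    case (Suc k)
    have "norm (sq_iter D (n + Suc k) - sq_iter D n)
        \<le> norm (sq_iter D (Suc (n + k)) - sq_iter D (n + k)) + norm (sq_iter D (n + k) - sq_iter D n)"
      by (metis add_Suc_right diff_add_cancel add_diff_eq norm_triangle_ineq)
    then show ?case
      using Suc sq_iter_norm[OF D, of "n + k"] by (simp del: sq_iter.simps sq_scalar.simps)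
  qed simp
  show ?thesis
  proof (rule CauchyI')
    fix e :: real assume "0 < e"
    then obtain M where M: "\<And>m n. m \<ge> M \<Longrightarrow> n \<ge> M \<Longrightarrow> norm (sq_scalar m - sq_scalar n) < e"
      using CauchyD[OF C] by blast
    have "norm (sq_iter D m - sq_iter D n) < e" if "m \<ge> M" "n > m" for m n
    proof -
      have "norm (sq_iter D n - sq_iter D m) \<le> sq_scalar n - sq_scalar m"
        using le[of m "n - m"] that by simp
      also have "\<dots> < e"
        using M[of n m] that by (simp add: abs_less_iff)
      finally show ?thesis by (simp add: norm_minus_commute)
    qed
    then show "\<exists>M. \<forall>m\<ge>M. \<forall>n>m. dist (sq_iter D m) (sq_iter D n) < e"
      by (auto simp: dist_norm)
  qed
qed

lemma square_root_exists:
  fixes A :: "('a::complex_hilbert \<Rightarrow>\<^sub>L 'a) set"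
  assumes A: "star_subalgebra V A" "closed A" and D: "D \<in> A" "adj D = D" "norm D \<le> 1"
  obtains Y where "Y \<in> A" "adj Y = Y" "norm Y \<le> 1" "Y = (1/2) *\<^sub>R (D + (Y o\<^sub>L Y))"
    "\<And>S. S o\<^sub>L D = D o\<^sub>L S \<Longrightarrow> S o\<^sub>L Y = Y o\<^sub>L S"
proof -
  note AD = star_subalgebraD[OF A(1)]
  obtain Y where Y: "sq_iter D \<longlonglongrightarrow> Y"
    using sq_iter_Cauchy[OF D(3)] Cauchy_convergent convergent_def by blast
  have mem: "sq_iter D n \<in> A" for n
    by (induction n) (auto intro!: AD(3-5,8) D(1))
  have sa: "adj (sq_iter D n) = sq_iter D n" for n
    by (induction n) (auto simp: adj_scaleR adj_add adj_compose AD(2) D(1,2) mem)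
  have YA: "Y \<in> A"
    using closed_sequentially[OF A(2) _ Y] mem by blast
  have "(\<lambda>n. adj (sq_iter D n)) \<longlonglongrightarrow> adj Y"
    by (rule bounded_linear_adj_limit[OF Y]) (use mem YA AD(2) in blast)+
  then have "adj Y = Y"
    using Y LIMSEQ_unique by (simp add: sa) blast
  moreover have "norm Y \<le> 1"
  proof (rule LIMSEQ_le_const2[OF tendsto_norm[OF Y]])
    have "norm (sq_iter D n) \<le> 1" for n
      using sq_iter_norm[OF D(3), of n] sq_scalar_bounds[of n] by linarith
    then show "\<exists>N. \<forall>n\<ge>N. norm (sq_iter D n) \<le> 1" by blast
  qed
  moreover have "Y = (1/2) *\<^sub>R (D + (Y o\<^sub>L Y))"
  proof (rule LIMSEQ_unique[OF LIMSEQ_Suc[OF Y]])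
    show "(\<lambda>n. sq_iter D (Suc n)) \<longlonglongrightarrow> (1/2) *\<^sub>R (D + (Y o\<^sub>L Y))"
      unfolding sq_iter.simps
      by (intro tendsto_intros Y bounded_bilinear.tendsto[OF bounded_bilinear_blinfun_compose])
  qed
  moreover have "S o\<^sub>L Y = Y o\<^sub>L S" if "S o\<^sub>L D = D o\<^sub>L S" for S
  proof (rule LIMSEQ_unique)
    show "(\<lambda>n. S o\<^sub>L sq_iter D n) \<longlonglongrightarrow> (S o\<^sub>L Y)"
      by (intro bounded_bilinear.tendsto[OF bounded_bilinear_blinfun_compose] tendsto_const Y)
    show "(\<lambda>n. S o\<^sub>L sq_iter D n) \<longlonglongrightarrow> (Y o\<^sub>L S)"
      unfolding sq_iter_commute[OF that]
      by (intro bounded_bilinear.tendsto[OF bounded_bilinear_blinfun_compose] tendsto_const Y)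
  qed
  ultimately show thesis
    using that YA by blast
qed


subsection \<open>Star homomorphisms are contractive\<close>

lemma star_homD:
  fixes \<phi> :: "('a::complex_hilbert \<Rightarrow>\<^sub>L 'a) \<Rightarrow> ('b::complex_hilbert \<Rightarrow>\<^sub>L 'b)"
  assumes "star_hom A B \<phi>"
  shows "T \<in> A \<Longrightarrow> \<phi> T \<in> B" "S \<in> A \<Longrightarrow> T \<in> A \<Longrightarrow> \<phi> (S + T) = \<phi> S + \<phi> T"
    "S \<in> A \<Longrightarrow> T \<in> A \<Longrightarrow> \<phi> (S o\<^sub>L T) = \<phi> S o\<^sub>L \<phi> T" "T \<in> A \<Longrightarrow> \<phi> (adj T) = adj (\<phi> T)"
    "T \<in> A \<Longrightarrow> \<phi> (scaleC_op c T) = scaleC_op c (\<phi> T)" "T \<in> A \<Longrightarrow> \<phi> (r *\<^sub>R T) = r *\<^sub>R \<phi> T"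
proof -
  show *: "T \<in> A \<Longrightarrow> \<phi> T \<in> B" "S \<in> A \<Longrightarrow> T \<in> A \<Longrightarrow> \<phi> (S + T) = \<phi> S + \<phi> T"
    "S \<in> A \<Longrightarrow> T \<in> A \<Longrightarrow> \<phi> (S o\<^sub>L T) = \<phi> S o\<^sub>L \<phi> T" "T \<in> A \<Longrightarrow> \<phi> (adj T) = adj (\<phi> T)"
    "T \<in> A \<Longrightarrow> \<phi> (scaleC_op c T) = scaleC_op c (\<phi> T)" for S T c
    using assms by (auto simp: star_hom_def)
  show "T \<in> A \<Longrightarrow> \<phi> (r *\<^sub>R T) = r *\<^sub>R \<phi> T"
    using *(5)[of T "of_real r"] by (simp add: scaleC_op_of_real)
qed

text \<open>If \<open>a\<close> is self-adjoint with \<open>\<parallel>a\<parallel> \<le> 1\<close>, then \<open>1 - a\<^sup>2 = (1 - Y)\<^sup>2\<close> with \<open>Y\<close> self-adjoint in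
  the algebra, and this identity is preserved by a star homomorphism.\<close>

lemma star_hom_contractive:
  fixes A :: "('a::complex_hilbert \<Rightarrow>\<^sub>L 'a) set" and \<phi> :: "('a \<Rightarrow>\<^sub>L 'a) \<Rightarrow> ('b::complex_hilbert \<Rightarrow>\<^sub>L 'b)"
  assumes A: "star_subalgebra V A" "closed A" and B: "star_subalgebra W B"
    and \<phi>: "star_hom A B \<phi>" and T: "T \<in> A"
  shows "norm (\<phi> T) \<le> norm T"
proof -
  note AD = star_subalgebraD[OF A(1)] and BD = star_subalgebraD[OF B] and \<phi>D = star_homD[OF \<phi>]
  have unit_ball: "norm (\<phi> a) \<le> 1" if a: "a \<in> A" "adj a = a" "norm a \<le> 1" for a
  proof -
    have D: "a o\<^sub>L a \<in> A" "adj (a o\<^sub>L a) = a o\<^sub>L a" "norm (a o\<^sub>L a) \<le> 1"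
      using a AD norm_blinfun_compose[of a a] mult_mono[of "norm a" 1 "norm a" 1]
      by (auto simp: adj_compose)
    obtain Y where Y: "Y \<in> A" "adj Y = Y" "Y = (1/2) *\<^sub>R ((a o\<^sub>L a) + (Y o\<^sub>L Y))"
      using square_root_exists[OF A D] by metis
    define b where "b = \<phi> a"
    define Z where "Z = \<phi> Y"
    have b: "clin b" "adj b = b" and Z: "clin Z" "adj Z = Z"
      using \<phi>D(1,4) BD(2) a Y by (auto simp: b_def Z_def) metis+
    have "\<phi> Y = (1/2) *\<^sub>R ((\<phi> a o\<^sub>L \<phi> a) + (\<phi> Y o\<^sub>L \<phi> Y))"
      using arg_cong[OF Y(3), of \<phi>] a(1) Y(1) AD by (simp add: \<phi>D)
    then have ZZ: "(1/2) *\<^sub>R ((b o\<^sub>L b) + (Z o\<^sub>L Z)) = Z"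
      by (simp add: b_def Z_def)
    have "norm (b x) \<le> 1 * norm x" for x
    proof -
      have "(1/2) *\<^sub>R (b (b x) + Z (Z x)) = Z x"
        using arg_cong[OF ZZ, of "\<lambda>T. T x"] by (simp add: blinfun.bilinear_simps)
      then have "(2::real) *\<^sub>R ((1/2) *\<^sub>R (b (b x) + Z (Z x))) = 2 *\<^sub>R Z x"
        by simp
      then have eq: "b (b x) = 2 *\<^sub>R Z x - Z (Z x)"
        by (simp add: algebra_simps)
      have bb: "(norm (b x))\<^sup>2 = inner x (b (b x))"
        using cinner_adj_right[OF b(1), of x "b x"]
        by (metis Re_cinner b(2) power2_norm_eq_inner)
      have ZZ2: "inner x (Z (Z x)) = inner (Z x) (Z x)"
        using cinner_adj_right[OF Z(1), of x "Z x"] by (metis Re_cinner Z(2))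
      have "(norm (b x))\<^sup>2 = 2 * inner x (Z x) - inner (Z x) (Z x)"
        unfolding bb eq by (simp add: inner_diff_right ZZ2)
      moreover have "(norm (x - Z x))\<^sup>2 = (norm x)\<^sup>2 - 2 * inner x (Z x) + inner (Z x) (Z x)"
        by (simp add: power2_norm_eq_inner inner_diff_left inner_diff_right inner_commute)
      ultimately have "(norm (b x))\<^sup>2 + (norm (x - Z x))\<^sup>2 = (norm x)\<^sup>2"
        by simp
      then have "(norm (b x))\<^sup>2 \<le> (norm x)\<^sup>2"
        using zero_le_power2[of "norm (x - Z x)"] by linarith
      then have "norm (b x) \<le> norm x"
        by (rule power2_le_imp_le) (rule norm_ge_zero)
      then show ?thesis
        by (simp only: mult_1)
    qed
    then show ?thesis
      unfolding b_def[symmetric] norm_blinfun_le_iff by auto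
  qed
  have sa: "norm (\<phi> a) \<le> norm a" if a: "a \<in> A" "adj a = a" for a
  proof (cases "a = 0")
    case True
    then show ?thesis
      using \<phi>D(6)[of 0 0] AD(3) by simp
  next
    case False
    then have "norm (\<phi> ((1 / norm a) *\<^sub>R a)) \<le> 1"
      using a AD by (intro unit_ball) (auto simp: adj_scaleR)
    then show ?thesis
      using False a(1) by (simp add: \<phi>D(6) field_simps)
  qed
  have TT: "adj T o\<^sub>L T \<in> A" "adj (adj T o\<^sub>L T) = adj T o\<^sub>L T"
    using T AD by (auto simp: adj_compose adj_adj)
  have "(norm (\<phi> T))\<^sup>2 = norm (\<phi> (adj T o\<^sub>L T))"
    using T AD \<phi>D BD by (simp add: norm_adj_compose)
  also have "\<dots> \<le> norm (adj T o\<^sub>L T)"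
    by (rule sa[OF TT])
  also have "\<dots> = (norm T)\<^sup>2"
    using T AD by (simp add: norm_adj_compose)
  finally show ?thesis
    by (rule power2_le_imp_le) simp
qed


subsection \<open>Positive parts\<close>

text \<open>The operator \<open>x = U + (U\<^sup>2)\<^bsup>1/2\<^esup>\<close>, twice the positive part of \<open>U\<close>, vanishes on every subset
  \<open>K\<close> invariant under \<open>x\<close> on which the quadratic form of \<open>U\<close> is at most \<open>0\<close>, and this form is at
  most \<open>0\<close> at every vector killed by \<open>x\<close>. The operator \<open>I\<close> is the unit of the algebra.\<close>

lemma positive_part_exists:
  fixes A :: "('a::complex_hilbert \<Rightarrow>\<^sub>L 'a) set"
  assumes A: "star_subalgebra V A" "closed A" and U: "U \<in> A" "adj U = U"
    and I: "I \<in> A" "\<And>v. v \<in> V \<Longrightarrow> I v = v"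
  obtains x where "x \<in> A"
    "\<And>K v. K \<subseteq> V \<Longrightarrow> (\<And>v. v \<in> K \<Longrightarrow> x v \<in> K) \<Longrightarrow> (\<And>v. v \<in> K \<Longrightarrow> inner v (U v) \<le> 0) \<Longrightarrow> v \<in> K \<Longrightarrow> x v = 0"
    "\<And>v. v \<in> V \<Longrightarrow> x v = 0 \<Longrightarrow> inner v (U v) \<le> 0"
proof -
  note AD = star_subalgebraD[OF A(1)]
  have AV: "T v \<in> V" if "T \<in> A" for T v
    using AD(1)[OF that] opsD(2) by blast
  have IT: "I o\<^sub>L T = T" if "T \<in> A" for T
    by (rule blinfun_eqI) (simp add: AV I(2) that)
  have IA: "adj I = I"
  proof -
    have "I o\<^sub>L adj I = adj I" using IT AD(6) I(1) by blast
    then show ?thesis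
      using adj_compose[of I "adj I"] AD(2) I(1) AD(6) by (metis adj_adj)
  qed
  have TI: "T o\<^sub>L I = T" if "T \<in> A" "adj T = T" for T
    using adj_compose[of I T] IT[OF that(1)] IA AD(2) I(1) that by simp
  \<comment> \<open>The square root is \<open>M = r (1 - Y)\<close>, where \<open>Y\<close> belongs to \<open>D = 1 - U\<^sup>2 / r\<^sup>2\<close>; the summand \<open>1\<close>
    in \<open>r\<close> covers the case \<open>U = 0\<close>.\<close>
  define r where "r = norm U + 1"
  have r: "r > 0" "norm U \<le> r" by (auto simp: r_def add_nonneg_pos)
  define S where "S = (1 / r\<^sup>2) *\<^sub>R (U o\<^sub>L U)"
  have S: "S \<in> A" "adj S = S" "norm S \<le> 1"
  proof -
    show "S \<in> A" "adj S = S"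
      using U AD by (auto simp: S_def adj_scaleR adj_compose)
    have "norm (U o\<^sub>L U) \<le> r\<^sup>2"
      using norm_blinfun_compose[of U U] mult_mono[OF r(2) r(2)] r(1) by (simp add: power2_eq_square)
    then show "norm S \<le> 1"
      using r by (simp add: S_def field_simps)
  qed
  have inner_S: "inner v (S v) = (norm (U v))\<^sup>2 / r\<^sup>2" for v
  proof -
    have "inner v (U (U v)) = inner (U v) (U v)"
      using cinner_adj_right[OF AD(2)[OF U(1)], of v "U v"] by (metis Re_cinner U(2))
    then show ?thesis
      by (simp add: S_def blinfun.scaleR_left power2_norm_eq_inner)
  qed
  define D where "D = I - S"
  have D: "D \<in> A" "adj D = D"
    using I(1) S AD IA by (auto simp: D_def adj_diff)
  have normD: "norm D \<le> 1"
  proof -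
    have pos: "0 \<le> inner v (D v)" "inner v (D v) \<le> (norm v)\<^sup>2" if "v \<in> V" for v
    proof -
      have "(norm (U v))\<^sup>2 \<le> (r * norm v)\<^sup>2"
        using norm_blinfun[of U v] mult_right_mono[OF r(2) norm_ge_zero[of v]]
        by (intro power_mono) auto
      then have "(norm (U v))\<^sup>2 / r\<^sup>2 \<le> (norm v)\<^sup>2"
        using r by (simp add: field_simps power_mult_distrib)
      then show "0 \<le> inner v (D v)" "inner v (D v) \<le> (norm v)\<^sup>2"
        by (simp_all add: D_def blinfun.diff_left inner_diff_right I(2)[OF that] inner_S power2_norm_eq_inner)
    qed
    \<comment> \<open>A positive operator \<open>D\<close> with \<open>\<langle>v, D v\<rangle> \<le> \<parallel>v\<parallel>\<^sup>2\<close> satisfies \<open>\<parallel>D v\<parallel>\<^sup>2 \<le> \<langle>v, D v\<rangle>\<close>: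
      expand \<open>0 \<le> \<langle>w, D w\<rangle>\<close> for \<open>w = v - D v\<close>.\<close>
    have bound: "norm (D v) \<le> norm v" if v: "v \<in> V" for v
    proof -
      have sa: "inner a (D b) = inner (D a) b" for a b
        using cinner_adj_right[OF AD(2)[OF D(1)], of a b] by (metis Re_cinner D(2))
      have w: "v - D v = (I - D) v" "(I - D) v \<in> V"
      proof -
        show "v - D v = (I - D) v"
          by (simp add: blinfun.diff_left I(2) v)
        show "(I - D) v \<in> V"
          by (rule AV[OF AD(9)[OF I(1) D(1)]])
      qed
      have "0 \<le> inner (v - D v) (D (v - D v))"
        using pos(1) w by simp
      also have "\<dots> = inner v (D v) - 2 * (norm (D v))\<^sup>2 + inner (D v) (D (D v))"
        by (simp add: blinfun.diff_right inner_diff_left inner_diff_right sa power2_norm_eq_inner)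
      also have "\<dots> \<le> inner v (D v) - (norm (D v))\<^sup>2"
        using pos(2)[of "D v"] AV[OF D(1)] by simp
      finally have "(norm (D v))\<^sup>2 \<le> (norm v)\<^sup>2"
        using pos(2)[OF v] by linarith
      then show ?thesis by (rule power2_le_imp_le) simp
    qed
    have DI: "D o\<^sub>L I = D" by (rule TI[OF D])
    have nI: "norm (I v) \<le> norm v" for v
    proof -
      have "(norm (I v))\<^sup>2 = inner v (I (I v))"
        using cinner_adj_right[OF AD(2)[OF I(1)], of v "I v"] by (metis Re_cinner IA power2_norm_eq_inner)
      also have "\<dots> \<le> norm v * norm (I v)"
        by (simp add: I AV norm_cauchy_schwarz)
      finally show ?thesis
        by (cases "I v = 0") (auto simp: power2_eq_square)
    qed
    have "norm (D v) \<le> 1 * norm v" for v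
      using bound[OF AV[OF I(1)], of v] nI[of v] arg_cong[OF DI, of "\<lambda>T. T v"] by simp
    then show ?thesis
      unfolding norm_blinfun_le_iff by auto
  qed
  obtain Y where Y: "Y \<in> A" "adj Y = Y" "norm Y \<le> 1" "Y = (1/2) *\<^sub>R (D + (Y o\<^sub>L Y))"
      "\<And>T. T o\<^sub>L D = D o\<^sub>L T \<Longrightarrow> T o\<^sub>L Y = Y o\<^sub>L T"
    using square_root_exists[OF A D normD] by metis
  define M where "M = r *\<^sub>R (I - Y)"
  have M: "M \<in> A" "adj M = M"
    using I(1) Y(1,2) AD IA by (auto simp: M_def adj_diff adj_scaleR)
  have UD: "U o\<^sub>L D = D o\<^sub>L U"
    using TI[OF U] IT[OF U(1)] by (simp add: D_def S_def blinfun_compose_bilinear blinfun_compose_assoc)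
  have UM: "U o\<^sub>L M = M o\<^sub>L U"
    using Y(5)[OF UD] TI[OF U] IT[OF U(1)] by (simp add: M_def blinfun_compose_bilinear)
  have MM: "M o\<^sub>L M = U o\<^sub>L U"
  proof -
    have "(2::real) *\<^sub>R Y = D + (Y o\<^sub>L Y)"
      using arg_cong[OF Y(4), of "\<lambda>T. (2::real) *\<^sub>R T"] by simp
    moreover have "M o\<^sub>L M = (r * r) *\<^sub>R (I - 2 *\<^sub>R Y + (Y o\<^sub>L Y))"
    proof -
      have "(I - Y) o\<^sub>L (I - Y) = I - 2 *\<^sub>R Y + (Y o\<^sub>L Y)"
        using TI[OF Y(1,2)] IT[OF Y(1)] IT[OF I(1)]
        by (simp add: blinfun_compose_bilinear scaleR_2)
      then show ?thesis
        by (simp only: M_def blinfun_compose_bilinear(5,6) scaleR_scaleR)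
    qed
    moreover have "I - (D + (Y o\<^sub>L Y)) + (Y o\<^sub>L Y) = S"
      by (simp add: D_def)
    moreover have "(r * r) *\<^sub>R S = U o\<^sub>L U"
      using r by (simp add: S_def power2_eq_square)
    ultimately show ?thesis
      by (simp only:)
  qed
  have Mpos: "0 \<le> inner v (M v)" if "v \<in> V" for v
  proof -
    have "inner v (Y v) \<le> norm v * norm (Y v)" by (rule norm_cauchy_schwarz)
    also have "\<dots> \<le> norm v * (1 * norm v)"
      using Y(3) by (intro mult_left_mono) (auto simp: norm_blinfun_le_iff)
    finally have "inner v (Y v) \<le> inner v v"
      by (simp add: power2_norm_eq_inner flip: power2_eq_square)
    then show ?thesis
      using r by (simp add: M_def blinfun.bilinear_simps I(2)[OF that] inner_diff_right)
  qed
  define x where "x = U + M"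
  have x: "x \<in> A" "adj x = x"
    using U M AD by (auto simp: x_def adj_add)
  show thesis
  proof (rule that[OF x(1)])
    show "x v = 0"
      if K: "K \<subseteq> V" and inv: "\<And>v. v \<in> K \<Longrightarrow> x v \<in> K" and neg: "\<And>v. v \<in> K \<Longrightarrow> inner v (U v) \<le> 0"
        and v: "v \<in> K" for K v
    proof -
      define w where "w = x v"
      have wK: "w \<in> K" "w \<in> V" using inv v K by (auto simp: w_def)
      have UMv: "U (M v) = M (U v)" "M (M v) = U (U v)"
        using arg_cong[OF UM, of "\<lambda>T. T v"] arg_cong[OF MM, of "\<lambda>T. T v"] by simp_all
      have "M w = U w"
        by (simp add: w_def x_def blinfun.bilinear_simps UMv)
      then have Mw0: "inner w (M w) = 0"
        using neg[OF wK(1)] Mpos[OF wK(2)] by simp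
      have sa: "inner a (M b) = inner (M a) b" for a b
        using cinner_adj_right[OF AD(2)[OF M(1)], of a b] by (metis Re_cinner M(2))
      \<comment> \<open>A positive operator kills the vectors on which its quadratic form vanishes.\<close>
      have "M w = 0"
      proof (rule ccontr)
        assume nz: "M w \<noteq> 0"
        define t where "t = inner (M w) (M w)"
        define q where "q = inner (M w) (M (M w))"
        have t: "t > 0" using nz by (simp add: t_def)
        have q: "q \<ge> 0" unfolding q_def by (rule Mpos) (use AV M in blast)
        have Vm: "w - e *\<^sub>R M w \<in> V" for e
        proof -
          have "w - e *\<^sub>R M w = (I - e *\<^sub>R M) w" by (simp add: blinfun.bilinear_simps I(2) wK)
          then show ?thesis using AV AD(8,9) I(1) M(1) by metis
        qed
        have "0 \<le> - 2 * e * t + e\<^sup>2 * q" for e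
        proof -
          have "0 \<le> inner (w - e *\<^sub>R M w) (M (w - e *\<^sub>R M w))" by (rule Mpos[OF Vm])
          also have "\<dots> = - 2 * e * t + e\<^sup>2 * q"
            using Mw0 by (simp add: blinfun.bilinear_simps inner_diff_left inner_diff_right sa t_def q_def
                power2_eq_square algebra_simps)
          finally show ?thesis .
        qed
        note quad = this
        define e where "e = t / (q + 1)"
        have e: "e > 0" "e * (q + 1) = t" using t q by (auto simp: e_def)
        have "0 \<le> e * (- 2 * t + e * q)"
          using quad[of e] by (simp add: power2_eq_square algebra_simps)
        then have "2 * t \<le> e * q"
          using e(1) by (simp add: zero_le_mult_iff)
        also have "\<dots> \<le> e * (q + 1)"
          using e by (intro mult_left_mono) auto
        finally show False using t e(2) by simp
      qed
      then have "x w = 0"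
        using \<open>M w = U w\<close> by (simp add: x_def blinfun.add_left)
      then have "cinner (x v) (x v) = 0"
        using cinner_adj_right[OF AD(2)[OF x(1)], of v "x v"] x(2) by (simp add: w_def)
      then show ?thesis by simp
    qed
    show "inner v (U v) \<le> 0" if v: "v \<in> V" "x v = 0" for v
    proof -
      have "U v = - M v"
        using v(2) by (simp add: x_def blinfun.add_left eq_neg_iff_add_eq_0)
      then show ?thesis using Mpos[OF v(1)] by simp
    qed
  qed
qed


section \<open>Unitary representations and weak containment\<close>

lemma unitary_repD:
  fixes \<pi> :: "'g \<Rightarrow> 'a::complex_hilbert \<Rightarrow>\<^sub>L 'a"
  assumes "unitary_rep G V \<pi>"
  shows "closed_csubspace V" "g \<in> carrier G \<Longrightarrow> \<pi> g \<in> ops V"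
    "g \<in> carrier G \<Longrightarrow> \<xi> \<in> V \<Longrightarrow> \<eta> \<in> V \<Longrightarrow> cinner (\<pi> g \<xi>) (\<pi> g \<eta>) = cinner \<xi> \<eta>"
    "\<xi> \<in> V \<Longrightarrow> \<pi> \<one>\<^bsub>G\<^esub> \<xi> = \<xi>"
    "g \<in> carrier G \<Longrightarrow> h \<in> carrier G \<Longrightarrow> \<pi> (g \<otimes>\<^bsub>G\<^esub> h) = \<pi> g o\<^sub>L \<pi> h"
    "g \<in> carrier G \<Longrightarrow> \<xi> \<in> V \<Longrightarrow> norm (\<pi> g \<xi>) = norm \<xi>"
    "g \<in> carrier G \<Longrightarrow> clin (\<pi> g)" "g \<in> carrier G \<Longrightarrow> \<pi> g \<xi> \<in> V"
proof -
  show *: "closed_csubspace V" "\<And>g. g \<in> carrier G \<Longrightarrow> \<pi> g \<in> ops V"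
    "\<And>g \<xi> \<eta>. g \<in> carrier G \<Longrightarrow> \<xi> \<in> V \<Longrightarrow> \<eta> \<in> V \<Longrightarrow> cinner (\<pi> g \<xi>) (\<pi> g \<eta>) = cinner \<xi> \<eta>"
    "\<xi> \<in> V \<Longrightarrow> \<pi> \<one>\<^bsub>G\<^esub> \<xi> = \<xi>"
    "g \<in> carrier G \<Longrightarrow> h \<in> carrier G \<Longrightarrow> \<pi> (g \<otimes>\<^bsub>G\<^esub> h) = \<pi> g o\<^sub>L \<pi> h"
    using assms by (auto simp: unitary_rep_def)
  show "g \<in> carrier G \<Longrightarrow> clin (\<pi> g)" "g \<in> carrier G \<Longrightarrow> \<pi> g \<xi> \<in> V"
    using *(2) ops_clin opsD(2) by blast+
  assume "g \<in> carrier G" "\<xi> \<in> V"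
  then have "complex_of_real ((norm (\<pi> g \<xi>))\<^sup>2) = complex_of_real ((norm \<xi>)\<^sup>2)"
    unfolding cinner_self[symmetric] by (rule *(3)) fact
  then have "(norm (\<pi> g \<xi>))\<^sup>2 = (norm \<xi>)\<^sup>2"
    using of_real_eq_iff by blast
  then show "norm (\<pi> g \<xi>) = norm \<xi>"
    by (simp add: power2_eq_iff_nonneg)
qed

lemma unitary_rep_inv:
  fixes \<pi> :: "'g \<Rightarrow> 'a::complex_hilbert \<Rightarrow>\<^sub>L 'a"
  assumes G: "group G" and R: "unitary_rep G V \<pi>" and g: "g \<in> carrier G" and v: "v \<in> V"
  shows "\<pi> g (\<pi> (inv\<^bsub>G\<^esub> g) v) = v" "\<pi> (inv\<^bsub>G\<^esub> g) (\<pi> g v) = v"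
proof -
  interpret group G by (rule G)
  show "\<pi> g (\<pi> (inv\<^bsub>G\<^esub> g) v) = v" "\<pi> (inv\<^bsub>G\<^esub> g) (\<pi> g v) = v"
    using unitary_repD(5)[OF R, of g "inv\<^bsub>G\<^esub> g"] unitary_repD(5)[OF R, of "inv\<^bsub>G\<^esub> g" g]
      unitary_repD(4)[OF R v] g
    by (metis blinfun_apply_blinfun_compose inv_closed l_inv r_inv)+
qed

lemma unitary_rep_norm_le:
  fixes \<pi> :: "'g \<Rightarrow> 'a::complex_hilbert \<Rightarrow>\<^sub>L 'a"
  assumes "unitary_rep G V \<pi>" "g \<in> carrier G"
  shows "norm (\<pi> g x) \<le> norm x"
proof -
  obtain p where p: "p \<in> V" "norm p \<le> norm x" "\<forall>v\<in>V. cinner v (x - p) = 0" "\<forall>T\<in>ops V. T x = T p"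
    using ops_decompose[OF unitary_repD(1)[OF assms(1)], of x] by (elim exE conjE)
  show ?thesis
    using p(2) unitary_repD(6)[OF assms p(1)] p(4)[rule_format, OF unitary_repD(2)[OF assms]] by simp
qed

lemma adj_unitary_rep:
  fixes \<pi> :: "'g \<Rightarrow> 'a::complex_hilbert \<Rightarrow>\<^sub>L 'a"
  assumes G: "group G" and R: "unitary_rep G V \<pi>" and g: "g \<in> carrier G"
  shows "adj (\<pi> g) = \<pi> (inv\<^bsub>G\<^esub> g)"
proof (rule adj_eqI)
  interpret group G by (rule G)
  fix x y
  note RD = unitary_repD[OF R]
  obtain p where p: "p \<in> V" "norm p \<le> norm x" "\<forall>v\<in>V. cinner v (x - p) = 0" "\<forall>T\<in>ops V. T x = T p"
    using ops_decompose[OF RD(1), of x] by (elim exE conjE)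
  obtain q where q: "q \<in> V" "norm q \<le> norm y" "\<forall>v\<in>V. cinner v (y - q) = 0" "\<forall>T\<in>ops V. T y = T q"
    using ops_decompose[OF RD(1), of y] by (elim exE conjE)
  have xp: "cinner x v = cinner p v" if "v \<in> V" for v
    using p(3)[rule_format, OF that] cinner_eq_0_commute[of v "x - p"] by (simp add: cinner_diff_left)
  have yq: "cinner v y = cinner v q" if "v \<in> V" for v
    using q(3)[rule_format, OF that] by (simp add: cinner_diff_right)
  have "cinner (\<pi> (inv\<^bsub>G\<^esub> g) x) y = cinner (\<pi> (inv\<^bsub>G\<^esub> g) p) q"
    using RD(2,8) g by (simp add: p(4) yq)
  also have "\<dots> = cinner (\<pi> g (\<pi> (inv\<^bsub>G\<^esub> g) p)) (\<pi> g q)"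
    using RD(3,8) g q(1) by simp
  also have "\<dots> = cinner x (\<pi> g y)"
    using RD(2,8) g by (simp add: unitary_rep_inv[OF G R g p(1)] q(4) xp)
  finally show "cinner (\<pi> (inv\<^bsub>G\<^esub> g) x) y = cinner x (\<pi> g y)" .
qed


subsection \<open>The group algebra\<close>

text \<open>An element of the complex group algebra is given by a list of coefficients and group
  elements.\<close>

definition lincomb :: "('g \<Rightarrow> 'a::complex_hilbert \<Rightarrow>\<^sub>L 'a) \<Rightarrow> (complex \<times> 'g) list \<Rightarrow> 'a \<Rightarrow>\<^sub>L 'a" where
  "lincomb \<pi> xs = (\<Sum>(c, g)\<leftarrow>xs. scaleC_op c (\<pi> g))"

lemma lincomb_simps [simp]:
  "lincomb \<pi> [] = 0" "lincomb \<pi> ((c, g) # xs) = scaleC_op c (\<pi> g) + lincomb \<pi> xs"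
  "lincomb \<pi> (xs @ ys) = lincomb \<pi> xs + lincomb \<pi> ys"
  by (auto simp: lincomb_def)

lemma scaleC_op_simps:
  fixes S T :: "'a::complex_hilbert \<Rightarrow>\<^sub>L 'a"
  shows "scaleC_op c (S + T) = scaleC_op c S + scaleC_op c T" "scaleC_op c 0 = 0"
    "scaleC_op c (scaleC_op d T) = scaleC_op (c * d) T" "scaleC_op c S o\<^sub>L T = scaleC_op c (S o\<^sub>L T)"
    "clin S \<Longrightarrow> S o\<^sub>L scaleC_op c T = scaleC_op c (S o\<^sub>L T)"
  by (rule blinfun_eqI; simp add: blinfun.bilinear_simps scaleC_add_right scaleC_scaleC clinD)+

lemma tendsto_scaleC_op:
  fixes T :: "'a::complex_hilbert \<Rightarrow>\<^sub>L 'a"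
  assumes "f \<longlonglongrightarrow> T"
  shows "(\<lambda>n. scaleC_op c (f n)) \<longlonglongrightarrow> scaleC_op c T"
proof -
  have "norm (scaleC_op c S) \<le> cmod c * norm S" for S :: "'a \<Rightarrow>\<^sub>L 'a"
    unfolding norm_blinfun_le_iff
    by (simp add: norm_scaleC mult.assoc mult_left_mono norm_blinfun)
  then have "bounded_linear (scaleC_op c :: ('a \<Rightarrow>\<^sub>L 'a) \<Rightarrow> _)"
    by (intro bounded_linear_intro[where K = "cmod c"] blinfun_eqI)
      (auto simp: blinfun.bilinear_simps scaleC_add_right scaleC_scaleR mult.commute)
  then show ?thesis
    using assms by (rule bounded_linear.tendsto)
qed

lemma lincomb_scale: "lincomb \<pi> (map (\<lambda>(d, g). (c * d, g)) xs) = scaleC_op c (lincomb \<pi> xs)"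
  by (induction xs) (auto simp: scaleC_op_simps)

lemma lincomb_adj:
  assumes "group G" "unitary_rep G V \<pi>" "snd ` set xs \<subseteq> carrier G"
  shows "lincomb \<pi> (map (\<lambda>(d, g). (cnj d, inv\<^bsub>G\<^esub> g)) xs) = adj (lincomb \<pi> xs) \<and> clin (lincomb \<pi> xs)"
  using assms(3) by (induction xs)
    (auto simp: adj_add adj_scaleC_op adj_unitary_rep[OF assms(1,2)] unitary_repD(7)[OF assms(2)])

lemma lincomb_mult:
  assumes "group G" "unitary_rep G V \<pi>" "snd ` set xs \<subseteq> carrier G" "snd ` set ys \<subseteq> carrier G"
  shows "lincomb \<pi> (concat (map (\<lambda>(c, g). map (\<lambda>(d, h). (c * d, g \<otimes>\<^bsub>G\<^esub> h)) ys) xs))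
    = lincomb \<pi> xs o\<^sub>L lincomb \<pi> ys"
  using assms(3)
proof (induction xs)
  case (Cons x xs)
  obtain c g where x: "x = (c, g)" by (cases x)
  have g: "g \<in> carrier G" using Cons.prems by (simp add: x)
  have "lincomb \<pi> (map (\<lambda>(d, h). (c * d, g \<otimes>\<^bsub>G\<^esub> h)) ys) = scaleC_op c (\<pi> g) o\<^sub>L lincomb \<pi> ys"
    using assms(4) by (induction ys)
      (auto simp: blinfun_compose_bilinear scaleC_op_simps unitary_repD(5,7)[OF assms(2)] g)
  then show ?case
    using Cons by (simp add: x blinfun_compose_bilinear)
qed (simp add: blinfun_compose_bilinear)

lemma lincomb_mult_carrier:
  assumes "group G" "snd ` set xs \<subseteq> carrier G" "snd ` set ys \<subseteq> carrier G"
  shows "snd ` set (concat (map (\<lambda>(c, g). map (\<lambda>(d, h). (c * d, g \<otimes>\<^bsub>G\<^esub> h)) ys) xs)) \<subseteq> carrier G"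
proof -
  interpret group G by (rule assms(1))
  show ?thesis using assms(2,3) by fastforce
qed

lemma lincomb_adj_carrier:
  assumes "group G" "snd ` set xs \<subseteq> carrier G"
  shows "snd ` set (map (\<lambda>(d, g). (cnj d, inv\<^bsub>G\<^esub> g)) xs) \<subseteq> carrier G"
proof -
  interpret group G by (rule assms(1))
  show ?thesis using assms(2) by fastforce
qed

lemma lincomb_scale_carrier: "snd ` set (map (\<lambda>(d, g). (c * d, g)) xs) = snd ` set xs"
  by force

lemma lincomb_invariant:
  fixes \<pi> :: "'g \<Rightarrow> 'a::complex_hilbert \<Rightarrow>\<^sub>L 'a"
  assumes "closed_csubspace W" "\<And>g w. g \<in> carrier G \<Longrightarrow> w \<in> W \<Longrightarrow> \<pi> g w \<in> W"
    "snd ` set xs \<subseteq> carrier G" "w \<in> W"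
  shows "lincomb \<pi> xs w \<in> W"
  using assms(3) by (induction xs)
    (auto simp: closed_csubspaceD[OF assms(1)] assms(2,4) blinfun.add_left)

lemma lincomb_in_star_subalgebra:
  assumes "star_subalgebra V A" "\<pi> ` carrier G \<subseteq> A" "snd ` set xs \<subseteq> carrier G"
  shows "lincomb \<pi> xs \<in> A"
  using assms(3)
  by (induction xs) (use star_subalgebraD[OF assms(1)] assms(2) in auto)

lemma rep_cstar_props:
  assumes "unitary_rep G V \<pi>"
  shows "star_subalgebra V (rep_cstar G V \<pi>)" "closed (rep_cstar G V \<pi>)"
    "snd ` set xs \<subseteq> carrier G \<Longrightarrow> lincomb \<pi> xs \<in> rep_cstar G V \<pi>"
    "g \<in> carrier G \<Longrightarrow> \<pi> g \<in> rep_cstar G V \<pi>"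
proof -
  have S: "\<pi> ` carrier G \<subseteq> ops V" using unitary_repD(2)[OF assms] by auto
  show *: "star_subalgebra V (rep_cstar G V \<pi>)" "closed (rep_cstar G V \<pi>)"
    using cstar_generated_star_subalgebra[OF unitary_repD(1)[OF assms] S] by (auto simp: rep_cstar_def)
  have sub: "\<pi> ` carrier G \<subseteq> rep_cstar G V \<pi>"
    using cstar_generated_star_subalgebra[OF unitary_repD(1)[OF assms] S] by (auto simp: rep_cstar_def)
  then show "g \<in> carrier G \<Longrightarrow> \<pi> g \<in> rep_cstar G V \<pi>" by auto
  show "snd ` set xs \<subseteq> carrier G \<Longrightarrow> lincomb \<pi> xs \<in> rep_cstar G V \<pi>"
    by (rule lincomb_in_star_subalgebra[OF *(1) sub])
qed

text \<open>The C*-algebra generated by a representation is the closure of the image of the group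
  algebra.\<close>

lemma rep_cstar_approx:
  fixes \<pi> :: "'g \<Rightarrow> 'a::complex_hilbert \<Rightarrow>\<^sub>L 'a"
  assumes G: "group G" and R: "unitary_rep G V \<pi>" and T: "T \<in> rep_cstar G V \<pi>"
  obtains xs where "\<And>n. snd ` set (xs n) \<subseteq> carrier G" "(\<lambda>n. lincomb \<pi> (xs n)) \<longlonglongrightarrow> T"
proof -
  define B where "B = {lincomb \<pi> xs | xs. snd ` set xs \<subseteq> carrier G}"
  note RD = unitary_repD[OF R]
  have BI: "lincomb \<pi> xs \<in> B" if "snd ` set xs \<subseteq> carrier G" for xs
    using that by (auto simp: B_def)
  have mem: "T \<in> closure B \<longleftrightarrow> (\<exists>f. (\<forall>n. f n \<in> B) \<and> f \<longlonglongrightarrow> T)" for T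
    by (rule closure_sequential)
  have memI: "T \<in> closure B" if "\<And>n. f n \<in> B" "f \<longlonglongrightarrow> T" for f T
    using that by (auto simp: mem)
  have V: "closed (ops V)" "star_subalgebra V (ops V)"
    using ops_simps[OF RD(1)] closed_ops[OF closed_csubspaceD(1)[OF RD(1)]] by (auto simp: star_subalgebra_def)
  have "B \<subseteq> ops V"
    using lincomb_in_star_subalgebra[OF V(2), of \<pi> G] RD(2) by (auto simp: B_def)
  then have cl: "closure B \<subseteq> ops V"
    using closure_minimal V(1) by blast
  have Badd: "S + T \<in> B" and Bmult: "S o\<^sub>L T \<in> B" and Badj: "adj T \<in> B" and Bscale: "scaleC_op c T \<in> B"
    if ST: "S \<in> B" "T \<in> B" for S T c
  proof -
    obtain xs ys where xs: "S = lincomb \<pi> xs" "snd ` set xs \<subseteq> carrier G"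
        and ys: "T = lincomb \<pi> ys" "snd ` set ys \<subseteq> carrier G"
      using ST by (auto simp: B_def)
    show "S + T \<in> B"
      using BI[of "xs @ ys"] xs ys by (simp add: image_Un)
    show "S o\<^sub>L T \<in> B"
      using BI[OF lincomb_mult_carrier[OF G xs(2) ys(2)]] lincomb_mult[OF G R xs(2) ys(2)] xs ys by simp
    show "adj T \<in> B"
      using BI[OF lincomb_adj_carrier[OF G ys(2)]] lincomb_adj[OF G R ys(2)] ys by simp
    show "scaleC_op c T \<in> B"
      using BI[of "map (\<lambda>(d, g). (c * d, g)) ys"] ys(2) unfolding lincomb_scale_carrier lincomb_scale ys(1)
      by simp
  qed
  have "star_subalgebra V (closure B)"
    unfolding star_subalgebra_def
  proof (intro conjI ballI allI cl)
    show "0 \<in> closure B"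
      using BI[of "[]"] closure_subset by fastforce
    fix S T assume "S \<in> closure B" "T \<in> closure B"
    then obtain f h where f: "\<And>n. f n \<in> B" "f \<longlonglongrightarrow> S" and h: "\<And>n. h n \<in> B" "h \<longlonglongrightarrow> T"
      unfolding mem by auto
    have "(\<lambda>n. f n + h n) \<longlonglongrightarrow> S + T"
      by (intro tendsto_intros f h)
    then show "S + T \<in> closure B"
      by (rule memI[OF Badd[OF f(1) h(1)]])
    have "(\<lambda>n. f n o\<^sub>L h n) \<longlonglongrightarrow> (S o\<^sub>L T)"
      by (intro bounded_bilinear.tendsto[OF bounded_bilinear_blinfun_compose] f h)
    then show "S o\<^sub>L T \<in> closure B"
      by (rule memI[OF Bmult[OF f(1) h(1)]])
  next
    fix T assume T: "T \<in> closure B"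
    then obtain f where f: "\<And>n. f n \<in> B" "f \<longlonglongrightarrow> T"
      unfolding mem by auto
    have "(\<lambda>n. adj (f n)) \<longlonglongrightarrow> adj T"
      by (rule bounded_linear_adj_limit[OF f(2)]) (use f(1) T cl closure_subset[of B] ops_clin in blast)+
    then show "adj T \<in> closure B"
      by (rule memI[OF Badj[OF f(1) f(1)]])
  next
    fix c T assume "T \<in> closure B"
    then obtain f where f: "\<And>n. f n \<in> B" "f \<longlonglongrightarrow> T"
      unfolding mem by auto
    have "(\<lambda>n. scaleC_op c (f n)) \<longlonglongrightarrow> scaleC_op c T"
      by (rule tendsto_scaleC_op[OF f(2)])
    then show "scaleC_op c T \<in> closure B"
      by (rule memI[OF Bscale[OF f(1) f(1)]])
  qed
  moreover have "\<pi> g \<in> B" if "g \<in> carrier G" for g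
  proof -
    have "lincomb \<pi> [(1, g)] = \<pi> g"
      by (rule blinfun_eqI) simp
    then show ?thesis using BI[of "[(1, g)]"] that by simp
  qed
  then have "\<pi> ` carrier G \<subseteq> closure B"
    using closure_subset by blast
  ultimately have "rep_cstar G V \<pi> \<subseteq> closure B"
    unfolding rep_cstar_def cstar_generated_def by (intro Inter_lower) auto
  then obtain f where f: "\<And>n. f n \<in> B" "f \<longlonglongrightarrow> T"
    using T mem by blast
  then have "\<forall>n. \<exists>xs. f n = lincomb \<pi> xs \<and> snd ` set xs \<subseteq> carrier G"
    by (auto simp: B_def)
  then obtain xs where "\<And>n. f n = lincomb \<pi> (xs n)" "\<And>n. snd ` set (xs n) \<subseteq> carrier G"
    by metis
  then show thesis
    using that f(2) by (metis (no_types, lifting) ext)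
qed

lemma rep_cstar_invariant:
  fixes \<pi> :: "'g \<Rightarrow> 'a::complex_hilbert \<Rightarrow>\<^sub>L 'a"
  assumes "group G" "unitary_rep G V \<pi>" "T \<in> rep_cstar G V \<pi>"
    and W: "closed_csubspace W" "\<And>g w. g \<in> carrier G \<Longrightarrow> w \<in> W \<Longrightarrow> \<pi> g w \<in> W" and w: "w \<in> W"
  shows "T w \<in> W"
proof -
  obtain xs where xs: "\<And>n. snd ` set (xs n) \<subseteq> carrier G" "(\<lambda>n. lincomb \<pi> (xs n)) \<longlonglongrightarrow> T"
    using rep_cstar_approx[OF assms(1-3)] by metis
  have "(\<lambda>n. lincomb \<pi> (xs n) w) \<longlonglongrightarrow> T w"
    by (intro tendsto_intros xs)
  moreover have "lincomb \<pi> (xs n) w \<in> W" for n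
    by (rule lincomb_invariant[OF W(1) _ xs(1) w]) (rule W(2))
  ultimately show ?thesis
    using closed_sequentially[OF closed_csubspaceD(1)[OF W(1)], of "\<lambda>n. lincomb \<pi> (xs n) w" "T w"]
    by simp
qed

lemma commutant_lincomb:
  assumes S: "S \<in> commutant V (\<pi> ` carrier G)" and xs: "snd ` set xs \<subseteq> carrier G"
  shows "S o\<^sub>L lincomb \<pi> xs = lincomb \<pi> xs o\<^sub>L S"
proof -
  have "clin S" using S by (auto simp: commutant_def ops_clin)
  then show ?thesis
    using xs S by (induction xs) (auto simp: blinfun_compose_bilinear scaleC_op_simps commutant_def)
qed

lemma rep_cstar_subset_rep_vn:
  fixes \<pi> :: "'g \<Rightarrow> 'a::complex_hilbert \<Rightarrow>\<^sub>L 'a"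
  assumes G: "group G" and R: "unitary_rep G V \<pi>" and T: "T \<in> rep_cstar G V \<pi>"
  shows "T \<in> rep_vn G V \<pi>"
proof -
  obtain xs where xs: "\<And>n. snd ` set (xs n) \<subseteq> carrier G" "(\<lambda>n. lincomb \<pi> (xs n)) \<longlonglongrightarrow> T"
    using rep_cstar_approx[OF assms] by metis
  have "T o\<^sub>L S = S o\<^sub>L T" if S: "S \<in> commutant V (\<pi> ` carrier G)" for S
  proof (rule LIMSEQ_unique)
    show "(\<lambda>n. lincomb \<pi> (xs n) o\<^sub>L S) \<longlonglongrightarrow> (T o\<^sub>L S)"
      by (intro bounded_bilinear.tendsto[OF bounded_bilinear_blinfun_compose] tendsto_const xs)
    show "(\<lambda>n. lincomb \<pi> (xs n) o\<^sub>L S) \<longlonglongrightarrow> (S o\<^sub>L T)"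
      unfolding commutant_lincomb[OF S xs(1), symmetric]
      by (intro bounded_bilinear.tendsto[OF bounded_bilinear_blinfun_compose] tendsto_const xs)
  qed
  then show ?thesis
    using star_subalgebraD(1)[OF rep_cstar_props(1)[OF R] T] by (auto simp: rep_vn_def commutant_def)
qed


subsection \<open>Weak containment as a norm inequality\<close>

lemma weakly_containedD:
  fixes \<pi> :: "'g \<Rightarrow> 'a::complex_hilbert \<Rightarrow>\<^sub>L 'a" and \<pi>' :: "'g \<Rightarrow> 'c::complex_hilbert \<Rightarrow>\<^sub>L 'c"
  assumes R: "unitary_rep G V \<pi>" and R': "unitary_rep G V' \<pi>'"
    and wc: "weakly_contained G V \<pi> V' \<pi>'" and xs: "snd ` set xs \<subseteq> carrier G"
  shows "norm (lincomb \<pi> xs) \<le> norm (lincomb \<pi>' xs)"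
proof -
  obtain \<phi> where \<phi>: "star_hom (rep_cstar G V' \<pi>') (rep_cstar G V \<pi>) \<phi>"
      "\<And>g. g \<in> carrier G \<Longrightarrow> \<phi> (\<pi>' g) = \<pi> g"
    using wc by (auto simp: weakly_contained_def)
  note A' = rep_cstar_props[OF R'] and A = rep_cstar_props[OF R]
  have "\<phi> (lincomb \<pi>' xs) = lincomb \<pi> xs"
    using xs
  proof (induction xs)
    case Nil
    show ?case
      using star_homD(6)[OF \<phi>(1), of 0 0] star_subalgebraD(3)[OF A'(1)] by simp
  next
    case (Cons x xs)
    then show ?case
      using star_homD(2)[OF \<phi>(1)] star_homD(5)[OF \<phi>(1)] \<phi>(2) A' star_subalgebraD(7)[OF A'(1)]
      by (cases x) simp
  qed
  then show ?thesis
    using star_hom_contractive[OF A'(1,2) A(1) \<phi>(1) A'(3)[OF xs]] by simp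
qed

text \<open>Conversely, under the norm inequality the closure of the set of all pairs
  \<open>(\<pi>'(a), \<pi>(a))\<close>, \<open>a\<close> in the group algebra, is the graph of a star homomorphism.\<close>

lemma weakly_containedI:
  fixes \<pi> :: "'g \<Rightarrow> 'a::complex_hilbert \<Rightarrow>\<^sub>L 'a" and \<pi>' :: "'g \<Rightarrow> 'c::complex_hilbert \<Rightarrow>\<^sub>L 'c"
  assumes G: "group G" and R: "unitary_rep G V \<pi>" and R': "unitary_rep G V' \<pi>'"
    and le: "\<And>xs. snd ` set xs \<subseteq> carrier G \<Longrightarrow> norm (lincomb \<pi> xs) \<le> norm (lincomb \<pi>' xs)"
  shows "weakly_contained G V \<pi> V' \<pi>'"
proof -
  define gr where "gr T S \<longleftrightarrow> (\<exists>xs. (\<forall>n. snd ` set (xs n) \<subseteq> carrier G) \<and>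
      (\<lambda>n. lincomb \<pi>' (xs n)) \<longlonglongrightarrow> T \<and> (\<lambda>n. lincomb \<pi> (xs n)) \<longlonglongrightarrow> S)" for T S
  note A = rep_cstar_props[OF R] and A' = rep_cstar_props[OF R']
  have grI: "gr T S" if "\<And>n. snd ` set (xs n) \<subseteq> carrier G"
      "(\<lambda>n. lincomb \<pi>' (xs n)) \<longlonglongrightarrow> T" "(\<lambda>n. lincomb \<pi> (xs n)) \<longlonglongrightarrow> S" for xs T S
    using that by (auto simp: gr_def)
  have mem: "T \<in> rep_cstar G V' \<pi>'" "S \<in> rep_cstar G V \<pi>" if gr_TS: "gr T S" for T S
  proof -
    obtain xs where xs: "\<And>n. snd ` set (xs n) \<subseteq> carrier G"
        "(\<lambda>n. lincomb \<pi>' (xs n)) \<longlonglongrightarrow> T" "(\<lambda>n. lincomb \<pi> (xs n)) \<longlonglongrightarrow> S"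
      using gr_TS by (auto simp: gr_def)
    show "T \<in> rep_cstar G V' \<pi>'"
      by (rule closed_sequentially[OF A'(2) A'(3)[OF xs(1)] xs(2)])
    show "S \<in> rep_cstar G V \<pi>"
      by (rule closed_sequentially[OF A(2) A(3)[OF xs(1)] xs(3)])
  qed
  have norm_le: "norm S \<le> norm T" if "gr T S" for T S
  proof -
    obtain xs where "\<And>n. snd ` set (xs n) \<subseteq> carrier G"
        "(\<lambda>n. lincomb \<pi>' (xs n)) \<longlonglongrightarrow> T" "(\<lambda>n. lincomb \<pi> (xs n)) \<longlonglongrightarrow> S"
      using \<open>gr T S\<close> by (auto simp: gr_def)
    moreover have "\<exists>N. \<forall>n\<ge>N. norm (lincomb \<pi> (xs n)) \<le> norm (lincomb \<pi>' (xs n))"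
      using le calculation(1) by blast
    ultimately show ?thesis
      using LIMSEQ_le[OF tendsto_norm tendsto_norm, of "\<lambda>n. lincomb \<pi> (xs n)" S "\<lambda>n. lincomb \<pi>' (xs n)" T]
      by simp
  qed
  have ops: "gr (T1 + T2) (S1 + S2)" "gr (T1 o\<^sub>L T2) (S1 o\<^sub>L S2)" "gr (adj T1) (adj S1)"
      "gr (scaleC_op c T1) (scaleC_op c S1)"
    if "gr T1 S1" "gr T2 S2" for T1 S1 T2 S2 c
  proof -
    obtain xs where xs: "\<And>n. snd ` set (xs n) \<subseteq> carrier G"
        "(\<lambda>n. lincomb \<pi>' (xs n)) \<longlonglongrightarrow> T1" "(\<lambda>n. lincomb \<pi> (xs n)) \<longlonglongrightarrow> S1"
      using \<open>gr T1 S1\<close> by (auto simp: gr_def)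
    obtain ys where ys: "\<And>n. snd ` set (ys n) \<subseteq> carrier G"
        "(\<lambda>n. lincomb \<pi>' (ys n)) \<longlonglongrightarrow> T2" "(\<lambda>n. lincomb \<pi> (ys n)) \<longlonglongrightarrow> S2"
      using \<open>gr T2 S2\<close> by (auto simp: gr_def)
    show "gr (T1 + T2) (S1 + S2)"
      by (rule grI[of "\<lambda>n. xs n @ ys n"]) (use xs ys in \<open>auto intro!: tendsto_add simp: image_Un\<close>)
    show "gr (T1 o\<^sub>L T2) (S1 o\<^sub>L S2)"
    proof (rule grI)
      let ?zs = "\<lambda>n. concat (map (\<lambda>(c, g). map (\<lambda>(d, h). (c * d, g \<otimes>\<^bsub>G\<^esub> h)) (ys n)) (xs n))"
      show "snd ` set (?zs n) \<subseteq> carrier G" for n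
        by (rule lincomb_mult_carrier[OF G xs(1) ys(1)])
      show "(\<lambda>n. lincomb \<pi>' (?zs n)) \<longlonglongrightarrow> (T1 o\<^sub>L T2)"
        unfolding lincomb_mult[OF G R' xs(1) ys(1)]
        by (intro bounded_bilinear.tendsto[OF bounded_bilinear_blinfun_compose] xs ys)
      show "(\<lambda>n. lincomb \<pi> (?zs n)) \<longlonglongrightarrow> (S1 o\<^sub>L S2)"
        unfolding lincomb_mult[OF G R xs(1) ys(1)]
        by (intro bounded_bilinear.tendsto[OF bounded_bilinear_blinfun_compose] xs ys)
    qed
    show "gr (adj T1) (adj S1)"
    proof (rule grI)
      show "snd ` set (map (\<lambda>(d, g). (cnj d, inv\<^bsub>G\<^esub> g)) (xs n)) \<subseteq> carrier G" for n
        by (rule lincomb_adj_carrier[OF G xs(1)])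
      have cl: "clin T1" "clin S1"
        using mem[OF \<open>gr T1 S1\<close>] star_subalgebraD(2) A(1) A'(1) by blast+
      show "(\<lambda>n. lincomb \<pi>' (map (\<lambda>(d, g). (cnj d, inv\<^bsub>G\<^esub> g)) (xs n))) \<longlonglongrightarrow> adj T1"
        using lincomb_adj[OF G R' xs(1)] bounded_linear_adj_limit[OF xs(2) _ cl(1)] by simp
      show "(\<lambda>n. lincomb \<pi> (map (\<lambda>(d, g). (cnj d, inv\<^bsub>G\<^esub> g)) (xs n))) \<longlonglongrightarrow> adj S1"
        using lincomb_adj[OF G R xs(1)] bounded_linear_adj_limit[OF xs(3) _ cl(2)] by simp
    qed
    show "gr (scaleC_op c T1) (scaleC_op c S1)"
      by (rule grI[of "\<lambda>n. map (\<lambda>(d, g). (c * d, g)) (xs n)"])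
        (simp_all only: lincomb_scale_carrier lincomb_scale xs tendsto_scaleC_op)
  qed
  have uniq: "S = S'" if "gr T S" "gr T S'" for T S S'
  proof -
    have "gr (T + scaleC_op (- 1) T) (S + scaleC_op (- 1) S')"
      by (rule ops(1)[OF that(1) ops(4)[OF that(2) that(2)]])
    moreover have "T + scaleC_op (- 1) T = 0" "S + scaleC_op (- 1) S' = S - S'"
      by (rule blinfun_eqI, simp add: blinfun.bilinear_simps scaleC_minus_one)+
    ultimately show ?thesis using norm_le[of 0 "S - S'"] by simp
  qed
  have ex: "\<exists>S. gr T S" if T: "T \<in> rep_cstar G V' \<pi>'" for T
  proof -
    obtain xs where xs: "\<And>n. snd ` set (xs n) \<subseteq> carrier G" "(\<lambda>n. lincomb \<pi>' (xs n)) \<longlonglongrightarrow> T"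
      using rep_cstar_approx[OF G R' T] by metis
    have "norm (lincomb \<pi> (xs m) - lincomb \<pi> (xs n)) \<le> norm (lincomb \<pi>' (xs m) - lincomb \<pi>' (xs n))" for m n
    proof -
      let ?z = "xs m @ map (\<lambda>(d, g). (- 1 * d, g)) (xs n)"
      have *: "lincomb \<rho> ?z = lincomb \<rho> (xs m) - lincomb \<rho> (xs n)" for \<rho> :: "'g \<Rightarrow> 'd::complex_hilbert \<Rightarrow>\<^sub>L 'd"
        unfolding lincomb_simps lincomb_scale
        by (rule blinfun_eqI) (simp add: blinfun.bilinear_simps scaleC_minus_one)
      have "snd ` set ?z \<subseteq> carrier G"
        unfolding set_append image_Un lincomb_scale_carrier using xs(1) by blast
      from le[OF this] show ?thesis unfolding * .
    qed
    moreover have "Cauchy (\<lambda>n. lincomb \<pi>' (xs n))"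
      using xs(2) by (rule LIMSEQ_imp_Cauchy)
    ultimately have "Cauchy (\<lambda>n. lincomb \<pi> (xs n))"
      unfolding Cauchy_iff by (meson le_less_trans)
    then obtain S where "(\<lambda>n. lincomb \<pi> (xs n)) \<longlonglongrightarrow> S"
      using Cauchy_convergent convergent_def by blast
    then show ?thesis using grI xs by blast
  qed
  define \<phi> where "\<phi> T = (SOME S. gr T S)" for T
  have \<phi>: "gr T (\<phi> T)" if "T \<in> rep_cstar G V' \<pi>'" for T
    unfolding \<phi>_def using someI_ex[OF ex[OF that]] .
  have \<phi>_eq: "\<phi> T = S" if "gr T S" for T S
    using uniq[OF that \<phi>[OF mem(1)[OF that]]] by simp
  have "star_hom (rep_cstar G V' \<pi>') (rep_cstar G V \<pi>) \<phi>"
    unfolding star_hom_def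
    by (intro conjI ballI allI mem(2)[OF \<phi>] \<phi>_eq ops[OF \<phi> \<phi>]) auto
  moreover have "\<phi> (\<pi>' g) = \<pi> g" if "g \<in> carrier G" for g
  proof (rule \<phi>_eq, rule grI)
    show "snd ` set [(1::complex, g)] \<subseteq> carrier G" for n :: nat using that by simp
    have "lincomb \<pi>' [(1, g)] = \<pi>' g" "lincomb \<pi> [(1, g)] = \<pi> g"
      by (rule blinfun_eqI, simp)+
    then show "(\<lambda>n. lincomb \<pi>' [(1, g)]) \<longlonglongrightarrow> \<pi>' g" "(\<lambda>n. lincomb \<pi> [(1, g)]) \<longlonglongrightarrow> \<pi> g"
      by (simp_all only: tendsto_const)
  qed
  ultimately show ?thesis
    unfolding weakly_contained_def by blast
qed


subsection \<open>Separating elements, intertwiners and factors\<close>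

text \<open>If \<open>a\<close> has norm at most \<open>r\<close> on an invariant subspace \<open>W\<close> but not at a vector \<open>v\<close>,
  then the positive part of \<open>a* a - r\<^sup>2\<close> vanishes on \<open>W\<close> and not at \<open>v\<close>.\<close>

lemma separating_element:
  fixes \<rho> :: "'g \<Rightarrow> 'a::complex_hilbert \<Rightarrow>\<^sub>L 'a"
  assumes G: "group G" and R: "unitary_rep G V \<rho>" and xs: "snd ` set xs \<subseteq> carrier G"
    and W: "closed_csubspace W" "W \<subseteq> V" "\<And>g w. g \<in> carrier G \<Longrightarrow> w \<in> W \<Longrightarrow> \<rho> g w \<in> W"
    and small: "\<And>w. w \<in> W \<Longrightarrow> norm (lincomb \<rho> xs w) \<le> r * norm w"
    and v: "v \<in> V" and r: "0 \<le> r" and big: "r * norm v < norm (lincomb \<rho> xs v)"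
  obtains x where "x \<in> rep_cstar G V \<rho>" "\<And>w. w \<in> W \<Longrightarrow> x w = 0" "x v \<noteq> 0"
proof -
  interpret group G by (rule G)
  note A = rep_cstar_props[OF R] and RD = unitary_repD[OF R]
  note AD = star_subalgebraD[OF A(1)]
  define a where "a = lincomb \<rho> xs"
  have a: "a \<in> rep_cstar G V \<rho>" "clin a" using A(3)[OF xs] AD(2) by (auto simp: a_def)
  define I where "I = \<rho> \<one>\<^bsub>G\<^esub>"
  have I: "I \<in> rep_cstar G V \<rho>" "\<And>v. v \<in> V \<Longrightarrow> I v = v" "adj I = I"
    using A(4) RD(4) adj_unitary_rep[OF G R] by (auto simp: I_def)
  define U where "U = (adj a o\<^sub>L a) - r\<^sup>2 *\<^sub>R I"
  have U: "U \<in> rep_cstar G V \<rho>" "adj U = U"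
    using a I AD by (auto simp: U_def adj_diff adj_scaleR adj_compose adj_adj)
  have inner_U: "inner w (U w) = (norm (a w))\<^sup>2 - (r * norm w)\<^sup>2" if "w \<in> V" for w
  proof -
    have "inner w (adj a (a w)) = (norm (a w))\<^sup>2"
      using cinner_adj_right[OF a(2), of w "a w"] by (metis Re_cinner power2_norm_eq_inner)
    then show ?thesis
      by (simp add: U_def blinfun.bilinear_simps inner_diff_right I(2)[OF that] power_mult_distrib
          power2_norm_eq_inner)
  qed
  show thesis
  proof (rule positive_part_exists[OF A(1,2) U I(1)])
    show "I v = v" if "v \<in> V" for v by (rule I(2)[OF that])
  next
    fix x
    assume x: "x \<in> rep_cstar G V \<rho>"
      "\<And>K v. K \<subseteq> V \<Longrightarrow> (\<And>v. v \<in> K \<Longrightarrow> x v \<in> K) \<Longrightarrow> (\<And>v. v \<in> K \<Longrightarrow> inner v (U v) \<le> 0) \<Longrightarrow> v \<in> K \<Longrightarrow> x v = 0"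
      "\<And>v. v \<in> V \<Longrightarrow> x v = 0 \<Longrightarrow> inner v (U v) \<le> 0"
    have x_W: "x w = 0" if "w \<in> W" for w
    proof (rule x(2)[OF W(2) _ _ that])
      show "x w \<in> W" if "w \<in> W" for w
        by (rule rep_cstar_invariant[OF G R x(1) W(1,3) that])
      show "inner w (U w) \<le> 0" if "w \<in> W" for w
        using power_mono[OF small[OF that], of 2] W(2) that by (auto simp: inner_U a_def)
    qed
    have x_v: "x v \<noteq> 0"
    proof
      assume "x v = 0"
      then have "(norm (a v))\<^sup>2 \<le> (r * norm v)\<^sup>2"
        using x(3)[OF v] inner_U[OF v] by simp
      then have "norm (a v) \<le> r * norm v"
        by (rule power2_le_imp_le) (use r in simp)
      then show False using big by (simp add: a_def)
    qed
    show thesis by (rule that[OF x(1) x_W x_v])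
  qed
qed

lemma lincomb_intertwine:
  fixes \<pi>0 :: "'g \<Rightarrow> 'a::complex_hilbert \<Rightarrow>\<^sub>L 'a" and \<pi> :: "'g \<Rightarrow> 'b::complex_hilbert \<Rightarrow>\<^sub>L 'b"
    and J :: "'a \<Rightarrow>\<^sub>L 'b"
  assumes "clin J" "\<And>g \<xi>. g \<in> carrier G \<Longrightarrow> J (\<pi>0 g \<xi>) = \<pi> g (J \<xi>)" "snd ` set xs \<subseteq> carrier G"
  shows "J (lincomb \<pi>0 xs \<xi>) = lincomb \<pi> xs (J \<xi>)"
  using assms(3) by (induction xs) (auto simp: blinfun.bilinear_simps assms(2) clinD[OF assms(1)])

text \<open>An isometric intertwiner maps \<open>\<pi>0\<close> to a part of \<open>\<pi>\<close>; elements of \<open>C*(\<pi>)\<close> restrict to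
  elements of \<open>C*(\<pi>0)\<close> there.\<close>

lemma rep_cstar_intertwine:
  fixes \<pi>0 :: "'g \<Rightarrow> 'a::complex_hilbert \<Rightarrow>\<^sub>L 'a" and \<pi> :: "'g \<Rightarrow> 'b::complex_hilbert \<Rightarrow>\<^sub>L 'b"
    and J :: "'a \<Rightarrow>\<^sub>L 'b"
  assumes G: "group G" and R0: "unitary_rep G UNIV \<pi>0" and R: "unitary_rep G V \<pi>"
    and J: "clin J" "\<And>\<xi>. norm (J \<xi>) = norm \<xi>" "\<And>g \<xi>. g \<in> carrier G \<Longrightarrow> J (\<pi>0 g \<xi>) = \<pi> g (J \<xi>)"
    and x: "x \<in> rep_cstar G V \<pi>"
  obtains x0 where "x0 \<in> rep_cstar G UNIV \<pi>0" "\<And>\<xi>. J (x0 \<xi>) = x (J \<xi>)"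
proof -
  obtain xs where xs: "\<And>n. snd ` set (xs n) \<subseteq> carrier G" "(\<lambda>n. lincomb \<pi> (xs n)) \<longlonglongrightarrow> x"
    using rep_cstar_approx[OF G R x] by metis
  note lin = lincomb_intertwine[OF J(1,3) xs(1)]
  have "norm (lincomb \<pi>0 (xs m) - lincomb \<pi>0 (xs n)) \<le> norm (lincomb \<pi> (xs m) - lincomb \<pi> (xs n))" for m n
    unfolding norm_blinfun_le_iff
  proof (intro conjI allI norm_ge_zero)
    fix \<xi>
    have "norm ((lincomb \<pi>0 (xs m) - lincomb \<pi>0 (xs n)) \<xi>) = norm ((lincomb \<pi> (xs m) - lincomb \<pi> (xs n)) (J \<xi>))"
      by (subst J(2)[symmetric]) (simp add: blinfun.bilinear_simps lin)
    also have "\<dots> \<le> norm (lincomb \<pi> (xs m) - lincomb \<pi> (xs n)) * norm \<xi>"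
      using norm_blinfun[of "lincomb \<pi> (xs m) - lincomb \<pi> (xs n)" "J \<xi>"] by (simp add: J(2))
    finally show "norm ((lincomb \<pi>0 (xs m) - lincomb \<pi>0 (xs n)) \<xi>)
        \<le> norm (lincomb \<pi> (xs m) - lincomb \<pi> (xs n)) * norm \<xi>" .
  qed
  moreover have "Cauchy (\<lambda>n. lincomb \<pi> (xs n))"
    using xs(2) by (rule LIMSEQ_imp_Cauchy)
  ultimately have "Cauchy (\<lambda>n. lincomb \<pi>0 (xs n))"
    unfolding Cauchy_iff by (meson le_less_trans)
  then obtain x0 where x0: "(\<lambda>n. lincomb \<pi>0 (xs n)) \<longlonglongrightarrow> x0"
    using Cauchy_convergent convergent_def by blast
  show thesis
  proof (rule that)
    show "x0 \<in> rep_cstar G UNIV \<pi>0"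
      using closed_sequentially[OF rep_cstar_props(2)[OF R0] _ x0] rep_cstar_props(3)[OF R0 xs(1)] by blast
    show "J (x0 \<xi>) = x (J \<xi>)" for \<xi>
    proof (rule LIMSEQ_unique)
      show "(\<lambda>n. J (lincomb \<pi>0 (xs n) \<xi>)) \<longlonglongrightarrow> J (x0 \<xi>)"
        by (intro tendsto_intros x0)
      have "(\<lambda>n. lincomb \<pi> (xs n) (J \<xi>)) \<longlonglongrightarrow> x (J \<xi>)"
        by (intro tendsto_intros xs)
      then show "(\<lambda>n. J (lincomb \<pi>0 (xs n) \<xi>)) \<longlonglongrightarrow> x (J \<xi>)"
        by (simp only: lin)
    qed
  qed
qed

lemma adj_commutant:
  fixes \<pi> :: "'g \<Rightarrow> 'a::complex_hilbert \<Rightarrow>\<^sub>L 'a"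
  assumes G: "group G" and R: "unitary_rep G V \<pi>" and T: "T \<in> commutant V (\<pi> ` carrier G)"
  shows "adj T \<in> commutant V (\<pi> ` carrier G)"
proof -
  interpret group G by (rule G)
  have T': "T \<in> ops V" "\<And>g. g \<in> carrier G \<Longrightarrow> T o\<^sub>L \<pi> g = \<pi> g o\<^sub>L T"
    using T by (auto simp: commutant_def)
  have "adj T o\<^sub>L \<pi> g = \<pi> g o\<^sub>L adj T" if g: "g \<in> carrier G" for g
  proof -
    have "adj (T o\<^sub>L \<pi> (inv\<^bsub>G\<^esub> g)) = adj (\<pi> (inv\<^bsub>G\<^esub> g) o\<^sub>L T)"
      using T'(2) g by simp
    then show ?thesis
      using g T'(1) unitary_repD(7)[OF R] by (simp add: adj_compose ops_clin adj_unitary_rep[OF G R])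
  qed
  then show ?thesis
    using ops_simps(5)[OF unitary_repD(1)[OF R] T'(1)] by (auto simp: commutant_def)
qed

text \<open>In a factor representation a nonzero \<open>x\<close> in the von Neumann algebra kills no nonzero orbit:
  the vectors whose orbit is killed by \<open>x\<close> form a closed subspace with central projection.\<close>

lemma factorial_rep_orbit:
  fixes \<pi> :: "'g \<Rightarrow> 'a::complex_hilbert \<Rightarrow>\<^sub>L 'a"
  assumes G: "group G" and F: "factorial_rep G UNIV \<pi>" and x: "x \<in> rep_vn G UNIV \<pi>" "x \<noteq> 0"
    and z: "\<And>g. g \<in> carrier G \<Longrightarrow> x (\<pi> g \<xi>) = 0"
  shows "\<xi> = 0"
proof -
  interpret group G by (rule G)
  have R: "unitary_rep G UNIV \<pi>" and fac: "factor UNIV (rep_vn G UNIV \<pi>)"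
    using F by (auto simp: factorial_rep_def)
  note RD = unitary_repD[OF R]
  define Z where "Z = {\<xi>. \<forall>g\<in>carrier G. x (\<pi> g \<xi>) = 0}"
  have xc: "clin x" using x by (auto simp: rep_vn_def commutant_def ops_clin)
  have Z: "closed_csubspace Z"
  proof -
    have "Z = (\<Inter>g\<in>carrier G. {\<xi>. x (\<pi> g \<xi>) = 0})" by (auto simp: Z_def)
    also have "closed \<dots>"
      by (intro closed_INT ballI closed_Collect_eq continuous_intros)
    finally show ?thesis
      unfolding closed_csubspace_def using RD(7)
      by (auto simp: Z_def blinfun.bilinear_simps clinD[OF xc] clinD)
  qed
  define P where "P = projection Z"
  note PP = projection[OF Z, folded P_def]
  have P: "P \<xi> \<in> Z" for \<xi> using PP(1) opsD(2) by blast
  have comm: "T o\<^sub>L P = P o\<^sub>L T" if T: "clin T" "\<And>\<xi>. \<xi> \<in> Z \<Longrightarrow> T \<xi> \<in> Z" "\<And>\<xi>. \<xi> \<in> Z \<Longrightarrow> adj T \<xi> \<in> Z" for T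
  proof (rule blinfun_eqI)
    fix \<xi>
    have "P (T (\<xi> - P \<xi>)) = 0"
    proof (rule opsD(3)[OF PP(1)])
      fix v assume "v \<in> Z"
      then have "cinner (adj T v) (\<xi> - P \<xi>) = 0" using PP(3) T(3) by blast
      then show "cinner v (T (\<xi> - P \<xi>)) = 0" by (simp add: cinner_adj_left T(1))
    qed
    moreover have "P (T (P \<xi>)) = T (P \<xi>)" using PP(2) T(2) P by blast
    ultimately show "(T o\<^sub>L P) \<xi> = (P o\<^sub>L T) \<xi>" by (simp add: blinfun.bilinear_simps)
  qed
  have \<pi>Z: "\<pi> g \<xi> \<in> Z" if "g \<in> carrier G" "\<xi> \<in> Z" for g \<xi>
  proof -
    have "x (\<pi> h (\<pi> g \<xi>)) = 0" if h: "h \<in> carrier G" for h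
    proof -
      have "\<pi> h (\<pi> g \<xi>) = \<pi> (h \<otimes>\<^bsub>G\<^esub> g) \<xi>" using RD(5) \<open>g \<in> carrier G\<close> h by simp
      then show ?thesis using that h \<open>g \<in> carrier G\<close> \<open>\<xi> \<in> Z\<close> by (simp add: Z_def)
    qed
    then show ?thesis by (simp add: Z_def)
  qed
  have P_comm: "P \<in> commutant UNIV (\<pi> ` carrier G)"
    using comm \<pi>Z RD(7) adj_unitary_rep[OF G R] ops_clin[OF PP(1)]
    by (auto simp: commutant_def ops_UNIV)
  have TZ: "T \<xi> \<in> Z" if T: "T \<in> commutant UNIV (\<pi> ` carrier G)" and \<xi>: "\<xi> \<in> Z" for T \<xi>
  proof -
    have "x o\<^sub>L T = T o\<^sub>L x" using x(1) T by (auto simp: rep_vn_def commutant_def)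
    moreover have "T o\<^sub>L \<pi> g = \<pi> g o\<^sub>L T" if "g \<in> carrier G" for g
      using T that by (auto simp: commutant_def)
    ultimately have "x (\<pi> g (T \<xi>)) = T (x (\<pi> g \<xi>))" if "g \<in> carrier G" for g
      using that by (metis blinfun_apply_blinfun_compose)
    then show ?thesis using \<xi> by (simp add: Z_def blinfun.zero_right)
  qed
  have P_vn: "P \<in> rep_vn G UNIV \<pi>"
    unfolding rep_vn_def commutant_def[of UNIV "commutant _ _"]
  proof (intro CollectI conjI ballI)
    fix T assume T: "T \<in> commutant UNIV (\<pi> ` carrier G)"
    then show "P o\<^sub>L T = T o\<^sub>L P"
      using comm[of T] TZ[OF T] TZ[OF adj_commutant[OF G R T]] by (auto simp: commutant_def ops_clin)
  qed (use ops_clin[OF PP(1)] in \<open>simp add: ops_UNIV\<close>)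
  have P_comm': "P \<in> commutant UNIV (rep_vn G UNIV \<pi>)"
  proof -
    have "P o\<^sub>L S = S o\<^sub>L P" if "S \<in> rep_vn G UNIV \<pi>" for S
      using that P_comm by (auto simp: rep_vn_def commutant_def[of UNIV "commutant _ _"])
    then show ?thesis using ops_clin[OF PP(1)] by (auto simp: commutant_def ops_UNIV)
  qed
  have "P \<in> rep_vn G UNIV \<pi> \<inter> commutant UNIV (rep_vn G UNIV \<pi>)"
    using P_vn P_comm' by (rule IntI)
  then have "\<exists>c. \<forall>v\<in>UNIV. P v = c *\<^sub>C v"
    using fac by (simp only: factor_def mem_Collect_eq)
  then obtain c where c: "\<And>v. P v = c *\<^sub>C v"
    by auto
  have \<xi>Z: "\<xi> \<in> Z" using z by (simp add: Z_def)
  show ?thesis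
  proof (rule ccontr)
    assume nz: "\<xi> \<noteq> 0"
    have "c *\<^sub>C \<xi> = \<xi>" using c[of \<xi>] PP(2)[OF \<xi>Z] by simp
    then have "cinner \<xi> (c *\<^sub>C \<xi>) = cinner \<xi> \<xi>" by simp
    then have "c = 1" using nz by (simp add: cinner_scaleC_right)
    then have "v \<in> Z" for v using c[of v] P[of v] by simp
    then have "x v = 0" for v
      using RD(4)[of v] unfolding Z_def by (metis (mono_tags, lifting) UNIV_I mem_Collect_eq one_closed)
    then show False using x(2) by (auto intro: blinfun_eqI)
  qed
qed


section \<open>Operators on square-summable families\<close>

subsection \<open>Coordinates, elementary tensors and density\<close>

lemma ell2_nth_simps [simp]:
  "ell2_nth 0 i = 0" "ell2_nth (f + g) i = ell2_nth f i + ell2_nth g i"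
  "ell2_nth (f - g) i = ell2_nth f i - ell2_nth g i" "ell2_nth (- f) i = - ell2_nth f i"
  "ell2_nth (r *\<^sub>R f) i = r *\<^sub>R ell2_nth f i" "ell2_nth (c *\<^sub>C f) i = c *\<^sub>C ell2_nth f i"
  "ell2_nth (delta x) i = (if i = x then 1 else 0)" "ell2_nth (etensor h \<xi>) i = ell2_nth h i *\<^sub>C \<xi>"
  by (simp_all add: zero_ell2.rep_eq plus_ell2.rep_eq minus_ell2.rep_eq uminus_ell2.rep_eq
      scaleR_ell2.rep_eq scaleC_ell2.rep_eq delta.rep_eq etensor.rep_eq)

lemma ell2_nth_sum [simp]: "ell2_nth (\<Sum>i\<in>I. f i) j = (\<Sum>i\<in>I. ell2_nth (f i) j)"
  by (induction I rule: infinite_finite_induct) auto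

lemma ell2_nth_bounded_linear: "bounded_linear (\<lambda>f :: ('i, 'h::complex_hilbert) ell2. ell2_nth f i)"
  by (rule bounded_linear_intro[where K = 1]) (auto simp: ell2_nth_norm_le)

lemma ell2_bound:
  assumes "\<And>F. finite F \<Longrightarrow> (\<Sum>i\<in>F. (norm (f i))\<^sup>2) \<le> B\<^sup>2" "0 \<le> B"
  shows "ell2_nth (Abs_ell2 f) = f" "norm (Abs_ell2 f) \<le> B"
proof -
  have sm: "(\<lambda>i. (norm (f i))\<^sup>2) summable_on UNIV"
    by (rule nonneg_bdd_above_summable_on)
      (use assms(1) in \<open>auto intro!: bdd_aboveI2[where M = "B\<^sup>2"]\<close>)
  then show eq: "ell2_nth (Abs_ell2 f) = f"
    by (intro Abs_ell2_inverse) simp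
  have "(norm (Abs_ell2 f))\<^sup>2 \<le> B\<^sup>2"
    unfolding ell2_norm_sq eq by (rule infsum_le_finite_sums[OF sm]) (use assms(1) in auto)
  then show "norm (Abs_ell2 f) \<le> B"
    using assms(2) by (rule power2_le_imp_le)
qed

lemma infsum_eq_term: "(\<And>j. j \<noteq> i \<Longrightarrow> f j = 0) \<Longrightarrow> (\<Sum>\<^sub>\<infinity>j. f j) = (f i :: complex)"
  using infsum_cong_neutral[of "{i}" UNIV f f] by simp

lemma cinner_delta: "cinner (delta i) f = ell2_nth f i"
  unfolding cinner_ell2_def
  by (subst infsum_eq_term[where i = i]) (auto simp: cinner_complex_def)

lemma cinner_etensor_delta: "cinner (etensor (delta i) \<xi>) f = cinner \<xi> (ell2_nth f i)"
  unfolding cinner_ell2_def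
  by (subst infsum_eq_term[where i = i]) auto

lemma cinner_etensor: "cinner (etensor f \<xi>) (etensor g \<eta>) = cinner f g * cinner \<xi> \<eta>"
  unfolding cinner_ell2_def infsum_cmult_left'[symmetric]
  by (intro infsum_cong) (simp add: cinner_scaleC_left cinner_scaleC_right cinner_complex_def)

lemma etensor_simps:
  "etensor (f + g) \<xi> = etensor f \<xi> + etensor g \<xi>" "etensor f (\<xi> + \<eta>) = etensor f \<xi> + etensor f \<eta>"
  "etensor (f - g) \<xi> = etensor f \<xi> - etensor g \<xi>" "etensor f (\<xi> - \<eta>) = etensor f \<xi> - etensor f \<eta>"
  "etensor (c *\<^sub>C f) \<xi> = c *\<^sub>C etensor f \<xi>" "etensor f (c *\<^sub>C \<xi>) = c *\<^sub>C etensor f \<xi>"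
  "etensor f (r *\<^sub>R \<xi>) = r *\<^sub>R etensor f \<xi>"
  "etensor 0 \<xi> = 0" "etensor f 0 = 0"
  by (rule ell2_ext; simp add: scaleC_add_left scaleC_add_right scaleC_diff_right scaleC_scaleC
      scaleC_complex_def mult.commute scaleC_scaleR; metis add_diff_cancel diff_add_cancel scaleC_add_left)+

lemma etensor_sum_left: "etensor (\<Sum>i\<in>I. f i) \<xi> = (\<Sum>i\<in>I. etensor (f i) \<xi>)"
  by (induction I rule: infinite_finite_induct) (auto simp: etensor_simps)

lemma etensor_sum_right: "etensor f (\<Sum>i\<in>I. \<xi> i) = (\<Sum>i\<in>I. etensor f (\<xi> i))"
  by (induction I rule: infinite_finite_induct) (auto simp: etensor_simps)

lemma norm_etensor: "norm (etensor f \<xi>) = norm f * norm \<xi>"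
proof -
  have "complex_of_real ((norm (etensor f \<xi>))\<^sup>2) = complex_of_real ((norm f * norm \<xi>)\<^sup>2)"
    unfolding cinner_self[symmetric] cinner_etensor by (simp add: cinner_self power_mult_distrib)
  then have "(norm (etensor f \<xi>))\<^sup>2 = (norm f * norm \<xi>)\<^sup>2"
    using of_real_eq_iff by blast
  then show ?thesis
    by (simp add: power2_eq_iff_nonneg)
qed

lemma norm_delta [simp]: "norm (delta i) = 1"
proof -
  have "complex_of_real ((norm (delta i))\<^sup>2) = 1"
    unfolding cinner_self[symmetric] cinner_delta by simp
  then have "(norm (delta i))\<^sup>2 = 1"
    using of_real_eq_1_iff by blast
  then show ?thesis by (simp add: power2_eq_1_iff) (use norm_ge_zero[of "delta i"] in linarith)
qed

lemma ell2_on_nth: "f \<in> ell2_on X \<Longrightarrow> i \<notin> X \<Longrightarrow> ell2_nth f i = 0"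
  by (simp add: ell2_on_def)

lemma delta_in_ell2_on [simp]: "i \<in> X \<Longrightarrow> delta i \<in> ell2_on X"
  by (auto simp: ell2_on_def)

lemma etensor_in_ell2_on [simp]: "f \<in> ell2_on X \<Longrightarrow> etensor f \<xi> \<in> ell2_on X"
  by (auto simp: ell2_on_def)

lemma closed_csubspace_ell2_on: "closed_csubspace (ell2_on X :: ('i, 'h::complex_hilbert) ell2 set)"
proof -
  have "ell2_on X = (\<Inter>i\<in>-X. {f :: ('i, 'h) ell2. ell2_nth f i = 0})"
    by (auto simp: ell2_on_def)
  also have "closed \<dots>"
    by (intro closed_INT ballI closed_Collect_eq continuous_intros
        bounded_linear.continuous_on[OF ell2_nth_bounded_linear])
  finally show ?thesis
    unfolding closed_csubspace_def by (auto simp: ell2_on_def)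
qed

lemma orthogonal_ell2_on:
  assumes "\<And>v. v \<in> ell2_on X \<Longrightarrow> cinner v f = 0" "i \<in> X"
  shows "ell2_nth f i = 0"
  using assms(1)[of "etensor (delta i) (ell2_nth f i)"] assms(2)
  by (simp add: cinner_etensor_delta)

lemma finite_truncation_norm:
  assumes "finite F"
  shows "(norm f)\<^sup>2 = (\<Sum>i\<in>F. (norm (ell2_nth f i))\<^sup>2)
    + (norm (f - (\<Sum>i\<in>F. etensor (delta i) (ell2_nth f i))))\<^sup>2"
proof -
  let ?s = "\<Sum>i\<in>F. etensor (delta i) (ell2_nth f i)"
  have nth: "ell2_nth ?s j = (if j \<in> F then ell2_nth f j else 0)" for j
  proof -
    have "ell2_nth ?s j = (\<Sum>i\<in>F. if j = i then ell2_nth f j else 0)"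
      by (auto intro!: sum.cong)
    then show ?thesis using assms by simp
  qed
  have "cinner ?s (f - ?s) = (\<Sum>i\<in>F. cinner (ell2_nth f i) (ell2_nth (f - ?s) i))"
    by (simp only: cinner_sum_left cinner_etensor_delta)
  also have "\<dots> = 0"
    unfolding ell2_nth_simps nth by simp
  finally have "cinner ?s (f - ?s) = 0" .
  then have "(norm f)\<^sup>2 = (norm ?s)\<^sup>2 + (norm (f - ?s))\<^sup>2"
    using norm_add_orthogonal[of ?s "f - ?s"] by simp
  also have "(norm ?s)\<^sup>2 = (\<Sum>i\<in>F. (norm (etensor (delta i) (ell2_nth f i)))\<^sup>2)"
    by (rule norm_sum_orthogonal[OF assms]) (simp add: cinner_etensor_delta cinner_scaleC_right)
  finally show ?thesis by (simp add: norm_etensor)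
qed

lemma ell2_approx:
  assumes f: "f \<in> ell2_on X" and e: "0 < e"
  obtains F where "finite F" "F \<subseteq> X" "norm (f - (\<Sum>i\<in>F. etensor (delta i) (ell2_nth f i))) < e"
proof -
  have "((\<lambda>i. (norm (ell2_nth f i))\<^sup>2) has_sum (norm f)\<^sup>2) UNIV"
    unfolding ell2_norm_sq using ell2_summable by (rule has_sum_infsum)
  then have "\<exists>F. finite F \<and> (norm f)\<^sup>2 - e\<^sup>2 < (\<Sum>i\<in>F. (norm (ell2_nth f i))\<^sup>2)"
    unfolding has_sum_def
    using order_tendstoD(1)[of "sum (\<lambda>i. (norm (ell2_nth f i))\<^sup>2)" "(norm f)\<^sup>2" "finite_subsets_at_top UNIV"
        "(norm f)\<^sup>2 - e\<^sup>2"] e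
    by (auto simp: eventually_finite_subsets_at_top)
  then obtain F where F: "finite F" "(norm f)\<^sup>2 - e\<^sup>2 < (\<Sum>i\<in>F. (norm (ell2_nth f i))\<^sup>2)"
    by blast
  have "(\<Sum>i\<in>F. (norm (ell2_nth f i))\<^sup>2) = (\<Sum>i\<in>F \<inter> X. (norm (ell2_nth f i))\<^sup>2)"
    by (rule sum.mono_neutral_right) (use F ell2_on_nth[OF f] in auto)
  then have "(norm (f - (\<Sum>i\<in>F \<inter> X. etensor (delta i) (ell2_nth f i))))\<^sup>2 < e\<^sup>2"
    using finite_truncation_norm[of "F \<inter> X" f] F by simp
  then have "norm (f - (\<Sum>i\<in>F \<inter> X. etensor (delta i) (ell2_nth f i))) < e"
    using e by (simp add: power_less_imp_less_base)
  then show thesis using that[of "F \<inter> X"] F(1) by simp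
qed

lemma ell2_on_subsetI:
  fixes W :: "('i, 'h::complex_hilbert) ell2 set"
  assumes W: "closed_csubspace W" and i: "\<And>i \<xi>. i \<in> X \<Longrightarrow> etensor (delta i) \<xi> \<in> W"
  shows "ell2_on X \<subseteq> W"
proof
  fix f :: "('i, 'h) ell2" assume f: "f \<in> ell2_on X"
  have "f \<in> closure W"
    unfolding closure_approachable
  proof (intro allI impI)
    fix e :: real assume "0 < e"
    then obtain F where F: "finite F" "F \<subseteq> X" "norm (f - (\<Sum>i\<in>F. etensor (delta i) (ell2_nth f i))) < e"
      using ell2_approx[OF f] by blast
    have "(\<Sum>i\<in>F. etensor (delta i) (ell2_nth f i)) \<in> W"
      using F(2) i by (intro closed_csubspace_sum[OF W]) auto
    then show "\<exists>y\<in>W. dist y f < e"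
      using F(3) by (auto simp: dist_norm norm_minus_commute)
  qed
  then show "f \<in> W"
    using closed_csubspaceD(1)[OF W] by simp
qed

lemma closed_csubspace_equalizer:
  assumes "clin S" "clin T"
  shows "closed_csubspace {v. S v = T v}"
proof -
  have "closed {v. S v = T v}"
    by (intro closed_Collect_eq continuous_intros)
  then show ?thesis
    unfolding closed_csubspace_def using assms
    by (auto simp: blinfun.bilinear_simps clinD)
qed

lemma ell2_on_eqI:
  fixes S T :: "('i, 'h::complex_hilbert) ell2 \<Rightarrow>\<^sub>L 'k::complex_hilbert"
  assumes "clin S" "clin T" "\<And>i \<xi>. i \<in> X \<Longrightarrow> S (etensor (delta i) \<xi>) = T (etensor (delta i) \<xi>)"
    "v \<in> ell2_on X"
  shows "S v = T v"
  using ell2_on_subsetI[OF closed_csubspace_equalizer[OF assms(1,2)], of X] assms(3,4) by auto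

lemma ops_ell2_eqI:
  fixes S T :: "('i, 'h::complex_hilbert) ell2 \<Rightarrow>\<^sub>L ('i, 'h) ell2"
  assumes "S \<in> ops (ell2_on X)" "T \<in> ops (ell2_on X)"
    "\<And>i \<xi>. i \<in> X \<Longrightarrow> S (etensor (delta i) \<xi>) = T (etensor (delta i) \<xi>)"
  shows "S = T"
  by (rule ops_eqI[OF closed_csubspace_ell2_on assms(1,2)])
    (rule ell2_on_eqI[OF ops_clin[OF assms(1)] ops_clin[OF assms(2)] assms(3)])

text \<open>The embedding and the evaluation at an index.\<close>

definition ell2_embed :: "'i \<Rightarrow> 'h::complex_hilbert \<Rightarrow>\<^sub>L ('i, 'h) ell2" where
  "ell2_embed i = Blinfun (etensor (delta i))"

definition ell2_coord :: "'i \<Rightarrow> ('i, 'h::complex_hilbert) ell2 \<Rightarrow>\<^sub>L 'h" where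
  "ell2_coord i = Blinfun (\<lambda>f. ell2_nth f i)"

lemma ell2_embed_apply [simp]: "ell2_embed i \<xi> = etensor (delta i) \<xi>"
proof -
  have "bounded_linear (etensor (delta i) :: 'b \<Rightarrow> _)"
    by (rule bounded_linear_intro[where K = 1]) (auto simp: etensor_simps norm_etensor)
  then show ?thesis by (simp add: ell2_embed_def bounded_linear_Blinfun_apply)
qed

lemma ell2_coord_apply [simp]: "ell2_coord i f = ell2_nth f i"
  by (simp add: ell2_coord_def bounded_linear_Blinfun_apply ell2_nth_bounded_linear)

lemma clin_ell2_embed [simp]: "clin (ell2_embed i)" and clin_ell2_coord [simp]: "clin (ell2_coord i)"
  by (simp_all add: clin_def etensor_simps)

lemma etensor_delta_complex: "etensor (delta i) c = c *\<^sub>C (delta i :: ('i, complex) ell2)"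
  by (rule ell2_ext) (simp add: scaleC_complex_def)


subsection \<open>Weighted composition operators\<close>

text \<open>The operator \<open>f \<mapsto> (i \<mapsto> u(i) f(\<tau>(i)))\<close> on \<open>X\<close>, extended by \<open>0\<close> off \<open>X\<close>.\<close>

definition wcomp :: "'i set \<Rightarrow> ('i \<Rightarrow> 'j) \<Rightarrow> ('i \<Rightarrow> 'h::complex_hilbert \<Rightarrow>\<^sub>L 'k::complex_hilbert) \<Rightarrow>
    ('j, 'h) ell2 \<Rightarrow>\<^sub>L ('i, 'k) ell2" where
  "wcomp X \<tau> u = Blinfun (\<lambda>f. Abs_ell2 (\<lambda>i. if i \<in> X then u i (ell2_nth f (\<tau> i)) else 0))"

lemma wcomp:
  fixes u :: "'i \<Rightarrow> 'h::complex_hilbert \<Rightarrow>\<^sub>L 'k::complex_hilbert" and \<tau> :: "'i \<Rightarrow> 'j"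
  assumes inj: "inj_on \<tau> X" and C: "\<And>i \<xi>. i \<in> X \<Longrightarrow> norm (u i \<xi>) \<le> C * norm \<xi>" "0 \<le> C"
  shows wcomp_nth: "ell2_nth (wcomp X \<tau> u f) i = (if i \<in> X then u i (ell2_nth f (\<tau> i)) else 0)"
    and wcomp_norm: "norm (wcomp X \<tau> u f) \<le> C * norm f"
proof -
  define w where "w f = Abs_ell2 (\<lambda>i. if i \<in> X then u i (ell2_nth f (\<tau> i)) else 0)" for f
  have fin: "(\<Sum>i\<in>F. (norm (if i \<in> X then u i (ell2_nth f (\<tau> i)) else 0))\<^sup>2) \<le> (C * norm f)\<^sup>2"
    if "finite F" for F f
  proof -
    have "(\<Sum>i\<in>F. (norm (if i \<in> X then u i (ell2_nth f (\<tau> i)) else 0))\<^sup>2)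
        = (\<Sum>i\<in>F \<inter> X. (norm (u i (ell2_nth f (\<tau> i))))\<^sup>2)"
      using that by (intro sum.mono_neutral_cong_right) auto
    also have "\<dots> \<le> (\<Sum>i\<in>F \<inter> X. C\<^sup>2 * (norm (ell2_nth f (\<tau> i)))\<^sup>2)"
      using power_mono[OF C(1), of _ _ 2] by (intro sum_mono) (auto simp: power_mult_distrib)
    also have "\<dots> = C\<^sup>2 * (\<Sum>j\<in>\<tau> ` (F \<inter> X). (norm (ell2_nth f j))\<^sup>2)"
      using inj_on_subset[OF inj, of "F \<inter> X"] by (simp add: sum.reindex sum_distrib_left)
    also have "\<dots> \<le> C\<^sup>2 * (norm f)\<^sup>2"
      using that by (intro mult_left_mono ell2_sum_le_norm_sq) auto
    finally show ?thesis by (simp add: power_mult_distrib)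
  qed
  have nth: "ell2_nth (w f) i = (if i \<in> X then u i (ell2_nth f (\<tau> i)) else 0)"
    and nrm: "norm (w f) \<le> C * norm f" for f i
    using ell2_bound[OF fin[of _ f]] C(2) by (auto simp: w_def)
  have "bounded_linear w"
    by (rule bounded_linear_intro[where K = C])
      (auto intro!: ell2_ext simp: nth nrm blinfun.bilinear_simps mult.commute)
  then have "wcomp X \<tau> u f = w f" for f
    by (simp add: wcomp_def w_def[abs_def] bounded_linear_Blinfun_apply)
  then show "ell2_nth (wcomp X \<tau> u f) i = (if i \<in> X then u i (ell2_nth f (\<tau> i)) else 0)"
    "norm (wcomp X \<tau> u f) \<le> C * norm f"
    using nth nrm by auto
qed

lemma wcomp_clin:
  fixes u :: "'i \<Rightarrow> 'h::complex_hilbert \<Rightarrow>\<^sub>L 'k::complex_hilbert" and \<tau> :: "'i \<Rightarrow> 'j"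
  assumes "inj_on \<tau> X" "\<And>i \<xi>. i \<in> X \<Longrightarrow> norm (u i \<xi>) \<le> C * norm \<xi>" "0 \<le> C" "\<And>i. i \<in> X \<Longrightarrow> clin (u i)"
  shows "clin (wcomp X \<tau> u)"
  unfolding clin_def by (intro allI ell2_ext) (auto simp: wcomp_nth[OF assms(1-3)] clinD[OF assms(4)])

lemma wcomp_ops:
  fixes u :: "'i \<Rightarrow> 'h::complex_hilbert \<Rightarrow>\<^sub>L 'h" and \<tau> :: "'i \<Rightarrow> 'i"
  assumes "inj_on \<tau> X" "\<And>i \<xi>. i \<in> X \<Longrightarrow> norm (u i \<xi>) \<le> C * norm \<xi>" "0 \<le> C" "\<And>i. i \<in> X \<Longrightarrow> clin (u i)"
    "\<tau> ` X \<subseteq> X"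
  shows "wcomp X \<tau> u \<in> ops (ell2_on X)"
proof (rule opsI)
  show "wcomp X \<tau> u (c *\<^sub>C x) = c *\<^sub>C wcomp X \<tau> u x" for c x
    by (rule clinD[OF wcomp_clin[OF assms(1-4)]])
  show "wcomp X \<tau> u x \<in> ell2_on X" for x
    by (auto simp: ell2_on_def wcomp_nth[OF assms(1-3)])
  show "wcomp X \<tau> u x = 0" if "\<And>v. v \<in> ell2_on X \<Longrightarrow> cinner v x = 0" for x
  proof (rule ell2_ext)
    show "ell2_nth (wcomp X \<tau> u x) i = ell2_nth 0 i" for i
      using orthogonal_ell2_on[OF that] assms(5)
      by (auto simp: wcomp_nth[OF assms(1-3)] image_subset_iff blinfun.zero_right)
  qed
qed


subsection \<open>Tensoring an operator with the identity\<close>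

lemma gram_schmidt:
  fixes F :: "'h::complex_hilbert set"
  assumes "finite F"
  obtains E where "finite E" "\<And>e e'. e \<in> E \<Longrightarrow> e' \<in> E \<Longrightarrow> e \<noteq> e' \<Longrightarrow> cinner e e' = 0"
    "\<And>e. e \<in> E \<Longrightarrow> norm e = 1" "\<And>x. x \<in> F \<Longrightarrow> x = (\<Sum>e\<in>E. cinner e x *\<^sub>C e)"
proof -
  have "\<exists>E. finite E \<and> (\<forall>e\<in>E. \<forall>e'\<in>E. e \<noteq> e' \<longrightarrow> cinner e e' = 0) \<and> (\<forall>e\<in>E. norm e = 1) \<and>
      (\<forall>x\<in>F. x = (\<Sum>e\<in>E. cinner e x *\<^sub>C e))"
    using assms
  proof (induction F rule: finite_induct)
    case empty
    then show ?case by (intro exI[of _ "{}"]) auto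
  next
    case (insert x F)
    from insert.IH obtain E where E': "finite E" "\<forall>e\<in>E. \<forall>e'\<in>E. e \<noteq> e' \<longrightarrow> cinner e e' = 0"
        "\<forall>e\<in>E. norm e = 1" "\<forall>x\<in>F. x = (\<Sum>e\<in>E. cinner e x *\<^sub>C e)"
      by (elim exE conjE)
    have E: "finite E" "\<And>e e'. e \<in> E \<Longrightarrow> e' \<in> E \<Longrightarrow> e \<noteq> e' \<Longrightarrow> cinner e e' = 0"
        "\<And>e. e \<in> E \<Longrightarrow> norm e = 1"
      using E'(1-3) by auto
    note E4 = E'(4)[rule_format]
    define p where "p = (\<Sum>e\<in>E. cinner e x *\<^sub>C e)"
    define r where "r = x - p"
    have ep: "cinner e p = cinner e x" if "e \<in> E" for e
    proof -
      have "cinner e p = (\<Sum>e'\<in>E. if e' = e then cinner e x else 0)"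
        unfolding p_def cinner_sum_right using E(2,3) that
        by (intro sum.cong) (auto simp: cinner_scaleC_right cinner_self)
      then show ?thesis using E(1) that by simp
    qed
    have er: "cinner e r = 0" if "e \<in> E" for e
      using ep[OF that] by (simp add: r_def cinner_diff_right)
    show ?case
    proof (cases "r = 0")
      case True
      then show ?thesis
        using E'(1-3) E4 by (intro exI[of _ E] conjI ballI) (auto simp: r_def p_def)
    next
      case False
      define u where "u = (1 / norm r) *\<^sub>R r"
      have u: "norm u = 1" using False by (simp add: u_def)
      have eu: "cinner e u = 0" "cinner u e = 0" if "e \<in> E" for e
        using er[OF that] cinner_eq_0_commute[of e u] by (auto simp: u_def cinner_scaleR_right)
      have uE: "u \<notin> E"
      proof
        assume "u \<in> E"
        then have "cinner u u = 0" by (rule eu(1))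
        then show False using u by simp
      qed
      have yF: "y = (\<Sum>e\<in>insert u E. cinner e y *\<^sub>C e)" if "y \<in> F" for y
      proof -
        have "cinner u y = 0"
          by (subst E4[OF that]) (simp add: cinner_sum_right cinner_scaleC_right eu)
        then show ?thesis using E(1) uE E4[OF that] by simp
      qed
      have "cinner p r = 0"
        unfolding p_def cinner_sum_left by (rule sum.neutral) (simp add: cinner_scaleC_left er)
      then have "cinner r x = cinner r r"
        using cinner_eq_0_commute[of p r] by (simp add: r_def cinner_diff_right cinner_diff_left)
      then have "cinner u x *\<^sub>C u = r"
        using False by (simp add: u_def cinner_scaleR_left cinner_self scaleC_scaleR power2_eq_square
            flip: of_real_divide of_real_mult) (simp add: scaleC_of_real)
      then have "x = (\<Sum>e\<in>insert u E. cinner e x *\<^sub>C e)"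
        using E(1) uE by (simp add: r_def flip: p_def)
      then show ?thesis
        using E(1-3) eu u yF by (intro exI[of _ "insert u E"] conjI ballI) auto
    qed
  qed
  then obtain E where E: "finite E" "\<forall>e\<in>E. \<forall>e'\<in>E. e \<noteq> e' \<longrightarrow> cinner e e' = 0"
      "\<forall>e\<in>E. norm e = 1" "\<forall>x\<in>F. x = (\<Sum>e\<in>E. cinner e x *\<^sub>C e)"
    by (elim exE conjE)
  show thesis
    by (rule that[OF E(1)]) (use E(2,3) in blast, use E(3) in blast, rule E(4)[rule_format])
qed

lemma clin_sum: "clin a \<Longrightarrow> a (\<Sum>i\<in>I. c i *\<^sub>C f i) = (\<Sum>i\<in>I. c i *\<^sub>C a (f i))"
  by (simp add: blinfun.sum_right clinD)

text \<open>The operator \<open>a \<otimes> 1\<close> has norm at most \<open>\<parallel>a\<parallel>\<close> on finite sums of elementary tensors: expand the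
  second factors in an orthonormal family.\<close>

lemma norm_etensor_sum_le:
  fixes a :: "('i, complex) ell2 \<Rightarrow>\<^sub>L ('j, complex) ell2" and \<xi> :: "'k \<Rightarrow> 'h::complex_hilbert"
  assumes a: "clin a" and F: "finite F"
  shows "norm (\<Sum>i\<in>F. etensor (a (f i)) (\<xi> i)) \<le> norm a * norm (\<Sum>i\<in>F. etensor (f i) (\<xi> i))"
proof -
  obtain E where E: "finite E" "\<And>e e'. e \<in> E \<Longrightarrow> e' \<in> E \<Longrightarrow> e \<noteq> e' \<Longrightarrow> cinner e e' = 0"
      "\<And>e. e \<in> E \<Longrightarrow> norm e = 1" "\<And>x. x \<in> \<xi> ` F \<Longrightarrow> x = (\<Sum>e\<in>E. cinner e x *\<^sub>C e)"
    by (rule gram_schmidt[of "\<xi> ` F"]) (use F in blast, rule that)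
  have nrm: "(norm (\<Sum>i\<in>F. etensor (g i) (\<xi> i)))\<^sup>2 = (\<Sum>e\<in>E. (norm (\<Sum>i\<in>F. cinner e (\<xi> i) *\<^sub>C g i))\<^sup>2)"
    for g :: "'k \<Rightarrow> ('l, complex) ell2"
  proof -
    have "(\<Sum>i\<in>F. etensor (g i) (\<xi> i)) = (\<Sum>i\<in>F. \<Sum>e\<in>E. cinner e (\<xi> i) *\<^sub>C etensor (g i) e)"
    proof (rule sum.cong[OF refl])
      fix i assume "i \<in> F"
      then have "etensor (g i) (\<xi> i) = etensor (g i) (\<Sum>e\<in>E. cinner e (\<xi> i) *\<^sub>C e)"
        using E(4)[of "\<xi> i"] by simp
      then show "etensor (g i) (\<xi> i) = (\<Sum>e\<in>E. cinner e (\<xi> i) *\<^sub>C etensor (g i) e)"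
        by (simp add: etensor_sum_right etensor_simps)
    qed
    also have "\<dots> = (\<Sum>e\<in>E. etensor (\<Sum>i\<in>F. cinner e (\<xi> i) *\<^sub>C g i) e)"
      by (subst sum.swap) (simp add: etensor_sum_left etensor_simps)
    also have "(norm \<dots>)\<^sup>2 = (\<Sum>e\<in>E. (norm (etensor (\<Sum>i\<in>F. cinner e (\<xi> i) *\<^sub>C g i) e))\<^sup>2)"
      by (rule norm_sum_orthogonal[OF E(1)]) (simp add: cinner_etensor E(2))
    finally show ?thesis by (simp add: norm_etensor E(3))
  qed
  have "(norm (\<Sum>i\<in>F. etensor (a (f i)) (\<xi> i)))\<^sup>2 = (\<Sum>e\<in>E. (norm (a (\<Sum>i\<in>F. cinner e (\<xi> i) *\<^sub>C f i)))\<^sup>2)"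
    unfolding nrm clin_sum[OF a] ..
  also have "\<dots> \<le> (\<Sum>e\<in>E. (norm a * norm (\<Sum>i\<in>F. cinner e (\<xi> i) *\<^sub>C f i))\<^sup>2)"
    by (intro sum_mono power_mono norm_blinfun) simp
  also have "\<dots> = (norm a * norm (\<Sum>i\<in>F. etensor (f i) (\<xi> i)))\<^sup>2"
    by (simp add: nrm power_mult_distrib sum_distrib_left)
  finally show ?thesis
    by (rule power2_le_imp_le) simp
qed

text \<open>The partial inner product \<open>\<Sum>\<^sub>i g(i)* v(i)\<close> of a scalar family \<open>g\<close> with a vector-valued
  family \<open>v\<close>: it is the adjoint of \<open>\<eta> \<mapsto> g \<otimes> \<eta>\<close>.\<close>

definition contraction :: "('i, complex) ell2 \<Rightarrow> ('i, 'h::complex_hilbert) ell2 \<Rightarrow> 'h" where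
  "contraction g v = (THE z. \<forall>\<eta>. cinner z \<eta> = cinner v (etensor g \<eta>))"

lemma cinner_contraction: "cinner (contraction g v) \<eta> = cinner v (etensor g \<eta>)"
proof -
  have "bounded_linear (\<lambda>\<eta>. etensor g \<eta>)"
    by (rule bounded_linear_intro[where K = "norm g"]) (auto simp: etensor_simps norm_etensor)
  then have "bounded_linear (\<lambda>\<eta>. cinner v (etensor g \<eta>))"
    by (rule bounded_linear_compose[OF bounded_linear_cinner_right])
  then obtain z where z: "\<And>\<eta>. cinner v (etensor g \<eta>) = cinner z \<eta>"
    using riesz_representation[of "\<lambda>\<eta>. cinner v (etensor g \<eta>)"]
    by (metis cinner_scaleC_right etensor_simps(6))
  have "contraction g v = z"
    unfolding contraction_def
    by (rule the_equality) (auto simp: z intro: cinner_eqI_left)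
  then show ?thesis by (simp add: z)
qed

lemma contraction_simps:
  "contraction g (v + w) = contraction g v + contraction g w"
  "contraction g (r *\<^sub>R v) = r *\<^sub>R contraction g v"
  "contraction g (c *\<^sub>C v) = c *\<^sub>C contraction g v"
  "contraction (g + h) v = contraction g v + contraction h v"
  "contraction (c *\<^sub>C g) v = cnj c *\<^sub>C contraction g v"
  "contraction 0 v = 0"
  "contraction g (etensor f \<xi>) = cinner g f *\<^sub>C \<xi>"
  "contraction (delta i) v = ell2_nth v i"
  by (rule cinner_eqI_left; simp add: cinner_contraction cinner_add_left cinner_scaleR_left
      cinner_scaleC_left etensor_simps cinner_add_right cinner_scaleC_right cinner_etensor;
      metis cinner_commute cinner_etensor_delta)+

lemma contraction_norm: "norm (contraction g v) \<le> norm g * norm v"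
proof (cases "contraction g v = 0")
  case False
  let ?z = "contraction g v"
  have "(norm ?z)\<^sup>2 = cmod (cinner v (etensor g ?z))"
    by (simp add: cinner_contraction[symmetric] cinner_self norm_power)
  also have "\<dots> \<le> norm v * (norm g * norm ?z)"
    using cmod_cinner_le[of v "etensor g ?z"] by (simp add: norm_etensor)
  finally show ?thesis using False by (simp add: power2_eq_square mult_ac)
qed simp

text \<open>The operator \<open>a \<otimes> 1\<close>; its coordinate at \<open>j\<close> is the contraction with \<open>a* \<delta>\<^sub>j\<close>, the conjugate
  of the \<open>j\<close>-th row of \<open>a\<close>.\<close>

definition tensor_id :: "(('i, complex) ell2 \<Rightarrow>\<^sub>L ('i, complex) ell2) \<Rightarrow>
    ('i, 'h::complex_hilbert) ell2 \<Rightarrow>\<^sub>L ('i, 'h) ell2" where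
  "tensor_id a = Blinfun (\<lambda>v. Abs_ell2 (\<lambda>j. contraction (adj a (delta j)) v))"

lemma
  assumes a: "clin a"
  shows tensor_id_nth: "ell2_nth (tensor_id a v) j = contraction (adj a (delta j)) v"
    and tensor_id_norm: "norm (tensor_id a v) \<le> norm a * norm v"
proof -
  define w where "w v = Abs_ell2 (\<lambda>j. contraction (adj a (delta j)) v)" for v :: "('a, 'b) ell2"
  have fin: "(\<Sum>j\<in>J. (norm (contraction (adj a (delta j)) v))\<^sup>2) \<le> (norm a * norm v)\<^sup>2"
    if J: "finite J" for J and v :: "('a, 'b) ell2"
  proof -
    let ?g = "\<lambda>v. sqrt (\<Sum>j\<in>J. (norm (contraction (adj a (delta j)) v))\<^sup>2)"
    have fs: "?g (\<Sum>i\<in>F. etensor (delta i) (\<xi> i)) \<le> norm a * norm (\<Sum>i\<in>F. etensor (delta i) (\<xi> i))"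
      if "finite F" for F and \<xi> :: "'a \<Rightarrow> 'b"
    proof -
      let ?y = "\<Sum>i\<in>F. etensor (a (delta i)) (\<xi> i)"
      have sum: "contraction g (\<Sum>i\<in>F. v i) = (\<Sum>i\<in>F. contraction g (v i))"
        for g and v :: "'a \<Rightarrow> ('a, 'b) ell2"
      proof -
        have "contraction g (0 :: ('a, 'b) ell2) = 0"
          using contraction_simps(2)[of g 0 0] by simp
        then show ?thesis
          by (induction F rule: infinite_finite_induct) (auto simp: contraction_simps(1))
      qed
      have "contraction (adj a (delta j)) (\<Sum>i\<in>F. etensor (delta i) (\<xi> i)) = ell2_nth ?y j" for j
        by (simp add: sum contraction_simps(7) cinner_adj_left[OF a] cinner_delta)
      then have "?g (\<Sum>i\<in>F. etensor (delta i) (\<xi> i)) = sqrt (\<Sum>j\<in>J. (norm (ell2_nth ?y j))\<^sup>2)"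
        by simp
      also have "\<dots> \<le> sqrt ((norm ?y)\<^sup>2)"
        by (intro real_sqrt_le_mono ell2_sum_le_norm_sq[OF J])
      also have "\<dots> \<le> norm a * norm (\<Sum>i\<in>F. etensor (delta i) (\<xi> i))"
        using norm_etensor_sum_le[OF a that, of delta \<xi>] by simp
      finally show ?thesis .
    qed
    have bl: "bounded_linear (contraction g :: ('a, 'b) ell2 \<Rightarrow> 'b)" for g
      by (rule bounded_linear_intro[where K = "norm g"])
        (auto simp: contraction_simps mult.commute[of "norm _" "norm g"] contraction_norm)
    have "closed {v :: ('a, 'b) ell2. ?g v \<le> norm a * norm v}"
      by (intro closed_Collect_le continuous_intros bounded_linear.continuous_on[OF bl])
    moreover have "v \<in> closure {v :: ('a, 'b) ell2. ?g v \<le> norm a * norm v}"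
      unfolding closure_approachable
    proof (intro allI impI)
      fix e :: real assume e: "0 < e"
      have "v \<in> ell2_on UNIV" by (simp add: ell2_on_def)
      then obtain F where "finite F" "norm (v - (\<Sum>i\<in>F. etensor (delta i) (ell2_nth v i))) < e"
        using ell2_approx[OF _ e] by metis
      then show "\<exists>y\<in>{v. ?g v \<le> norm a * norm v}. dist y v < e"
        using fs by (intro bexI[of _ "\<Sum>i\<in>F. etensor (delta i) (ell2_nth v i)"])
          (auto simp: dist_norm norm_minus_commute)
    qed
    ultimately have "?g v \<le> norm a * norm v" by simp
    then have "(?g v)\<^sup>2 \<le> (norm a * norm v)\<^sup>2" by (intro power_mono) (auto simp: sum_nonneg)
    then show ?thesis by (simp add: sum_nonneg)
  qed
  have nth: "ell2_nth (w v) j = contraction (adj a (delta j)) v" and nrm: "norm (w v) \<le> norm a * norm v"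
    for v j using ell2_bound[OF fin[of _ v]] by (auto simp: w_def)
  have "bounded_linear w"
    by (rule bounded_linear_intro[where K = "norm a"])
      (auto intro!: ell2_ext simp: nth nrm contraction_simps mult.commute[of _ "norm a"])
  then have "tensor_id a v = w v" for v :: "('a, 'b) ell2"
    by (simp add: tensor_id_def w_def[abs_def] bounded_linear_Blinfun_apply)
  then show "ell2_nth (tensor_id a v) j = contraction (adj a (delta j)) v"
    "norm (tensor_id a v) \<le> norm a * norm v"
    using nth nrm by auto
qed

lemma tensor_id_clin: "clin a \<Longrightarrow> clin (tensor_id a)"
  unfolding clin_def[of "tensor_id a"]
  by (intro allI ell2_ext) (simp add: tensor_id_nth contraction_simps)

lemma tensor_id_etensor: "clin a \<Longrightarrow> tensor_id a (etensor f \<xi>) = etensor (a f) \<xi>"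
  by (rule ell2_ext) (simp add: tensor_id_nth contraction_simps cinner_adj_left cinner_delta)

lemma tensor_id_ops:
  fixes a :: "('i, complex) ell2 \<Rightarrow>\<^sub>L ('i, complex) ell2"
  assumes a: "a \<in> ops (ell2_on X)"
  shows "tensor_id a v \<in> ell2_on X"
proof -
  have "adj a \<in> ops (ell2_on X)"
    by (rule ops_simps(5)[OF closed_csubspace_ell2_on a])
  then have "adj a (delta j) = 0" if "j \<notin> X" for j
  proof (rule opsD(3))
    fix v :: "('i, complex) ell2" assume "v \<in> ell2_on X"
    then have "cinner (delta j) v = 0" using that by (simp add: cinner_delta ell2_on_nth)
    then show "cinner v (delta j) = 0" by (simp add: cinner_eq_0_commute)
  qed
  then show ?thesis
    by (auto simp: ell2_on_def tensor_id_nth ops_clin[OF a] contraction_simps)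
qed

lemma tensor_op_eq:
  fixes a :: "('i, complex) ell2 \<Rightarrow>\<^sub>L ('i, complex) ell2" and b :: "'h::complex_hilbert \<Rightarrow>\<^sub>L 'h"
  assumes a: "a \<in> ops (ell2_on X)" and b: "clin b"
  shows "tensor_op X a b \<in> ops (ell2_on X)"
    "f \<in> ell2_on X \<Longrightarrow> tensor_op X a b (etensor f \<xi>) = etensor (a f) (b \<xi>)"
proof -
  define T :: "('i, 'h) ell2 \<Rightarrow>\<^sub>L ('i, 'h) ell2" where "T = tensor_id a o\<^sub>L wcomp X (\<lambda>i. i) (\<lambda>_. b)"
  have w: "inj_on (\<lambda>i. i) X" "\<And>i \<xi>. i \<in> X \<Longrightarrow> norm (b \<xi>) \<le> norm b * norm \<xi>" "0 \<le> norm b"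
    by (auto simp: norm_blinfun)
  have wops: "wcomp X (\<lambda>i. i) (\<lambda>_. b) \<in> ops (ell2_on X)"
    by (rule wcomp_ops[OF w]) (use b in auto)
  have T: "T \<in> ops (ell2_on X)"
    by (rule opsI)
      (simp_all add: T_def opsD(1)[OF wops] clinD tensor_id_clin ops_clin[OF a] tensor_id_ops[OF a]
        opsD(3)[OF wops] blinfun.zero_right)
  have Te: "T (etensor f \<xi>) = etensor (a f) (b \<xi>)" if "f \<in> ell2_on X" for f \<xi>
  proof -
    have "wcomp X (\<lambda>i. i) (\<lambda>_. b) (etensor f \<xi>) = etensor f (b \<xi>)"
      by (rule ell2_ext) (use ell2_on_nth[OF that] in \<open>simp add: wcomp_nth[OF w] clinD[OF b]\<close>)
    then show ?thesis by (simp add: T_def tensor_id_etensor ops_clin[OF a])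
  qed
  have "tensor_op X a b = T"
    unfolding tensor_op_def
  proof (rule the_equality)
    show "S = T" if "S \<in> ops (ell2_on X) \<and> (\<forall>f\<in>ell2_on X. \<forall>\<xi>. S (etensor f \<xi>) = etensor (a f) (b \<xi>))"
      for S :: "('i, 'h) ell2 \<Rightarrow>\<^sub>L ('i, 'h) ell2"
      by (rule ops_ell2_eqI[OF _ T]) (use that Te in auto)
  qed (use T Te in auto)
  then show "tensor_op X a b \<in> ops (ell2_on X)"
    "f \<in> ell2_on X \<Longrightarrow> tensor_op X a b (etensor f \<xi>) = etensor (a f) (b \<xi>)"
    using T Te by auto
qed


section \<open>The left regular representation\<close>

lemma wcomp_cinner:
  fixes u :: "'i \<Rightarrow> 'h::complex_hilbert \<Rightarrow>\<^sub>L 'h"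
  assumes \<tau>: "bij_betw \<tau> X X" and u: "\<And>i \<xi> \<eta>. i \<in> X \<Longrightarrow> cinner (u i \<xi>) (u i \<eta>) = cinner \<xi> \<eta>"
    and f: "f \<in> ell2_on X" and g: "g \<in> ell2_on X"
    and n: "\<And>i \<xi>. i \<in> X \<Longrightarrow> norm (u i \<xi>) \<le> 1 * norm \<xi>"
  shows "cinner (wcomp X \<tau> u f) (wcomp X \<tau> u g) = cinner f g"
proof -
  have inj: "inj_on \<tau> X" using \<tau> by (rule bij_betw_imp_inj_on)
  note nth = wcomp_nth[OF inj n zero_le_one]
  have "cinner (wcomp X \<tau> u f) (wcomp X \<tau> u g)
      = (\<Sum>\<^sub>\<infinity>i\<in>X. cinner (ell2_nth f (\<tau> i)) (ell2_nth g (\<tau> i)))"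
    unfolding cinner_ell2_def by (rule infsum_cong_neutral) (auto simp: nth u)
  also have "\<dots> = (\<Sum>\<^sub>\<infinity>i\<in>X. cinner (ell2_nth f i) (ell2_nth g i))"
    using infsum_reindex_bij_betw[OF \<tau>, of "\<lambda>i. cinner (ell2_nth f i) (ell2_nth g i)"] .
  also have "\<dots> = cinner f g"
    unfolding cinner_ell2_def by (rule infsum_cong_neutral) (use f in \<open>auto simp: ell2_on_nth\<close>)
  finally show ?thesis .
qed

lemma (in group) bij_betw_mult_inv:
  "g \<in> carrier G \<Longrightarrow> bij_betw (\<lambda>k. inv g \<otimes> k) (carrier G) (carrier G)"
  by (rule bij_betw_byWitness[where f' = "\<lambda>k. g \<otimes> k"]) (auto simp flip: m_assoc)

context
  fixes G :: "('g, 'b) monoid_scheme" (structure)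
  assumes G: "group G"
begin

interpretation group G by (rule G)

lemma left_regular_wcomp:
  assumes g: "g \<in> carrier G"
  shows "left_regular G g = wcomp (carrier G) (\<lambda>k. inv g \<otimes> k) (\<lambda>_. id_blinfun)"
    "wcomp (carrier G) (\<lambda>k. inv g \<otimes> k) (\<lambda>_. id_blinfun :: complex \<Rightarrow>\<^sub>L complex) \<in> ops (ell2_on (carrier G))"
    "h \<in> carrier G \<Longrightarrow> left_regular G g (delta h) = delta (g \<otimes> h)"
proof -
  let ?T = "wcomp (carrier G) (\<lambda>k. inv g \<otimes> k) (\<lambda>_. id_blinfun :: complex \<Rightarrow>\<^sub>L complex)"
  have inj: "inj_on (\<lambda>k. inv g \<otimes> k) (carrier G)"
    using bij_betw_mult_inv[OF g] by (rule bij_betw_imp_inj_on)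
  show T: "?T \<in> ops (ell2_on (carrier G))"
    by (rule wcomp_ops[OF inj, where C = 1]) (use g in auto)
  have Td: "?T (delta h) = delta (g \<otimes> h)" if h: "h \<in> carrier G" for h
  proof (rule ell2_ext)
    fix k
    have "inv g \<otimes> k = h \<longleftrightarrow> k = g \<otimes> h" if "k \<in> carrier G"
      using g h that by (metis inv_closed inv_solve_left' inv_inv)
    then show "ell2_nth (?T (delta h)) k = ell2_nth (delta (g \<otimes> h)) k"
      using g h by (auto simp: wcomp_nth[OF inj, where C = 1])
  qed
  show eq: "left_regular G g = ?T"
    unfolding left_regular_def
  proof (rule the_equality)
    fix S :: "('g, complex) ell2 \<Rightarrow>\<^sub>L ('g, complex) ell2"
    assume S: "S \<in> ops (ell2_on (carrier G)) \<and> (\<forall>h\<in>carrier G. S (delta h) = delta (g \<otimes> h))"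
    show "S = ?T"
      by (rule ops_ell2_eqI[OF _ T])
        (use S Td in \<open>auto simp: etensor_delta_complex opsD(1)[OF T] clinD[OF ops_clin[of S]]\<close>)
  qed (use T Td in auto)
  show "left_regular G g (delta h) = delta (g \<otimes> h)" if "h \<in> carrier G"
    unfolding eq by (rule Td[OF that])
qed

lemma left_regular_nth:
  assumes g: "g \<in> carrier G"
  shows "ell2_nth (left_regular G g f) k = (if k \<in> carrier G then ell2_nth f (inv g \<otimes> k) else 0)"
  unfolding left_regular_wcomp(1)[OF g]
  using bij_betw_imp_inj_on[OF bij_betw_mult_inv[OF g]]
  by (subst wcomp_nth[where C = 1]) auto

lemma left_regular_ops: "g \<in> carrier G \<Longrightarrow> left_regular G g \<in> ops (ell2_on (carrier G))"
  using left_regular_wcomp(1,2) by simp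

lemma unitary_rep_left_regular: "unitary_rep G (ell2_on (carrier G)) (left_regular G)"
  unfolding unitary_rep_def
proof (intro conjI ballI closed_csubspace_ell2_on)
  fix g assume g: "g \<in> carrier G"
  show "left_regular G g \<in> ops (ell2_on (carrier G))" by (rule left_regular_ops[OF g])
  show "cinner (left_regular G g \<xi>) (left_regular G g \<eta>) = cinner \<xi> \<eta>"
    if "\<xi> \<in> ell2_on (carrier G)" "\<eta> \<in> ell2_on (carrier G)" for \<xi> \<eta>
    unfolding left_regular_wcomp(1)[OF g]
    by (rule wcomp_cinner[OF bij_betw_mult_inv[OF g] _ that]) auto
next
  fix \<xi> :: "('g, complex) ell2" assume "\<xi> \<in> ell2_on (carrier G)"
  then show "left_regular G \<one> \<xi> = \<xi>"
    by (intro ell2_ext) (auto simp: left_regular_nth ell2_on_nth)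
next
  fix g h assume gh: "g \<in> carrier G" "h \<in> carrier G"
  show "left_regular G (g \<otimes> h) = left_regular G g o\<^sub>L left_regular G h"
  proof (rule blinfun_eqI, rule ell2_ext)
    fix f k
    have "inv (g \<otimes> h) \<otimes> k = inv h \<otimes> (inv g \<otimes> k)" if "k \<in> carrier G"
      using gh that by (simp add: inv_mult_group m_assoc)
    then show "ell2_nth (left_regular G (g \<otimes> h) f) k
        = ell2_nth ((left_regular G g o\<^sub>L left_regular G h) f) k"
      using gh by (auto simp: left_regular_nth)
  qed
qed

end


section \<open>Amenability and almost invariant vectors\<close>

subsection \<open>Integration of simple functions against a finitely additive measure\<close>

text \<open>A finitely additive probability measure on all subsets of \<open>K\<close>.\<close>

locale finitely_additive =
  fixes K :: "'g set" and \<mu> :: "'g set \<Rightarrow> real"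
  assumes total: "\<mu> K = 1" and nonneg: "A \<subseteq> K \<Longrightarrow> 0 \<le> \<mu> A"
    and additive: "A \<subseteq> K \<Longrightarrow> B \<subseteq> K \<Longrightarrow> A \<inter> B = {} \<Longrightarrow> \<mu> (A \<union> B) = \<mu> A + \<mu> B"
begin

text \<open>The integral of a function with finitely many values.\<close>

definition fint :: "('g \<Rightarrow> real) \<Rightarrow> real" where
  "fint f = (\<Sum>y\<in>f ` K. y * \<mu> {k\<in>K. f k = y})"

lemma empty: "\<mu> {} = 0"
  using additive[of "{}" "{}"] by simp

lemma additive_Union:
  assumes "finite Z" "\<And>z. z \<in> Z \<Longrightarrow> A z \<subseteq> K" "\<And>z z'. z \<in> Z \<Longrightarrow> z' \<in> Z \<Longrightarrow> z \<noteq> z' \<Longrightarrow> A z \<inter> A z' = {}"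
  shows "\<mu> (\<Union>z\<in>Z. A z) = (\<Sum>z\<in>Z. \<mu> (A z))"
  using assms
proof (induction Z rule: finite_induct)
  case (insert z Z)
  have "A z \<inter> (\<Union>z\<in>Z. A z) = {}" using insert by fastforce
  then have "\<mu> (A z \<union> (\<Union>z\<in>Z. A z)) = \<mu> (A z) + \<mu> (\<Union>z\<in>Z. A z)"
    using insert.prems by (intro additive) auto
  then show ?case using insert by simp
qed (simp add: empty)

text \<open>The integral may be computed on any finite partition on which the function is constant.\<close>

lemma fint_partition:
  assumes fin: "finite (u ` K)" and f: "\<And>k. k \<in> K \<Longrightarrow> f k = \<phi> (u k)"
  shows "fint f = (\<Sum>z\<in>u ` K. \<phi> z * \<mu> {k\<in>K. u k = z})"
proof -
  have im: "f ` K = \<phi> ` (u ` K)" using f by (auto simp: image_image)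
  have "(\<Sum>z\<in>u ` K. \<phi> z * \<mu> {k\<in>K. u k = z})
      = (\<Sum>y\<in>f ` K. \<Sum>z\<in>{z \<in> u ` K. \<phi> z = y}. \<phi> z * \<mu> {k\<in>K. u k = z})"
    unfolding im by (rule sum.image_gen[OF fin])
  also have "\<dots> = fint f"
    unfolding fint_def
  proof (rule sum.cong[OF refl])
    fix y assume "y \<in> f ` K"
    have "(\<Sum>z\<in>{z \<in> u ` K. \<phi> z = y}. \<phi> z * \<mu> {k\<in>K. u k = z})
        = y * (\<Sum>z\<in>{z \<in> u ` K. \<phi> z = y}. \<mu> {k\<in>K. u k = z})"
      by (simp add: sum_distrib_left)
    also have "(\<Sum>z\<in>{z \<in> u ` K. \<phi> z = y}. \<mu> {k\<in>K. u k = z})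
        = \<mu> (\<Union>z\<in>{z \<in> u ` K. \<phi> z = y}. {k\<in>K. u k = z})"
      using fin by (intro additive_Union[symmetric]) auto
    also have "(\<Union>z\<in>{z \<in> u ` K. \<phi> z = y}. {k\<in>K. u k = z}) = {k\<in>K. f k = y}"
      using f by auto
    finally show "(\<Sum>z\<in>{z \<in> u ` K. \<phi> z = y}. \<phi> z * \<mu> {k\<in>K. u k = z}) = y * \<mu> {k\<in>K. f k = y}" .
  qed
  finally show ?thesis by simp
qed

lemma
  assumes f: "finite (f ` K)" and g: "finite (g ` K)"
  shows fint_add: "fint (\<lambda>k. f k + g k) = fint f + fint g"
    and fint_mono: "(\<And>k. k \<in> K \<Longrightarrow> f k \<le> g k) \<Longrightarrow> fint f \<le> fint g"
proof -
  let ?u = "\<lambda>k. (f k, g k)"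
  have fin: "finite (?u ` K)"
    by (rule finite_subset[of _ "f ` K \<times> g ` K"]) (use f g in auto)
  show "fint (\<lambda>k. f k + g k) = fint f + fint g"
    by (simp add: fint_partition[OF fin, of _ fst] fint_partition[OF fin, of _ snd]
        fint_partition[OF fin, of _ "\<lambda>z. fst z + snd z"] distrib_right sum.distrib)
  assume le: "\<And>k. k \<in> K \<Longrightarrow> f k \<le> g k"
  show "fint f \<le> fint g"
    unfolding fint_partition[OF fin, of f fst, simplified] fint_partition[OF fin, of g snd, simplified]
    by (intro sum_mono mult_right_mono nonneg) (use le in auto)
qed

lemma fint_sum:
  assumes "finite S" "\<And>s. s \<in> S \<Longrightarrow> finite (f s ` K)"
  shows "finite ((\<lambda>k. \<Sum>s\<in>S. f s k) ` K) \<and> fint (\<lambda>k. \<Sum>s\<in>S. f s k) = (\<Sum>s\<in>S. fint (f s))"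
  using assms
proof (induction S rule: finite_induct)
  case empty
  have "(\<lambda>k. 0::real) ` K \<subseteq> {0}" by auto
  then show ?case by (auto simp: fint_def intro: finite_subset intro!: sum.neutral)
next
  case (insert s S)
  have fin: "finite ((\<lambda>k. f s k + (\<Sum>s\<in>S. f s k)) ` K)"
    by (rule finite_subset[of _ "(\<lambda>(a, b). a + b) ` (f s ` K \<times> (\<lambda>k. \<Sum>s\<in>S. f s k) ` K)"])
      (use insert in force)+
  then show ?case
    using insert by (simp add: fint_add)
qed

lemma fint_const: "fint (\<lambda>_. c) = c"
proof -
  have "K \<noteq> {}" using total empty by auto
  then show ?thesis by (simp add: fint_def image_constant_conv total)
qed

end


subsection \<open>Superharmonic functions on amenable groups\<close>

text \<open>On an amenable group, a positive function \<open>h\<close> with \<open>\<Sum>\<^sub>s h(s k) \<le> c h(k)\<close> for a finite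
  symmetric set \<open>S\<close> has \<open>c \<ge> card S\<close>: put \<open>r\<^sub>s(k) = h(s k) / h(k)\<close>. An invariant mean \<open>m\<close> gives
  \<open>m(r\<^sub>s) + m(r\<^sub>t) = m(r\<^sub>s + 1 / r\<^sub>s) \<ge> 2\<close> for \<open>t\<close> the inverse of \<open>s\<close>, as \<open>r\<^sub>t(s k) = 1 / r\<^sub>s(k)\<close>, while
  \<open>\<Sum>\<^sub>s m(r\<^sub>s) \<le> c\<close>. To integrate simple functions only, \<open>r\<^sub>s\<close> is rounded down to a multiple
  of \<open>1 / N\<close>.\<close>

lemma amenable_superharmonic:
  fixes G :: "('g, 'b) monoid_scheme" (structure) and h :: "'g \<Rightarrow> real"
  assumes G: "group G" and am: "amenable G"
    and S: "finite S" "S \<subseteq> carrier G" "\<And>s. s \<in> S \<Longrightarrow> inv s \<in> S"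
    and pos: "\<And>k. k \<in> carrier G \<Longrightarrow> 0 < h k"
    and sup: "\<And>k. k \<in> carrier G \<Longrightarrow> (\<Sum>s\<in>S. h (s \<otimes> k)) \<le> c * h k"
  shows "real (card S) \<le> c"
proof -
  interpret group G by (rule G)
  obtain \<mu> :: "'g set \<Rightarrow> real" where \<mu>: "\<mu> (carrier G) = 1" "\<And>A. A \<subseteq> carrier G \<Longrightarrow> 0 \<le> \<mu> A"
      "\<And>A B. A \<subseteq> carrier G \<Longrightarrow> B \<subseteq> carrier G \<Longrightarrow> A \<inter> B = {} \<Longrightarrow> \<mu> (A \<union> B) = \<mu> A + \<mu> B"
      "\<And>g A. g \<in> carrier G \<Longrightarrow> A \<subseteq> carrier G \<Longrightarrow> \<mu> (g <# A) = \<mu> A"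
  proof -
    from am[unfolded amenable_def] obtain \<mu> :: "'g set \<Rightarrow> real" where
      "\<mu> (carrier G) = 1" "\<forall>A\<subseteq>carrier G. 0 \<le> \<mu> A"
      "\<forall>A B. A \<subseteq> carrier G \<longrightarrow> B \<subseteq> carrier G \<longrightarrow> A \<inter> B = {} \<longrightarrow> \<mu> (A \<union> B) = \<mu> A + \<mu> B"
      "\<forall>g\<in>carrier G. \<forall>A\<subseteq>carrier G. \<mu> (g <# A) = \<mu> A"
      by (elim exE conjE)
    then show thesis by (intro that[of \<mu>]) simp_all
  qed
  interpret finitely_additive "carrier G" \<mu>
    by unfold_locales (use \<mu>(1-3) in auto)
  have shift: "fint (\<lambda>k. f (s \<otimes> k)) = fint f" if s: "s \<in> carrier G" for f s
  proof -
    have im: "(\<lambda>k. f (s \<otimes> k)) ` carrier G = f ` carrier G"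
    proof -
      have "(\<lambda>k. s \<otimes> k) ` carrier G = carrier G"
        using surj_const_mult[OF s] .
      then show ?thesis by (metis image_image)
    qed
    have "\<mu> {k \<in> carrier G. f (s \<otimes> k) = y} = \<mu> {k \<in> carrier G. f k = y}" for y
    proof -
      have "s <# {k \<in> carrier G. f (s \<otimes> k) = y} = {k \<in> carrier G. f k = y}"
      proof (intro equalityI subsetI)
        fix k assume k: "k \<in> {k \<in> carrier G. f k = y}"
        then have "s \<otimes> (inv s \<otimes> k) = k" "inv s \<otimes> k \<in> carrier G"
          using s by (simp_all flip: m_assoc)
        then show "k \<in> s <# {k \<in> carrier G. f (s \<otimes> k) = y}"
          using k unfolding l_coset_def by force
      qed (use s in \<open>auto simp: l_coset_def\<close>)
      then show ?thesis
        using \<mu>(4)[OF s, of "{k \<in> carrier G. f (s \<otimes> k) = y}"] by auto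
    qed
    then show ?thesis unfolding fint_def im by simp
  qed
  have nn: "0 \<le> h (s \<otimes> k)" if "s \<in> S" "k \<in> carrier G" for s k
    using pos[of "s \<otimes> k"] S(2) that by (auto intro!: less_imp_le)
  have c0: "0 \<le> c"
  proof -
    have "0 \<le> (\<Sum>s\<in>S. h (s \<otimes> \<one>))"
      using nn by (intro sum_nonneg) auto
    also have "\<dots> \<le> c * h \<one>" by (rule sup) simp
    finally show ?thesis using pos[of \<one>] by (simp add: zero_le_mult_iff)
  qed
  have main: "real (card S) * (real N - 1) \<le> c * real N" if N: "N > 0" for N :: nat
  proof -
    \<comment> \<open>\<open>N r\<^sub>s(k)\<close>, rounded down.\<close>
    define n where "n s k = real_of_int \<lfloor>real N * (h (s \<otimes> k) / h k)\<rfloor>" for s k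
    have n_le: "n s k \<le> real N * (h (s \<otimes> k) / h k)" and n_ge: "real N * (h (s \<otimes> k) / h k) - 1 < n s k" for s k
      unfolding n_def by linarith+
    have ratio: "h (s \<otimes> k) \<le> c * h k" if "s \<in> S" "k \<in> carrier G" for s k
    proof -
      have "h (s \<otimes> k) \<le> (\<Sum>s\<in>S. h (s \<otimes> k))"
        using S that nn by (intro member_le_sum) auto
      then show ?thesis using sup[OF that(2)] by linarith
    qed
    have fin: "finite (n s ` carrier G)" if s: "s \<in> S" for s
    proof (rule finite_subset)
      show "n s ` carrier G \<subseteq> real_of_int ` {0..\<lfloor>real N * c\<rfloor>}"
      proof
        fix y assume "y \<in> n s ` carrier G"
        then obtain k where k: "k \<in> carrier G" "y = n s k" by auto
        have sk: "s \<otimes> k \<in> carrier G" using s S(2) k by auto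
        have "0 \<le> h (s \<otimes> k) / h k" "h (s \<otimes> k) / h k \<le> c"
          using pos[OF sk] pos[OF k(1)] ratio[OF s k(1)] by (auto simp: field_simps)
        then show "y \<in> real_of_int ` {0..\<lfloor>real N * c\<rfloor>}"
          unfolding k(2) n_def
          using mult_left_mono[of "h (s \<otimes> k) / h k" c "real N"]
            mult_nonneg_nonneg[of "real N" "h (s \<otimes> k) / h k"]
          by (intro imageI) (simp add: floor_mono del: times_divide_eq_right)
      qed
    qed simp
    have "(\<Sum>s\<in>S. fint (n s)) = fint (\<lambda>k. \<Sum>s\<in>S. n s k)"
      using fint_sum[OF S(1) fin] by simp
    also have "\<dots> \<le> fint (\<lambda>_. real N * c)"
    proof (rule fint_mono)
      fix k assume k: "k \<in> carrier G"
      have "(\<Sum>s\<in>S. n s k) \<le> (\<Sum>s\<in>S. real N * (h (s \<otimes> k) / h k))"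
        by (intro sum_mono n_le)
      also have "\<dots> = real N * ((\<Sum>s\<in>S. h (s \<otimes> k)) / h k)"
        by (simp add: sum_distrib_left sum_divide_distrib)
      also have "\<dots> \<le> real N * c"
        using sup[OF k] pos[OF k] by (intro mult_left_mono) (auto simp: field_simps)
      finally show "(\<Sum>s\<in>S. n s k) \<le> real N * c" .
    next
      show "finite ((\<lambda>_. real N * c) ` carrier G)"
        by (rule finite_subset[of _ "{real N * c}"]) auto
    qed (use fint_sum[OF S(1), of n] fin in simp)
    finally have upper: "(\<Sum>s\<in>S. fint (n s)) \<le> real N * c"
      by (simp add: fint_const)
    have lower: "2 * real N - 2 \<le> fint (n s) + fint (n (inv s))" if s: "s \<in> S" for s
    proof -
      have sc: "s \<in> carrier G" "inv s \<in> S" using s S by auto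
      have "(\<lambda>k. n (inv s) (s \<otimes> k)) ` carrier G \<subseteq> n (inv s) ` carrier G"
        using sc by auto
      then have fin': "finite ((\<lambda>k. n (inv s) (s \<otimes> k)) ` carrier G)"
        using fin[OF sc(2)] by (rule finite_subset)
      have "2 * real N - 2 = fint (\<lambda>_. 2 * real N - 2)" by (simp add: fint_const)
      also have "\<dots> \<le> fint (\<lambda>k. n s k + n (inv s) (s \<otimes> k))"
      proof (rule fint_mono)
        fix k assume k: "k \<in> carrier G"
        define r where "r = h (s \<otimes> k) / h k"
        have r: "r > 0" using pos k sc by (simp add: r_def)
        have "inv s \<otimes> (s \<otimes> k) = k" using sc k by (simp flip: m_assoc)
        then have "real N * (1 / r) - 1 < n (inv s) (s \<otimes> k)"
          using n_ge[of "inv s" "s \<otimes> k"] by (simp add: r_def)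
        moreover have "real N * r - 1 < n s k" using n_ge[of s k] by (simp add: r_def)
        moreover have "2 \<le> r + 1 / r"
        proof -
          have "0 \<le> (r - 1)\<^sup>2 / r" using r by simp
          also have "\<dots> = r + 1 / r - 2" using r by (simp add: field_simps power2_eq_square)
          finally show ?thesis by simp
        qed
        then have "real N * 2 \<le> real N * (r + 1 / r)" by (intro mult_left_mono) auto
        ultimately show "2 * real N - 2 \<le> n s k + n (inv s) (s \<otimes> k)"
          by (simp add: distrib_left)
      next
        show "finite ((\<lambda>_. 2 * real N - 2) ` carrier G)"
          by (rule finite_subset[of _ "{2 * real N - 2}"]) auto
        show "finite ((\<lambda>k. n s k + n (inv s) (s \<otimes> k)) ` carrier G)"
          by (rule finite_subset[of _ "(\<lambda>(a, b). a + b) ` (n s ` carrier G \<times> (\<lambda>k. n (inv s) (s \<otimes> k)) ` carrier G)"])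
            (use fin[OF s] fin' in force)+
      qed
      also have "\<dots> = fint (n s) + fint (n (inv s))"
        by (simp add: fint_add[OF fin[OF s] fin'] shift[OF sc(1)])
      finally show ?thesis .
    qed
    have "bij_betw (\<lambda>s. inv s) S S"
      by (rule bij_betw_byWitness[where f' = "\<lambda>s. inv s"]) (use S in auto)
    then have "(\<Sum>s\<in>S. fint (n (inv s))) = (\<Sum>s\<in>S. fint (n s))"
      by (rule sum.reindex_bij_betw)
    moreover have "(\<Sum>s\<in>S. 2 * real N - 2) \<le> (\<Sum>s\<in>S. fint (n s) + fint (n (inv s)))"
      by (intro sum_mono lower)
    ultimately show ?thesis
      using upper by (simp add: sum.distrib algebra_simps)
  qed
  show ?thesis
  proof (rule ccontr)
    assume "\<not> real (card S) \<le> c"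
    then have d: "real (card S) - c > 0" by simp
    then obtain N :: nat where N: "real (card S) < real N * (real (card S) - c)"
      using reals_Archimedean3 by blast
    then have "N > 0" using c0 d by (cases N) auto
    then show False using main[of N] N by (simp add: algebra_simps)
  qed
qed


subsection \<open>Almost invariant vectors\<close>

text \<open>The vectors are found in \<open>\<ell>\<^sup>2\<close> of the whole group, with invariance only under the amenable
  subgroup \<open>K\<close>.\<close>

lemma almost_invariant_vector:
  fixes G :: "('g, 'b) monoid_scheme" (structure)
  assumes G: "group G" and K: "subgroup K G" and am: "amenable (G\<lparr>carrier := K\<rparr>)"
    and S: "finite S" "S \<subseteq> K" and e: "0 < e"
  obtains \<zeta> where "\<zeta> \<in> ell2_on (carrier G)" "norm \<zeta> = 1" "\<And>s. s \<in> S \<Longrightarrow> norm (left_regular G s \<zeta> - \<zeta>) < e"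
proof -
  interpret group G by (rule G)
  interpret K: subgroup K G by (rule K)
  have K_group: "group (G\<lparr>carrier := K\<rparr>)"
    using subgroup_imp_group[OF K] .
  let ?l = "left_regular G" and ?V = "ell2_on (carrier G) :: ('g, complex) ell2 set"
  note R = unitary_repD[OF unitary_rep_left_regular[OF G]]
  note Vs = closed_csubspaceD[OF closed_csubspace_ell2_on[of "carrier G"]]
  define S' where "S' = insert \<one> (S \<union> (\<lambda>s. inv s) ` S)"
  have S': "finite S'" "S' \<subseteq> K" "\<And>s. s \<in> S' \<Longrightarrow> inv s \<in> S'" "\<one> \<in> S'" "S \<subseteq> S'"
    using S by (auto simp: S'_def)
  have S'c: "s \<in> carrier G" if "s \<in> S'" for s using S'(2) that K.subset by auto
  define n where "n = real (card S')"
  have n1: "1 \<le> n"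
  proof -
    have "card S' \<noteq> 0" using S'(1,4) by auto
    then show ?thesis by (simp add: n_def)
  qed
  define M where "M = (\<Sum>s\<in>S'. ?l s)"
  have M_apply: "M f = (\<Sum>s\<in>S'. ?l s f)" for f by (simp add: M_def blinfun.sum_left)
  have MV: "M f \<in> ?V" for f
    unfolding M_apply by (intro closed_csubspace_sum[OF closed_csubspace_ell2_on] R(8) S'c)
  \<comment> \<open>If \<open>M\<close> had norm at most \<open>n - \<delta>\<close>, the fixed point \<open>h = \<Sum>\<^sub>j \<tau>\<^sup>j M\<^sup>j \<delta>\<^sub>1\<close> of
    \<open>h \<mapsto> \<delta>\<^sub>1 + \<tau> M h\<close> with \<open>1 / \<tau> = n - \<delta> / 2\<close> would yield a superharmonic function on \<open>K\<close> with
    constant \<open>1 / \<tau> < n\<close>.\<close>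
  have norm_M: "\<exists>\<xi>\<in>?V. norm \<xi> = 1 \<and> n - \<delta> < norm (M \<xi>)" if \<delta>: "0 < \<delta>" "\<delta> \<le> 1" for \<delta>
  proof (rule ccontr)
    assume neg: "\<not> ?thesis"
    have bound: "norm (M \<xi>) \<le> (n - \<delta>) * norm \<xi>" if "\<xi> \<in> ?V" for \<xi>
    proof (cases "\<xi> = 0")
      case False
      then have "(1 / norm \<xi>) *\<^sub>R \<xi> \<in> ?V" "norm ((1 / norm \<xi>) *\<^sub>R \<xi>) = 1"
        using that Vs(5) by auto
      then have "norm (M ((1 / norm \<xi>) *\<^sub>R \<xi>)) \<le> n - \<delta>"
        using neg by (meson not_less)
      then show ?thesis using False by (simp add: blinfun.scaleR_right field_simps)
    qed (simp add: blinfun.zero_right)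
    define \<tau> where "\<tau> = 1 / (n - \<delta> / 2)"
    have \<tau>: "\<tau> > 0" "\<tau> * (n - \<delta>) < 1" "0 \<le> \<tau> * (n - \<delta>)" "1 / \<tau> = n - \<delta> / 2"
      using n1 \<delta> by (auto simp: \<tau>_def field_simps)
    define C where "C = {f \<in> ?V. \<forall>k. 0 \<le> Re (ell2_nth f k)}"
    have "closed C"
    proof -
      have "C = ?V \<inter> (\<Inter>k. {f. 0 \<le> Re (ell2_nth f k)})" by (auto simp: C_def)
      also have "closed \<dots>"
        by (intro closed_Int Vs(1) closed_INT ballI closed_Collect_le continuous_intros
            bounded_linear.continuous_on[OF bounded_linear_compose[OF bounded_linear_Re ell2_nth_bounded_linear], simplified])
      finally show ?thesis .
    qed
    then have "complete C" by (simp add: complete_eq_closed)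
    have M_nth: "ell2_nth (M f) k = (\<Sum>s\<in>S'. ell2_nth f (inv s \<otimes> k))" if "k \<in> carrier G" for f k
      unfolding M_apply using that by (simp add: left_regular_nth[OF G] S'c)
    have M_nth0: "ell2_nth (M f) k = 0" if "k \<notin> carrier G" for f k
      by (rule ell2_on_nth[OF MV that])
    have "\<exists>!h\<in>C. delta \<one> + \<tau> *\<^sub>R M h = h"
    proof (rule Banach_fix[of C "\<tau> * (n - \<delta>)"])
      show "complete C" by fact
      show "C \<noteq> {}" by (auto simp: C_def intro!: exI[of _ 0] Vs(2))
      show "(\<lambda>h. delta \<one> + \<tau> *\<^sub>R M h) ` C \<subseteq> C"
      proof
        fix f assume "f \<in> (\<lambda>h. delta \<one> + \<tau> *\<^sub>R M h) ` C"
        then obtain h where h: "f = delta \<one> + \<tau> *\<^sub>R M h" "h \<in> C" by auto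
        have "0 \<le> Re (ell2_nth (M h) k)" for k
          using h(2) by (cases "k \<in> carrier G") (auto simp: M_nth M_nth0 C_def intro!: sum_nonneg)
        then show "f \<in> C"
          using \<tau>(1) MV by (auto simp: C_def h(1) intro!: Vs add_nonneg_nonneg)
      qed
      show "dist (delta \<one> + \<tau> *\<^sub>R M x) (delta \<one> + \<tau> *\<^sub>R M y) \<le> \<tau> * (n - \<delta>) * dist x y"
        if "x \<in> C" "y \<in> C" for x y
      proof -
        have "norm (M (x - y)) \<le> (n - \<delta>) * norm (x - y)"
          using that by (intro bound Vs(7)) (auto simp: C_def)
        then show ?thesis
          using \<tau>(1) by (simp add: dist_norm blinfun.diff_right flip: scaleR_right_diff_distrib)
      qed
    qed (use \<tau> in auto)
    then obtain h where h: "h \<in> C" "delta \<one> + \<tau> *\<^sub>R M h = h" by blast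
    define a where "a k = Re (ell2_nth h k)" for k
    have a0: "0 \<le> a k" for k using h(1) by (simp add: C_def a_def)
    have a_eq: "a k = (if k = \<one> then 1 else 0) + \<tau> * (\<Sum>s\<in>S'. a (inv s \<otimes> k))" if "k \<in> carrier G" for k
      using arg_cong[OF h(2), of "\<lambda>f. Re (ell2_nth f k)"] that
      by (cases "k = \<one>") (auto simp: a_def M_nth)
    have inv_bij: "bij_betw (\<lambda>s. inv s) S' S'"
      by (rule bij_betw_byWitness[where f' = "\<lambda>s. inv s"]) (use S' S'c in auto)
    have a_sup: "(\<Sum>s\<in>S'. a (s \<otimes> k)) \<le> (n - \<delta> / 2) * a k" if "k \<in> carrier G" for k
    proof -
      have "(\<Sum>s\<in>S'. a (inv s \<otimes> k)) = (\<Sum>s\<in>S'. a (s \<otimes> k))"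
        using sum.reindex_bij_betw[OF inv_bij, of "\<lambda>s. a (s \<otimes> k)"] .
      then have "\<tau> * (\<Sum>s\<in>S'. a (s \<otimes> k)) \<le> a k"
        using a_eq[OF that] by auto
      then show ?thesis
        unfolding \<tau>(4)[symmetric] using \<tau>(1) by (simp add: field_simps)
    qed
    have a_pos_step: "0 < a (s \<otimes> k)" if "0 < a k" "s \<in> S'" "k \<in> carrier G" for s k
    proof -
      have "inv s \<otimes> (s \<otimes> k) = k" using that S'c by (simp flip: m_assoc)
      then have "a k \<le> (\<Sum>t\<in>S'. a (inv t \<otimes> (s \<otimes> k)))"
        using member_le_sum[of s S' "\<lambda>t. a (inv t \<otimes> (s \<otimes> k))"] S'(1) a0 that by auto
      then have "0 < \<tau> * (\<Sum>t\<in>S'. a (inv t \<otimes> (s \<otimes> k)))"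
        using \<tau>(1) that by simp
      then show ?thesis
        using a_eq[of "s \<otimes> k"] that S'c by auto
    qed
    \<comment> \<open>The function \<open>a\<close> need not be positive off the subgroup generated by \<open>S'\<close>. It is translated on
      the right by a point \<open>q k\<close> that makes it positive at \<open>k\<close> and does not change when \<open>k\<close> is
      multiplied by \<open>S'\<close> on the left.\<close>
    define Q where "Q k = {c \<in> carrier G. 0 < a (k \<otimes> inv c)}" for k
    define q where "q k = (SOME c. c \<in> Q k)" for k
    have "0 < a \<one>"
      using a_eq[of \<one>] mult_nonneg_nonneg[OF less_imp_le[OF \<tau>(1)] sum_nonneg[of S' "\<lambda>s. a (inv s \<otimes> \<one>)"]] a0
      by simp
    then have "k \<in> Q k" if "k \<in> carrier G" for k using that by (simp add: Q_def)
    then have q: "q k \<in> Q k" if "k \<in> carrier G" for k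
      unfolding q_def using that by (metis someI_ex)
    have Q_sub: "Q k \<subseteq> Q (s \<otimes> k)" if "s \<in> S'" "k \<in> carrier G" for s k
      using a_pos_step[OF _ that(1)] that S'c by (auto simp: Q_def m_assoc)
    have Q_eq: "Q (s \<otimes> k) = Q k" if "s \<in> S'" "k \<in> carrier G" for s k
    proof
      have "inv s \<otimes> (s \<otimes> k) = k" using that S'c by (simp flip: m_assoc)
      then show "Q (s \<otimes> k) \<subseteq> Q k"
        using Q_sub[OF S'(3)[OF that(1)], of "s \<otimes> k"] that S'c by simp
    qed (rule Q_sub[OF that])
    define b where "b k = a (k \<otimes> inv (q k))" for k
    have "real (card S') \<le> n - \<delta> / 2"
    proof (rule amenable_superharmonic[OF K_group am S'(1)])
      show "S' \<subseteq> carrier (G\<lparr>carrier := K\<rparr>)" using S'(2) by simp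
      show "inv\<^bsub>G\<lparr>carrier := K\<rparr>\<^esub> s \<in> S'" if "s \<in> S'" for s
        using S'(3)[OF that] m_inv_consistent[OF K] S'(2) that by auto
      show "0 < b k" if "k \<in> carrier (G\<lparr>carrier := K\<rparr>)" for k
        using q[of k] that K.subset by (auto simp: Q_def b_def)
      show "(\<Sum>s\<in>S'. b (s \<otimes>\<^bsub>G\<lparr>carrier := K\<rparr>\<^esub> k)) \<le> (n - \<delta> / 2) * b k" if "k \<in> carrier (G\<lparr>carrier := K\<rparr>)" for k
      proof -
        have k: "k \<in> carrier G" using that K.subset by auto
        have qc: "q k \<in> carrier G" using q[OF k] by (simp add: Q_def)
        have "b (s \<otimes> k) = a (s \<otimes> (k \<otimes> inv (q k)))" if "s \<in> S'" for s
          using Q_eq[OF that k] S'c[OF that] k qc by (simp add: b_def q_def m_assoc)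
        then show ?thesis
          using a_sup[of "k \<otimes> inv (q k)"] k qc by (simp add: b_def)
      qed
    qed
    then show False using \<delta> by (simp add: n_def)
  qed
  \<comment> \<open>A unit vector whose \<open>n\<close> translates have a sum of norm almost \<open>n\<close> is almost invariant, by the
    parallelogram law.\<close>
  define \<delta> where "\<delta> = min 1 (e\<^sup>2 / 4)"
  have \<delta>: "0 < \<delta>" "\<delta> \<le> 1" "4 * \<delta> \<le> e\<^sup>2" using e by (auto simp: \<delta>_def)
  obtain \<xi> where \<xi>: "\<xi> \<in> ?V" "norm \<xi> = 1" "n - \<delta> < norm (M \<xi>)"
    using norm_M[OF \<delta>(1,2)] by blast
  have "norm (?l s \<xi> - \<xi>) < e" if s: "s \<in> S" for s
  proof (cases "s = \<one>")
    case True
    then show ?thesis using R(4)[OF \<xi>(1)] e by simp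
  next
    case False
    have sS: "s \<in> S'" "s \<in> carrier G" using s S'(5) S'c by auto
    have "M \<xi> = (?l s \<xi> + \<xi>) + (\<Sum>t\<in>S' - {s, \<one>}. ?l t \<xi>)"
    proof -
      have "M \<xi> = (\<Sum>t\<in>{s, \<one>}. ?l t \<xi>) + (\<Sum>t\<in>S' - {s, \<one>}. ?l t \<xi>)"
        unfolding M_apply using sS S'(1,4) by (subst sum.subset_diff[of "{s, \<one>}"]) (auto simp: add.commute)
      then show ?thesis using False R(4)[OF \<xi>(1)] by simp
    qed
    then have "norm (M \<xi>) \<le> norm (?l s \<xi> + \<xi>) + norm (\<Sum>t\<in>S' - {s, \<one>}. ?l t \<xi>)"
      by (simp add: norm_triangle_ineq)
    also have "norm (\<Sum>t\<in>S' - {s, \<one>}. ?l t \<xi>) \<le> (\<Sum>t\<in>S' - {s, \<one>}. 1)"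
      by (rule order_trans[OF norm_sum]) (use R(6)[OF S'c \<xi>(1)] \<xi>(2) in \<open>auto intro!: sum_mono\<close>)
    also have "\<dots> = n - 2"
    proof -
      have "card (S' - {s, \<one>}) = card S' - 2"
        using False sS S'(1,4) by (simp add: card_Diff_subset)
      moreover have "2 \<le> card S'"
        using False sS S'(1,4) card_mono[of S' "{s, \<one>}"] by simp
      ultimately show ?thesis by (simp add: n_def)
    qed
    finally have "2 - \<delta> < norm (?l s \<xi> + \<xi>)" using \<xi>(3) by simp
    then have "(2 - \<delta>)\<^sup>2 < (norm (?l s \<xi> + \<xi>))\<^sup>2"
      using \<delta> by (intro power_strict_mono) auto
    moreover have "(norm (?l s \<xi> + \<xi>))\<^sup>2 + (norm (?l s \<xi> - \<xi>))\<^sup>2 = 2 * (norm (?l s \<xi>))\<^sup>2 + 2 * (norm \<xi>)\<^sup>2"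
      by (simp add: power2_norm_eq_inner inner_add_left inner_add_right inner_diff_left inner_diff_right inner_commute)
    then have "(norm (?l s \<xi> + \<xi>))\<^sup>2 + (norm (?l s \<xi> - \<xi>))\<^sup>2 = 4"
      using R(6)[OF sS(2) \<xi>(1)] \<xi>(2) by simp
    moreover have "4 - (2 - \<delta>)\<^sup>2 \<le> 4 * \<delta>"
      by (simp add: power2_eq_square algebra_simps)
    ultimately have "(norm (?l s \<xi> - \<xi>))\<^sup>2 < e\<^sup>2"
      using \<delta>(3) by linarith
    then show ?thesis using e by (simp add: power_less_imp_less_base)
  qed
  then show thesis using that \<xi> by blast
qed


section \<open>Weak containment in the regular representation\<close>

lemma lincomb_apply: "lincomb \<pi> xs v = (\<Sum>(c, g)\<leftarrow>xs. c *\<^sub>C \<pi> g v)"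
  for \<pi> :: "'g \<Rightarrow> 'a::complex_hilbert \<Rightarrow>\<^sub>L 'a"
  by (induction xs) (auto simp: blinfun.add_left)

lemma sum_list_index: "(\<Sum>(c, g)\<leftarrow>xs. f c g) = (\<Sum>i<length xs. f (fst (xs ! i)) (snd (xs ! i)))"
  by (simp add: sum_list_sum_nth atLeast0LessThan case_prod_beta)

lemma norm_sum_etensor_labels:
  fixes w :: "'p \<Rightarrow> 'h::complex_hilbert"
  assumes "\<And>p. p \<in> P \<Longrightarrow> norm (\<zeta> (y p)) = 1"
    "\<And>p q. p \<in> P \<Longrightarrow> q \<in> P \<Longrightarrow> y p \<noteq> y q \<Longrightarrow> cinner (w p) (w q) = 0"
  shows "norm (\<Sum>p\<in>P. etensor (\<zeta> (y p)) (w p)) = norm (\<Sum>p\<in>P. w p)"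
proof -
  have eq: "cinner (\<zeta> (y p)) (\<zeta> (y q)) * cinner (w p) (w q) = cinner (w p) (w q)" if "p \<in> P" "q \<in> P" for p q
    using assms that by (cases "y p = y q") (auto simp: cinner_self)
  have "cinner (\<Sum>p\<in>P. etensor (\<zeta> (y p)) (w p)) (\<Sum>p\<in>P. etensor (\<zeta> (y p)) (w p))
      = cinner (\<Sum>p\<in>P. w p) (\<Sum>p\<in>P. w p)"
    unfolding cinner_sum_left cinner_sum_right cinner_etensor by (intro sum.cong refl eq)
  then have "(norm (\<Sum>p\<in>P. etensor (\<zeta> (y p)) (w p)))\<^sup>2 = (norm (\<Sum>p\<in>P. w p))\<^sup>2"
    unfolding cinner_self using of_real_eq_iff by blast
  then show ?thesis by simp
qed

context
  fixes G :: "('g, 'b) monoid_scheme" (structure)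
  assumes G: "group G"
begin

interpretation group G by (rule G)

lemma tensor_id_lincomb:
  assumes "snd ` set xs \<subseteq> carrier G"
  shows "tensor_id (lincomb (left_regular G) xs) w = (\<Sum>(c, g)\<leftarrow>xs. c *\<^sub>C tensor_id (left_regular G g) w)"
proof -
  note R = unitary_rep_left_regular[OF G]
  have "clin (lincomb (left_regular G) xs) \<and>
      tensor_id (lincomb (left_regular G) xs) w = (\<Sum>(c, g)\<leftarrow>xs. c *\<^sub>C tensor_id (left_regular G g) w)"
    using assms
  proof (induction xs)
    case Nil
    show ?case by (auto intro!: ell2_ext simp: tensor_id_nth contraction_simps)
  next
    case (Cons x xs)
    obtain c g where x: "x = (c, g)" by (cases x)
    have g: "clin (left_regular G g)" using unitary_repD(7)[OF R] Cons.prems by (simp add: x)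
    have IH: "clin (lincomb (left_regular G) xs)"
        "tensor_id (lincomb (left_regular G) xs) w = (\<Sum>(c, g)\<leftarrow>xs. c *\<^sub>C tensor_id (left_regular G g) w)"
      using Cons by auto
    have "tensor_id (scaleC_op c (left_regular G g) + lincomb (left_regular G) xs) w
        = c *\<^sub>C tensor_id (left_regular G g) w + tensor_id (lincomb (left_regular G) xs) w"
      by (rule ell2_ext)
        (simp add: tensor_id_nth g IH(1) adj_add adj_scaleC_op contraction_simps blinfun.add_left)
    then show ?case using g IH by (simp add: x)
  qed
  then show ?thesis by blast
qed

text \<open>Fell absorption: on \<open>\<ell>\<^sup>2(G) \<otimes> V\<close>, the representation \<open>\<lambda> \<otimes> \<rho>\<close> is conjugate to \<open>\<lambda> \<otimes> 1\<close> by
  the unitary \<open>w \<mapsto> (k \<mapsto> \<rho>(k) w(k))\<close>.\<close>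

lemma fell_absorption_bound:
  fixes \<rho> :: "'g \<Rightarrow> 'w::complex_hilbert \<Rightarrow>\<^sub>L 'w"
  assumes R: "unitary_rep G V \<rho>" and xs: "snd ` set xs \<subseteq> carrier G"
    and J: "\<And>j. j \<in> J \<Longrightarrow> \<zeta> j \<in> ell2_on (carrier G)" "\<And>j. j \<in> J \<Longrightarrow> v j \<in> V"
  shows "norm (\<Sum>j\<in>J. \<Sum>(c, h)\<leftarrow>xs. c *\<^sub>C etensor (left_regular G h (\<zeta> j)) (\<rho> h (v j)))
    \<le> norm (lincomb (left_regular G) xs) * norm (\<Sum>j\<in>J. etensor (\<zeta> j) (v j))"
proof -
  note RD = unitary_repD[OF R] and L = unitary_repD[OF unitary_rep_left_regular[OF G]]
  define U :: "('g, 'w) ell2 \<Rightarrow>\<^sub>L ('g, 'w) ell2" where "U = wcomp (carrier G) (\<lambda>k. k) (\<lambda>k. \<rho> (inv k))"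
  define U' :: "('g, 'w) ell2 \<Rightarrow>\<^sub>L ('g, 'w) ell2" where "U' = wcomp (carrier G) (\<lambda>k. k) \<rho>"
  have inj: "inj_on (\<lambda>k. k) (carrier G)" by simp
  have n1: "norm (\<rho> (inv k) \<xi>) \<le> 1 * norm \<xi>" and n2: "norm (\<rho> k \<xi>) \<le> 1 * norm \<xi>"
    if "k \<in> carrier G" for k \<xi>
    using unitary_rep_norm_le[OF R] that by auto
  have U: "ell2_nth (U f) k = (if k \<in> carrier G then \<rho> (inv k) (ell2_nth f k) else 0)"
      "norm (U f) \<le> norm f" for f k
    using wcomp_nth[OF inj n1 zero_le_one, where f = f] wcomp_norm[OF inj n1 zero_le_one, where f = f]
    by (auto simp: U_def)
  have U': "ell2_nth (U' f) k = (if k \<in> carrier G then \<rho> k (ell2_nth f k) else 0)"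
      "norm (U' f) \<le> norm f" for f k
    using wcomp_nth[OF inj n2 zero_le_one, where f = f] wcomp_norm[OF inj n2 zero_le_one, where f = f]
    by (auto simp: U'_def)
  have U'c: "clin U'"
    unfolding U'_def by (rule wcomp_clin[OF inj n2 zero_le_one]) (use RD(7) in auto)
  have conj: "U' (tensor_id (left_regular G h) (U (etensor \<zeta> v))) = etensor (left_regular G h \<zeta>) (\<rho> h v)"
    if h: "h \<in> carrier G" for h \<zeta> v
  proof (rule ell2_ext)
    fix k
    show "ell2_nth (U' (tensor_id (left_regular G h) (U (etensor \<zeta> v)))) k
        = ell2_nth (etensor (left_regular G h \<zeta>) (\<rho> h v)) k"
    proof (cases "k \<in> carrier G")
      case True
      have "inv (inv h \<otimes> k) = inv k \<otimes> h" using True h by (simp add: inv_mult_group)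
      then have "ell2_nth (tensor_id (left_regular G h) (U (etensor \<zeta> v))) k
          = \<rho> (inv k \<otimes> h) (ell2_nth \<zeta> (inv h \<otimes> k) *\<^sub>C v)"
        using True h
        by (simp add: tensor_id_nth L(7) adj_unitary_rep[OF G unitary_rep_left_regular[OF G]]
            left_regular_wcomp(3)[OF G] contraction_simps U(1))
      moreover have "\<rho> k (\<rho> (inv k \<otimes> h) \<xi>) = \<rho> h \<xi>" for \<xi>
      proof -
        have "k \<otimes> (inv k \<otimes> h) = h" using True h by (simp flip: m_assoc)
        then show ?thesis using RD(5)[of k "inv k \<otimes> h"] True h
          by (metis blinfun_apply_blinfun_compose inv_closed m_closed)
      qed
      ultimately show ?thesis
        using True h by (simp add: U'(1) left_regular_nth[OF G] clinD[OF RD(7)])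
    qed (use h in \<open>simp add: U'(1) left_regular_nth[OF G]\<close>)
  qed
  define w where "w = (\<Sum>j\<in>J. etensor (\<zeta> j) (v j))"
  have "(\<Sum>j\<in>J. \<Sum>(c, h)\<leftarrow>xs. c *\<^sub>C etensor (left_regular G h (\<zeta> j)) (\<rho> h (v j)))
      = (\<Sum>j\<in>J. \<Sum>(c, h)\<leftarrow>xs. c *\<^sub>C U' (tensor_id (left_regular G h) (U (etensor (\<zeta> j) (v j)))))"
  proof (rule sum.cong[OF refl])
    fix j
    show "(\<Sum>(c, h)\<leftarrow>xs. c *\<^sub>C etensor (left_regular G h (\<zeta> j)) (\<rho> h (v j)))
        = (\<Sum>(c, h)\<leftarrow>xs. c *\<^sub>C U' (tensor_id (left_regular G h) (U (etensor (\<zeta> j) (v j)))))"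
      by (rule arg_cong[where f = sum_list], rule map_cong[OF refl]) (use xs conj in auto)
  qed
  also have "\<dots> = (\<Sum>j\<in>J. U' (tensor_id (lincomb (left_regular G) xs) (U (etensor (\<zeta> j) (v j)))))"
    by (rule sum.cong[OF refl], unfold tensor_id_lincomb[OF xs] sum_list_index)
      (simp add: blinfun.sum_right clinD[OF U'c])
  also have "\<dots> = U' (tensor_id (lincomb (left_regular G) xs) (U w))"
    by (simp add: w_def blinfun.sum_right)
  finally have "norm (\<Sum>j\<in>J. \<Sum>(c, h)\<leftarrow>xs. c *\<^sub>C etensor (left_regular G h (\<zeta> j)) (\<rho> h (v j)))
      \<le> norm (tensor_id (lincomb (left_regular G) xs) (U w))"
    using U'(2) by simp
  also have "\<dots> \<le> norm (lincomb (left_regular G) xs) * norm (U w)"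
    using lincomb_adj[OF G unitary_rep_left_regular[OF G] xs] by (intro tensor_id_norm) blast
  also have "\<dots> \<le> norm (lincomb (left_regular G) xs) * norm w"
    by (intro mult_left_mono U(2)) simp
  finally show ?thesis by (simp add: w_def)
qed

text \<open>If the components \<open>v(x)\<close> of a vector are permuted by the representation according to an
  action \<open>a\<close> on the labels, and there are almost equivariant fields \<open>x \<mapsto> \<zeta>(x)\<close> of unit vectors
  of the regular representation, then \<open>v(x) \<mapsto> \<zeta>(x) \<otimes> v(x)\<close> almost intertwines \<open>\<rho>\<close> with
  \<open>\<lambda> \<otimes> \<rho>\<close>.\<close>

lemma equivariant_field_bound:
  fixes \<rho> :: "'g \<Rightarrow> 'w::complex_hilbert \<Rightarrow>\<^sub>L 'w" and a :: "'g \<Rightarrow> 'x \<Rightarrow> 'x"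
  assumes R: "unitary_rep G V \<rho>" and xs: "snd ` set xs \<subseteq> carrier G"
    and F: "finite F" and v: "\<And>x. x \<in> F \<Longrightarrow> v x \<in> V"
    and orth: "\<And>x y. x \<in> F \<Longrightarrow> y \<in> F \<Longrightarrow> x \<noteq> y \<Longrightarrow> cinner (v x) (v y) = 0"
      "\<And>g h x y. g \<in> carrier G \<Longrightarrow> h \<in> carrier G \<Longrightarrow> x \<in> F \<Longrightarrow> y \<in> F \<Longrightarrow> a g x \<noteq> a h y \<Longrightarrow>
         cinner (\<rho> g (v x)) (\<rho> h (v y)) = 0"
    and field: "\<And>\<epsilon>. 0 < \<epsilon> \<Longrightarrow> \<exists>\<zeta>. (\<forall>x\<in>F. \<zeta> x \<in> ell2_on (carrier G) \<and> norm (\<zeta> x) = 1) \<and>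
      (\<forall>h\<in>snd ` set xs. \<forall>x\<in>F. norm (\<zeta> (a h x)) = 1 \<and> norm (left_regular G h (\<zeta> x) - \<zeta> (a h x)) \<le> \<epsilon>)"
  shows "norm (lincomb \<rho> xs (\<Sum>x\<in>F. v x)) \<le> norm (lincomb (left_regular G) xs) * norm (\<Sum>x\<in>F. v x)"
proof (rule field_le_epsilon)
  fix e :: real assume e: "0 < e"
  define c where "c i = fst (xs ! i)" for i
  define h where "h i = snd (xs ! i)" for i
  define n where "n = length xs"
  have h: "h i \<in> carrier G" "h i \<in> snd ` set xs" if "i < n" for i
    using that xs nth_mem[of i xs] by (auto simp: h_def n_def image_subset_iff)
  define P where "P = F \<times> {..<n}"
  define C where "C = (\<Sum>(x, i)\<in>P. cmod (c i) * norm (v x))"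
  have C0: "0 \<le> C" unfolding C_def by (intro sum_nonneg) auto
  obtain \<zeta> where \<zeta>: "\<And>x. x \<in> F \<Longrightarrow> \<zeta> x \<in> ell2_on (carrier G)" "\<And>x. x \<in> F \<Longrightarrow> norm (\<zeta> x) = 1"
      "\<And>h x. h \<in> snd ` set xs \<Longrightarrow> x \<in> F \<Longrightarrow> norm (\<zeta> (a h x)) = 1"
      "\<And>h x. h \<in> snd ` set xs \<Longrightarrow> x \<in> F \<Longrightarrow> norm (left_regular G h (\<zeta> x) - \<zeta> (a h x)) \<le> e / (C + 1)"
    using field[of "e / (C + 1)"] e C0 by (auto simp: add_nonneg_pos)
  \<comment> \<open>\<open>A\<close> is the image of \<open>lincomb \<rho> xs (\<Sum>x\<in>F. v x)\<close> under \<open>w(y) \<mapsto> \<zeta>(y) \<otimes> w(y)\<close>, whereas \<open>B\<close> is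
    obtained by applying the combination of \<open>\<lambda> \<otimes> \<rho>\<close> to \<open>\<Sum>x\<in>F. \<zeta>(x) \<otimes> v(x)\<close>.\<close>
  define A where "A = (\<Sum>(x, i)\<in>P. etensor (\<zeta> (a (h i) x)) (c i *\<^sub>C \<rho> (h i) (v x)))"
  define B where "B = (\<Sum>(x, i)\<in>P. etensor (left_regular G (h i) (\<zeta> x)) (c i *\<^sub>C \<rho> (h i) (v x)))"
  have "norm A = norm (\<Sum>(x, i)\<in>P. c i *\<^sub>C \<rho> (h i) (v x))"
    unfolding A_def case_prod_beta
    by (rule norm_sum_etensor_labels)
      (use h \<zeta>(3) orth(2) in \<open>auto simp: P_def cinner_scaleC_left cinner_scaleC_right\<close>)
  also have "(\<Sum>(x, i)\<in>P. c i *\<^sub>C \<rho> (h i) (v x)) = lincomb \<rho> xs (\<Sum>x\<in>F. v x)"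
    unfolding P_def blinfun.sum_right
    by (subst sum.cartesian_product[symmetric])
      (simp add: lincomb_apply sum_list_index c_def h_def n_def)
  finally have A: "norm (lincomb \<rho> xs (\<Sum>x\<in>F. v x)) = norm A" by simp
  have "B = (\<Sum>x\<in>F. \<Sum>(c, h)\<leftarrow>xs. c *\<^sub>C etensor (left_regular G h (\<zeta> x)) (\<rho> h (v x)))"
    unfolding B_def P_def
    by (subst sum.cartesian_product[symmetric])
      (simp add: sum_list_index c_def h_def n_def etensor_simps)
  then have "norm B \<le> norm (lincomb (left_regular G) xs) * norm (\<Sum>x\<in>F. etensor (\<zeta> x) (v x))"
    using fell_absorption_bound[OF R xs \<zeta>(1) v, of F] by simp
  also have "norm (\<Sum>x\<in>F. etensor (\<zeta> x) (v x)) = norm (\<Sum>x\<in>F. v x)"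
    using norm_sum_etensor_labels[of F \<zeta> "\<lambda>x. x" v] \<zeta>(2) orth(1) by simp
  finally have B: "norm B \<le> norm (lincomb (left_regular G) xs) * norm (\<Sum>x\<in>F. v x)" .
  have "B - A = (\<Sum>(x, i)\<in>P. etensor (left_regular G (h i) (\<zeta> x) - \<zeta> (a (h i) x)) (c i *\<^sub>C \<rho> (h i) (v x)))"
    unfolding A_def B_def case_prod_beta etensor_simps(3) sum_subtractf ..
  also have "norm \<dots> \<le> (\<Sum>(x, i)\<in>P. e / (C + 1) * (cmod (c i) * norm (v x)))"
    unfolding case_prod_beta
  proof (rule sum_norm_le)
    fix p assume p: "p \<in> P"
    then have *: "fst p \<in> F" "snd p < n" by (auto simp: P_def)
    show "norm (etensor (left_regular G (h (snd p)) (\<zeta> (fst p)) - \<zeta> (a (h (snd p)) (fst p)))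
        (c (snd p) *\<^sub>C \<rho> (h (snd p)) (v (fst p)))) \<le> e / (C + 1) * (cmod (c (snd p)) * norm (v (fst p)))"
      unfolding norm_etensor norm_scaleC unitary_repD(6)[OF R h(1)[OF *(2)] v[OF *(1)]]
      by (intro mult_right_mono \<zeta>(4) h(2) *) auto
  qed
  also have "\<dots> = e / (C + 1) * C"
    by (simp add: C_def case_prod_beta sum_distrib_left)
  also have "\<dots> \<le> e"
    using e C0 by (simp add: field_simps)
  finally have "norm (B - A) \<le> e" .
  moreover have "norm A \<le> norm B + norm (B - A)"
    by (metis add.commute norm_minus_commute norm_triangle_sub)
  ultimately show "norm (lincomb \<rho> xs (\<Sum>x\<in>F. v x))
      \<le> norm (lincomb (left_regular G) xs) * norm (\<Sum>x\<in>F. v x) + e"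
    using A B by linarith
qed

lemma unitary_rep_subgroup:
  assumes R: "unitary_rep G V \<pi>" and H: "subgroup H G"
  shows "unitary_rep (G\<lparr>carrier := H\<rparr>) V \<pi>"
  using R subgroup.subset[OF H] by (auto simp: unitary_rep_def subset_iff)

end


section \<open>Induced representations\<close>

text \<open>A subgroup with a section of its left cosets.\<close>

locale coset_section = group G for G :: "('g, 'b) monoid_scheme" (structure) +
  fixes H :: "'g set" and s :: "'g set \<Rightarrow> 'g"
  assumes H: "subgroup H G" and sec: "is_section G H s"
begin

abbreviation "X \<equiv> lcosets H"
abbreviation "L \<equiv> G\<lparr>carrier := H\<rparr>"
abbreviation "cocycle \<equiv> coset_cocycle G s"

lemma group_L: "group L"
  by (rule subgroup_imp_group[OF H])

lemma H_carrier: "h \<in> H \<Longrightarrow> h \<in> carrier G"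
  using subgroup.subset[OF H] by auto

lemma coset_subset: "x \<in> X \<Longrightarrow> x \<subseteq> carrier G"
  by (rule subgroup.lcosets_carrier[OF H is_group])

lemma coset_E:
  assumes "x \<in> X" obtains a where "a \<in> carrier G" "x = a <# H"
  using assms by (auto simp: LCOSETS_def)

lemma coset_I: "a \<in> carrier G \<Longrightarrow> a <# H \<in> X"
  by (auto simp: LCOSETS_def)

lemma act_coset [simp, intro]: "g \<in> carrier G \<Longrightarrow> x \<in> X \<Longrightarrow> g <# x \<in> X"
  by (metis coset_E coset_I lcos_m_assoc m_closed subgroup.subset[OF H])

lemma act_mult: "g \<in> carrier G \<Longrightarrow> h \<in> carrier G \<Longrightarrow> x \<in> X \<Longrightarrow> g <# (h <# x) = (g \<otimes> h) <# x"
  using lcos_m_assoc coset_subset by blast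

lemma act_one [simp]: "x \<in> X \<Longrightarrow> \<one> <# x = x"
  using lcos_mult_one coset_subset by blast

lemma act_inv [simp]:
  assumes "g \<in> carrier G" "x \<in> X"
  shows "inv g <# (g <# x) = x" "g <# (inv g <# x) = x"
  using assms by (auto simp: act_mult)

lemma base_coset [simp]: "H \<in> X"
  using coset_I[of \<one>] lcos_mult_one[OF subgroup.subset[OF H]] by simp

lemma act_base [simp]: "h \<in> H \<Longrightarrow> h <# H = H"
  using coset_join3[OF H_carrier H] by blast

lemma section_in: "x \<in> X \<Longrightarrow> s x \<in> x"
  using sec by (auto simp: is_section_def)

lemma section_carrier [simp]: "x \<in> X \<Longrightarrow> s x \<in> carrier G"
  using section_in coset_subset by blast

lemma coset_of_element: "x \<in> X \<Longrightarrow> a \<in> x \<Longrightarrow> a <# H = x"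
  by (metis H coset_E l_repr_independence)

lemma section_coset: "x \<in> X \<Longrightarrow> s x <# H = x"
  by (rule coset_of_element[OF _ section_in])

lemma cocycle_in:
  assumes g: "g \<in> carrier G" and x: "x \<in> X"
  shows "cocycle g x \<in> H"
proof -
  have gx: "g <# x \<in> X" using g x by simp
  have "g \<otimes> s x \<in> g <# x" using section_in[OF x] by (auto simp: l_coset_def)
  also have "g <# x = s (g <# x) <# H" by (rule section_coset[OF gx, symmetric])
  finally have "inv (s (g <# x)) \<otimes> (g \<otimes> s x) \<in> H"
    by (rule subgroup.lcos_module_imp[OF H is_group section_carrier[OF gx]])
  then show ?thesis
    using g x gx by (simp add: coset_cocycle_def m_assoc)
qed

lemma cocycle_mult:
  assumes "g \<in> carrier G" "h \<in> carrier G" "x \<in> X"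
  shows "cocycle (g \<otimes> h) x = cocycle g (h <# x) \<otimes> cocycle h x"
proof -
  let ?a = "s (h <# x)" and ?b = "s (g <# (h <# x))"
  have c: "?a \<in> carrier G" "?b \<in> carrier G" "s x \<in> carrier G" using assms by simp_all
  have "(inv ?b \<otimes> g \<otimes> ?a) \<otimes> (inv ?a \<otimes> h \<otimes> s x) = inv ?b \<otimes> g \<otimes> (?a \<otimes> inv ?a) \<otimes> h \<otimes> s x"
    using assms(1,2) c by (simp only: m_assoc m_closed inv_closed)
  also have "\<dots> = inv ?b \<otimes> (g \<otimes> h) \<otimes> s x"
    using assms(1,2) c by (simp add: m_assoc)
  finally show ?thesis using assms by (simp add: coset_cocycle_def act_mult)
qed

lemma cocycle_one [simp]: "x \<in> X \<Longrightarrow> cocycle \<one> x = \<one>"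
  by (simp add: coset_cocycle_def)

lemma act_bij: "g \<in> carrier G \<Longrightarrow> bij_betw (\<lambda>y. inv g <# y) X X"
  by (rule bij_betw_byWitness[where f' = "\<lambda>y. g <# y"]) auto

lemma act_eq_iff: "g \<in> carrier G \<Longrightarrow> x \<in> X \<Longrightarrow> y \<in> X \<Longrightarrow> inv g <# y = x \<longleftrightarrow> y = g <# x"
  by auto

end

text \<open>A unitary representation of the subgroup, to be induced.\<close>

locale induction = coset_section G H s for G :: "('g, 'b) monoid_scheme" (structure) and H s +
  fixes \<pi>0 :: "'g \<Rightarrow> 'h::complex_hilbert \<Rightarrow>\<^sub>L 'h"
  assumes R0: "unitary_rep L UNIV \<pi>0"
begin

abbreviation "\<pi> \<equiv> induced_rep G H s \<pi>0"
abbreviation "V \<equiv> ell2_on X :: ('g set, 'h) ell2 set"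

lemma R0D:
  "g \<in> H \<Longrightarrow> clin (\<pi>0 g)" "g \<in> H \<Longrightarrow> norm (\<pi>0 g \<xi>) = norm \<xi>" "\<pi>0 \<one> \<xi> = \<xi>"
  "g \<in> H \<Longrightarrow> h \<in> H \<Longrightarrow> \<pi>0 (g \<otimes> h) = \<pi>0 g o\<^sub>L \<pi>0 h"
  "g \<in> H \<Longrightarrow> cinner (\<pi>0 g \<xi>) (\<pi>0 g \<eta>) = cinner \<xi> \<eta>"
  using unitary_repD[OF R0] by auto

lemma induced_rep_wcomp:
  assumes g: "g \<in> carrier G"
  shows "\<pi> g = wcomp X (\<lambda>y. inv g <# y) (\<lambda>y. \<pi>0 (cocycle g (inv g <# y)))" (is "_ = ?T")
    and "wcomp X (\<lambda>y. inv g <# y) (\<lambda>y. \<pi>0 (cocycle g (inv g <# y))) \<in> ops V"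
    and "ell2_nth (\<pi> g f) y = (if y \<in> X then \<pi>0 (cocycle g (inv g <# y)) (ell2_nth f (inv g <# y)) else 0)"
    and "x \<in> X \<Longrightarrow> \<pi> g (etensor (delta x) \<xi>) = etensor (delta (g <# x)) (\<pi>0 (cocycle g x) \<xi>)"
proof -
  have inj: "inj_on (\<lambda>y. inv g <# y) X" using act_bij[OF g] by (rule bij_betw_imp_inj_on)
  have c: "cocycle g (inv g <# y) \<in> H" if "y \<in> X" for y using g that by (intro cocycle_in) auto
  have n: "norm (\<pi>0 (cocycle g (inv g <# y)) \<xi>) \<le> 1 * norm \<xi>" if "y \<in> X" for y \<xi>
    using R0D(2)[OF c[OF that]] by simp
  note nth = wcomp_nth[OF inj n zero_le_one]
  show T: "?T \<in> ops V"
    by (rule wcomp_ops[OF inj n zero_le_one]) (use R0D(1) c g in auto)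
  have Te: "?T (etensor (delta x) \<xi>) = etensor (delta (g <# x)) (\<pi>0 (cocycle g x) \<xi>)" if x: "x \<in> X" for x \<xi>
  proof (rule ell2_ext)
    fix y
    show "ell2_nth (?T (etensor (delta x) \<xi>)) y = ell2_nth (etensor (delta (g <# x)) (\<pi>0 (cocycle g x) \<xi>)) y"
    proof (cases "y \<in> X")
      case True
      show ?thesis
      proof (cases "y = g <# x")
        case True
        then show ?thesis using g x by (simp add: nth)
      next
        case False
        then have "inv g <# y \<noteq> x" using act_eq_iff[OF g x \<open>y \<in> X\<close>] by simp
        then show ?thesis using False \<open>y \<in> X\<close> by (simp add: nth blinfun.zero_right)
      qed
    next
      case False
      then have "y \<noteq> g <# x" using g x by auto
      then show ?thesis using False by (simp add: nth)
    qed
  qed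
  show eq: "\<pi> g = ?T"
    unfolding induced_rep_def
  proof (rule the_equality)
    fix S :: "('g set, 'h) ell2 \<Rightarrow>\<^sub>L ('g set, 'h) ell2"
    assume S: "S \<in> ops V \<and> (\<forall>x\<in>X. \<forall>\<xi>. S (etensor (delta x) \<xi>) = etensor (delta (g <# x)) (\<pi>0 (cocycle g x) \<xi>))"
    show "S = ?T"
      by (rule ops_ell2_eqI[OF _ T]) (use S Te in auto)
  qed (use T Te in auto)
  show "ell2_nth (\<pi> g f) y = (if y \<in> X then \<pi>0 (cocycle g (inv g <# y)) (ell2_nth f (inv g <# y)) else 0)"
    unfolding eq by (rule nth)
  show "x \<in> X \<Longrightarrow> \<pi> g (etensor (delta x) \<xi>) = etensor (delta (g <# x)) (\<pi>0 (cocycle g x) \<xi>)"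
    unfolding eq by (rule Te)
qed

lemma unitary_rep_induced: "unitary_rep G V \<pi>"
  unfolding unitary_rep_def
proof (intro conjI ballI closed_csubspace_ell2_on)
  fix g assume g: "g \<in> carrier G"
  show "\<pi> g \<in> ops V" using induced_rep_wcomp(1,2)[OF g] by simp
  have c: "cocycle g (inv g <# y) \<in> H" if "y \<in> X" for y using g that by (intro cocycle_in) auto
  show "cinner (\<pi> g \<xi>) (\<pi> g \<eta>) = cinner \<xi> \<eta>" if "\<xi> \<in> V" "\<eta> \<in> V" for \<xi> \<eta>
    unfolding induced_rep_wcomp(1)[OF g]
    by (rule wcomp_cinner[OF act_bij[OF g] _ that]) (use R0D c in auto)
next
  fix \<xi> assume "\<xi> \<in> V"
  then show "\<pi> \<one> \<xi> = \<xi>"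
    by (intro ell2_ext) (auto simp: induced_rep_wcomp(3) R0D(3) ell2_on_nth)
next
  fix g h assume gh: "g \<in> carrier G" "h \<in> carrier G"
  show "\<pi> (g \<otimes> h) = \<pi> g o\<^sub>L \<pi> h"
  proof (rule blinfun_eqI, rule ell2_ext)
    fix f y
    show "ell2_nth (\<pi> (g \<otimes> h) f) y = ell2_nth ((\<pi> g o\<^sub>L \<pi> h) f) y"
    proof (cases "y \<in> X")
      case True
      define x where "x = inv h <# (inv g <# y)"
      have x: "x \<in> X" "inv g <# y = h <# x" "inv (g \<otimes> h) <# y = x"
      proof -
        show "x \<in> X" using gh True by (simp add: x_def)
        show "inv g <# y = h <# x" unfolding x_def using gh True by (intro act_inv(2)[symmetric]) auto
        show "inv (g \<otimes> h) <# y = x" using gh True by (simp add: x_def act_mult inv_mult_group)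
      qed
      then show ?thesis
        using gh True by (simp add: induced_rep_wcomp(3) cocycle_mult R0D(4) cocycle_in)
    qed (use gh in \<open>simp add: induced_rep_wcomp(3)\<close>)
  qed
qed

end


subsection \<open>Almost equivariant fields of unit vectors\<close>

context coset_section
begin

lemma stabilizer_subgroup:
  assumes x: "x \<in> X"
  shows "subgroup {k \<in> H. k <# x = x} L"
proof (rule group.subgroupI[OF group_L])
  show "{k \<in> H. k <# x = x} \<noteq> {}" using subgroup.one_closed[OF H] x by auto
  show "inv\<^bsub>L\<^esub> k \<in> {k \<in> H. k <# x = x}" if "k \<in> {k \<in> H. k <# x = x}" for k
    using that x act_inv(1)[of k x] subgroup.m_inv_closed[OF H]
    by (auto simp: m_inv_consistent[OF H] H_carrier)
  show "k \<otimes>\<^bsub>L\<^esub> l \<in> {k \<in> H. k <# x = x}" if "k \<in> {k \<in> H. k <# x = x}" "l \<in> {k \<in> H. k <# x = x}" for k l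
    using that x act_mult[of k l x] subgroup.m_closed[OF H] by (auto simp: H_carrier)
qed auto

lemma stabilizer_amenable:
  assumes an: "a_normal G H" and x: "x \<in> X" "x \<noteq> H"
  shows "amenable (G\<lparr>carrier := {k \<in> H. k <# x = x}\<rparr>)"
proof -
  obtain a where a: "a \<in> carrier G" "x = a <# H" using x(1) by (rule coset_E)
  have "a \<notin> H" using x(2) a coset_join3[OF a(1) H] by auto
  have "{k \<in> H. k <# x = x} = H \<inter> (a <# (H #> inv a))"
  proof (intro equalityI subsetI)
    fix k assume k: "k \<in> {k \<in> H. k <# x = x}"
    have "k \<otimes> a \<in> k <# x"
      using lcos_self[OF a(1) H] unfolding a(2) l_coset_def[of G k "a <# H"] by blast
    then have "k \<otimes> a \<in> a <# H" using k a(2) by simp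
    then obtain h where h: "h \<in> H" "k \<otimes> a = a \<otimes> h" by (auto simp: l_coset_def)
    have "k = (k \<otimes> a) \<otimes> inv a" using k a(1) by (simp add: m_assoc H_carrier)
    also have "\<dots> = a \<otimes> (h \<otimes> inv a)" using h a(1) by (simp add: m_assoc H_carrier)
    finally show "k \<in> H \<inter> (a <# (H #> inv a))"
      using k h(1) by (auto simp: l_coset_def r_coset_def)
  next
    fix k assume k: "k \<in> H \<inter> (a <# (H #> inv a))"
    then obtain h where h: "h \<in> H" "k = a \<otimes> (h \<otimes> inv a)" by (auto simp: l_coset_def r_coset_def)
    have "k \<otimes> a = a \<otimes> h" using h a(1) by (simp add: m_assoc H_carrier)
    then have "k \<otimes> a \<in> x" using h(1) a(2) by (auto simp: l_coset_def)
    then have "(k \<otimes> a) <# H = x" by (rule coset_of_element[OF x(1)])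
    then have "k <# x = x"
      using a k lcos_m_assoc[OF subgroup.subset[OF H], of k a] by (simp add: H_carrier)
    then show "k \<in> {k \<in> H. k <# x = x}" using k by simp
  qed
  then show ?thesis
    using an \<open>a \<notin> H\<close> a(1) by (simp add: a_normal_def)
qed

text \<open>In each orbit of \<open>H\<close> on the cosets other than \<open>H\<close>, choose a representative \<open>y\<close> and elements
  \<open>t(x)\<close> of \<open>H\<close> with \<open>t(x) y = x\<close>. The translates by \<open>t(x)\<close> of a vector almost invariant under the
  stabilizer of \<open>y\<close> form the field.\<close>

lemma equivariant_fields:
  assumes an: "a_normal G H" and F: "finite F" "F \<subseteq> X - {H}" and E: "finite E" "E \<subseteq> H" and e: "0 < \<epsilon>"
  shows "\<exists>\<zeta>. (\<forall>x\<in>F. \<zeta> x \<in> ell2_on H \<and> norm (\<zeta> x) = 1) \<and>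
    (\<forall>h\<in>E. \<forall>x\<in>F. norm (\<zeta> (h <# x)) = 1 \<and> norm (left_regular L h (\<zeta> x) - \<zeta> (h <# x)) \<le> \<epsilon>)"
proof -
  define orb where "orb x = (\<lambda>h. h <# x) ` H" for x
  define r where "r x = (SOME y. y \<in> orb x)" for x
  define t where "t x = (SOME t. t \<in> H \<and> t <# r x = x)" for x
  have orb_sub: "orb (h <# x) \<subseteq> orb x" if "h \<in> H" "x \<in> X" for h x
    using that by (auto simp: orb_def act_mult H_carrier intro!: imageI subgroup.m_closed[OF H])
  have orb_eq: "orb (h <# x) = orb x" if "h \<in> H" "x \<in> X" for h x
    using orb_sub[OF that] orb_sub[OF subgroup.m_inv_closed[OF H that(1)], of "h <# x"] that
    by (simp add: H_carrier)
  have r_eq: "r (h <# x) = r x" if "h \<in> H" "x \<in> X" for h x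
    by (simp add: r_def orb_eq[OF that])
  have r: "\<exists>h\<in>H. r x = h <# x" if "x \<in> X" for x
  proof -
    have "\<one> <# x \<in> orb x" unfolding orb_def using subgroup.one_closed[OF H] by blast
    then have "r x \<in> orb x" unfolding r_def by (rule someI)
    then show ?thesis by (auto simp: orb_def)
  qed
  have rX: "r x \<in> X" if "x \<in> X" for x using r[OF that] that H_carrier by auto
  have r_base: "r x \<noteq> H" if "x \<in> X" "x \<noteq> H" for x
  proof
    assume "r x = H"
    with r[OF that(1)] obtain h where h: "h \<in> H" "h <# x = H" by auto
    then have "x = inv h <# H" using act_inv(1)[of h x] that(1) H_carrier by simp
    then show False using that(2) subgroup.m_inv_closed[OF H h(1)] by simp
  qed
  have t: "t x \<in> H" "t x <# r x = x" if "x \<in> X" for x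
  proof -
    from r[OF that] obtain h where h: "h \<in> H" "r x = h <# x" by auto
    then have "inv h \<in> H \<and> inv h <# r x = x" using that H_carrier subgroup.m_inv_closed[OF H] by simp
    then have "t x \<in> H \<and> t x <# r x = x" unfolding t_def by (rule someI)
    then show "t x \<in> H" "t x <# r x = x" by auto
  qed
  define D where "D y = (\<lambda>(h, x). inv (t (h <# x)) \<otimes> h \<otimes> t x) ` (E \<times> {x \<in> F. r x = y})" for y
  have FX: "x \<in> X" "x \<noteq> H" if "x \<in> F" for x using F(2) that by auto
  have D: "D y \<subseteq> {k \<in> H. k <# y = y}" for y
  proof
    fix k assume "k \<in> D y"
    then obtain h x where k: "k = inv (t (h <# x)) \<otimes> h \<otimes> t x" "h \<in> E" "x \<in> F" "r x = y"
      by (auto simp: D_def)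
    have hH: "h \<in> H" and x: "x \<in> X" using k E(2) FX by auto
    have hx: "h <# x \<in> X" using hH x H_carrier by simp
    have kH: "k \<in> H" unfolding k(1)
      by (intro subgroup.m_closed[OF H] subgroup.m_inv_closed[OF H] t hx hH x)
    have c: "t (h <# x) \<in> carrier G" "h \<in> carrier G" "t x \<in> carrier G" "y \<in> X"
      using t(1)[OF hx] t(1)[OF x] hH H_carrier rX[OF x] k(4) by auto
    have "k <# y = inv (t (h <# x)) <# (h <# (t x <# y))"
      unfolding k(1) using c by (simp add: act_mult m_assoc)
    also have "\<dots> = inv (t (h <# x)) <# (h <# x)" using t(2)[OF x] k(4) by simp
    also have "\<dots> = r (h <# x)"
      using t(2)[OF hx] act_inv(1)[OF c(1) rX[OF hx]] by simp
    finally show "k \<in> {k \<in> H. k <# y = y}" using r_eq[OF hH x] k(4) kH by simp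
  qed
  have "\<forall>y. \<exists>\<eta>. y \<in> X \<and> y \<noteq> H \<longrightarrow> \<eta> \<in> ell2_on H \<and> norm \<eta> = 1 \<and>
      (\<forall>k\<in>D y. norm (left_regular L k \<eta> - \<eta>) < \<epsilon>)"
  proof (intro allI)
    fix y
    show "\<exists>\<eta>. y \<in> X \<and> y \<noteq> H \<longrightarrow> \<eta> \<in> ell2_on H \<and> norm \<eta> = 1 \<and>
        (\<forall>k\<in>D y. norm (left_regular L k \<eta> - \<eta>) < \<epsilon>)"
    proof (cases "y \<in> X \<and> y \<noteq> H")
      case True
      have am: "amenable (L\<lparr>carrier := {k \<in> H. k <# y = y}\<rparr>)"
        using stabilizer_amenable[OF an, of y] True by simp
      have "finite (D y)" unfolding D_def using F E by auto
      then obtain \<eta> where "\<eta> \<in> ell2_on (carrier L)" "norm \<eta> = 1"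
          "\<And>k. k \<in> D y \<Longrightarrow> norm (left_regular L k \<eta> - \<eta>) < \<epsilon>"
        using almost_invariant_vector[OF group_L stabilizer_subgroup am _ D e] True by blast
      then show ?thesis by auto
    qed blast
  qed
  from choice[OF this] obtain \<eta> where \<eta>: "\<And>y. y \<in> X \<Longrightarrow> y \<noteq> H \<Longrightarrow> \<eta> y \<in> ell2_on H \<and> norm (\<eta> y) = 1 \<and>
      (\<forall>k\<in>D y. norm (left_regular L k (\<eta> y) - \<eta> y) < \<epsilon>)"
    by blast
  define \<zeta> where "\<zeta> x = left_regular L (t x) (\<eta> (r x))" for x
  note LR = unitary_repD[OF unitary_rep_left_regular[OF group_L], simplified]
  have \<zeta>: "\<zeta> x \<in> ell2_on H" "norm (\<zeta> x) = 1" if "x \<in> X" "x \<noteq> H" for x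
    using LR(8)[of "t x"] LR(6)[of "t x" "\<eta> (r x)"] t(1)[OF that(1)] \<eta>[OF rX[OF that(1)] r_base[OF that]]
    by (auto simp: \<zeta>_def)
  have act_off_base: "h <# x \<noteq> H" if "h \<in> H" "x \<in> X" "x \<noteq> H" for h x
  proof
    assume "h <# x = H"
    then have "x = inv h <# H" using act_inv(1)[of h x] that H_carrier by simp
    then show False using that(3) subgroup.m_inv_closed[OF H that(1)] by simp
  qed
  show ?thesis
  proof (intro exI[of _ \<zeta>] conjI ballI)
    fix x assume "x \<in> F"
    then show "\<zeta> x \<in> ell2_on H" "norm (\<zeta> x) = 1" using \<zeta> FX by blast+
  next
    fix h x assume h: "h \<in> E" and x: "x \<in> F"
    have hH: "h \<in> H" using h E(2) by auto
    have hx: "h <# x \<in> X" "h <# x \<noteq> H" using hH FX[OF x] H_carrier act_off_base by auto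
    show "norm (\<zeta> (h <# x)) = 1" by (rule \<zeta>(2)[OF hx])
    define k where "k = inv (t (h <# x)) \<otimes> h \<otimes> t x"
    have kD: "k \<in> D (r x)" unfolding D_def k_def using h x by force
    have tH: "t x \<in> H" "t (h <# x) \<in> H" using t FX[OF x] hx by auto
    have kH: "k \<in> H" using D kD by auto
    have eq: "h \<otimes> t x = t (h <# x) \<otimes> k"
      using tH hH by (simp add: k_def H_carrier m_assoc[symmetric])
    let ?\<eta> = "\<eta> (r x)"
    have \<eta>r: "?\<eta> \<in> ell2_on H" "norm (left_regular L k ?\<eta> - ?\<eta>) < \<epsilon>"
      using \<eta>[OF rX[OF FX(1)[OF x]] r_base[OF FX[OF x]]] kD by auto
    have "left_regular L h (\<zeta> x) = left_regular L (h \<otimes> t x) ?\<eta>"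
      using LR(5)[of h "t x"] hH tH by (simp add: \<zeta>_def)
    also have "\<dots> = left_regular L (t (h <# x)) (left_regular L k ?\<eta>)"
      unfolding eq using LR(5)[of "t (h <# x)" k] kH tH by simp
    finally have "left_regular L h (\<zeta> x) - \<zeta> (h <# x)
        = left_regular L (t (h <# x)) (left_regular L k ?\<eta> - ?\<eta>)"
      using r_eq[OF hH FX(1)[OF x]] by (simp add: \<zeta>_def blinfun.diff_right)
    moreover have "left_regular L k ?\<eta> - ?\<eta> \<in> ell2_on H"
      using LR(8)[OF kH] \<eta>r(1) closed_csubspaceD(7)[OF closed_csubspace_ell2_on] by blast
    ultimately show "norm (left_regular L h (\<zeta> x) - \<zeta> (h <# x)) \<le> \<epsilon>"
      using LR(6)[OF tH(2)] \<eta>r(2) by simp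
  qed
qed

end


subsection \<open>Restriction of the induced representation to the subgroup\<close>

lemma norm_ops_le:
  fixes T :: "'a::complex_hilbert \<Rightarrow>\<^sub>L 'a"
  assumes V: "closed_csubspace V" and T: "T \<in> ops V" and C: "0 \<le> C" "\<And>v. v \<in> V \<Longrightarrow> norm (T v) \<le> C * norm v"
  shows "norm T \<le> C"
  unfolding norm_blinfun_le_iff
proof (intro conjI allI C(1))
  fix x
  obtain p where p: "p \<in> V" "norm p \<le> norm x" "\<forall>v\<in>V. cinner v (x - p) = 0" "\<forall>T\<in>ops V. T x = T p"
    using ops_decompose[OF V, of x] by (elim exE conjE)
  have "norm (T x) = norm (T p)" using p(4) T by simp
  also have "\<dots> \<le> C * norm p" by (rule C(2)[OF p(1)])
  also have "\<dots> \<le> C * norm x" using C(1) p(2) by (rule mult_left_mono[rotated])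
  finally show "norm (T x) \<le> C * norm x" .
qed

lemma lincomb_ops:
  fixes \<pi> :: "'g \<Rightarrow> 'a::complex_hilbert \<Rightarrow>\<^sub>L 'a"
  assumes "unitary_rep G V \<pi>" "snd ` set xs \<subseteq> carrier G"
  shows "lincomb \<pi> xs \<in> ops V"
  using star_subalgebraD(1)[OF rep_cstar_props(1)[OF assms(1)] rep_cstar_props(3)[OF assms]] .

context induction
begin

text \<open>The vectors vanishing at the base coset \<open>H\<close>; their complement carries a copy of \<open>\<pi>0\<close>.\<close>

definition off_base :: "('g set, 'h) ell2 set" where
  "off_base = {w \<in> V. ell2_nth w H = 0}"

lemma off_base_eq: "off_base = ell2_on (X - {H})"
  by (auto simp: off_base_def ell2_on_def)

lemma closed_csubspace_off_base: "closed_csubspace off_base"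
  unfolding off_base_eq by (rule closed_csubspace_ell2_on)

lemma off_base_invariant: "h \<in> H \<Longrightarrow> w \<in> off_base \<Longrightarrow> \<pi> h w \<in> off_base"
  using unitary_repD(8)[OF unitary_rep_induced] subgroup.m_inv_closed[OF H]
  by (auto simp: off_base_def induced_rep_wcomp(3) H_carrier blinfun.zero_right)

lemma unitary_rep_restrict: "unitary_rep L V \<pi>"
  by (rule unitary_rep_subgroup[OF is_group unitary_rep_induced H])

text \<open>If \<open>H\<close> is a-normal, the restriction of \<open>\<pi>\<close> to \<open>H\<close> is weakly contained in the left regular
  representation off the base coset.\<close>

lemma off_base_bound:
  assumes an: "a_normal G H" and xs: "snd ` set xs \<subseteq> H" and w: "w \<in> off_base"
  shows "norm (lincomb \<pi> xs w) \<le> norm (lincomb (left_regular L) xs) * norm w"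
proof -
  let ?C = "norm (lincomb (left_regular L) xs)"
  let ?W = "{w :: ('g set, 'h) ell2. norm (lincomb \<pi> xs w) \<le> ?C * norm w}"
  have "closed ?W"
    by (intro closed_Collect_le continuous_intros)
  moreover have "w \<in> closure ?W"
    unfolding closure_approachable
  proof (intro allI impI)
    fix e :: real assume e: "0 < e"
    obtain F where F: "finite F" "F \<subseteq> X - {H}" "norm (w - (\<Sum>i\<in>F. etensor (delta i) (ell2_nth w i))) < e"
      using ell2_approx[OF w[unfolded off_base_eq] e] by blast
    let ?v = "\<lambda>x. etensor (delta x) (ell2_nth w x)"
    have FX: "x \<in> X" if "x \<in> F" for x using F(2) that by auto
    have "norm (lincomb \<pi> xs (\<Sum>x\<in>F. ?v x)) \<le> ?C * norm (\<Sum>x\<in>F. ?v x)"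
    proof (rule equivariant_field_bound[OF group_L unitary_rep_restrict _ F(1), where a = "\<lambda>(h::'g) (x::'g set). h <# x"])
      show "snd ` set xs \<subseteq> carrier L" using xs by simp
      show "?v x \<in> V" if "x \<in> F" for x using FX[OF that] by simp
      show "cinner (?v x) (?v y) = 0" if "x \<noteq> y" for x y
        using that by (simp add: cinner_etensor_delta)
      show "cinner (\<pi> g (?v x)) (\<pi> h (?v y)) = 0"
        if "g \<in> carrier L" "h \<in> carrier L" "x \<in> F" "y \<in> F" "g <# x \<noteq> h <# y" for g h x y
        using that FX by (simp add: induced_rep_wcomp(4) H_carrier cinner_etensor_delta)
      show "\<exists>\<zeta>. (\<forall>x\<in>F. \<zeta> x \<in> ell2_on (carrier L) \<and> norm (\<zeta> x) = 1) \<and>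
          (\<forall>h\<in>snd ` set xs. \<forall>x\<in>F. norm (\<zeta> (h <# x)) = 1 \<and> norm (left_regular L h (\<zeta> x) - \<zeta> (h <# x)) \<le> \<epsilon>)"
        if "0 < \<epsilon>" for \<epsilon>
        using equivariant_fields[OF an F(1,2) _ xs that] by simp
    qed
    then show "\<exists>y\<in>?W. dist y w < e"
      using F(3) by (intro bexI[of _ "\<Sum>x\<in>F. ?v x"]) (auto simp: dist_norm norm_minus_commute)
  qed
  ultimately show ?thesis by simp
qed

text \<open>The embedding of \<open>\<pi>0\<close> at the base coset, where \<open>h\<close> acts by \<open>\<pi>0\<close> of the conjugate
  \<open>s(H)\<^bsup>-1\<^esup> h s(H)\<close>; the section need not choose \<open>\<one>\<close> there.\<close>

definition J :: "'h \<Rightarrow>\<^sub>L ('g set, 'h) ell2" where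
  "J = ell2_embed H o\<^sub>L \<pi>0 (inv (s H))"

lemma section_base: "s H \<in> H" "inv (s H) \<in> H"
  using section_in[OF base_coset] subgroup.m_inv_closed[OF H] by auto

lemma J_apply: "J \<xi> = etensor (delta H) (\<pi>0 (inv (s H)) \<xi>)"
  by (simp add: J_def)

lemma J_clin: "clin J"
  by (simp add: clin_def J_apply etensor_simps clinD[OF R0D(1)[OF section_base(2)]])

lemma J_norm: "norm (J \<xi>) = norm \<xi>"
  by (simp add: J_apply norm_etensor R0D(2) section_base)

lemma J_in: "J \<xi> \<in> V"
  by (simp add: J_apply)

lemma cocycle_base: "h \<in> H \<Longrightarrow> cocycle h H = inv (s H) \<otimes> h \<otimes> s H"
  by (simp add: coset_cocycle_def)

lemma J_intertwine:
  assumes h: "h \<in> H"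
  shows "J (\<pi>0 h \<xi>) = \<pi> h (J \<xi>)"
proof -
  have c: "inv (s H) \<otimes> h \<in> H" "cocycle h H \<in> H"
    using h section_base subgroup.m_closed[OF H] cocycle_in[OF H_carrier[OF h] base_coset] by auto
  have "cocycle h H \<otimes> inv (s H) = inv (s H) \<otimes> h"
    using h section_base by (simp add: cocycle_base H_carrier m_assoc)
  then have "\<pi>0 (cocycle h H) (\<pi>0 (inv (s H)) \<xi>) = \<pi>0 (inv (s H)) (\<pi>0 h \<xi>)"
    using R0D(4)[OF c(2) section_base(2)] R0D(4)[OF section_base(2) h]
    by (metis blinfun_apply_blinfun_compose)
  then show ?thesis
    using h by (simp add: J_apply induced_rep_wcomp(4) H_carrier)
qed

lemma base_decompose:
  assumes "w \<in> V"
  obtains \<xi> w' where "w = J \<xi> + w'" "w' \<in> off_base"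
proof
  let ?\<xi> = "\<pi>0 (s H) (ell2_nth w H)"
  have "\<pi>0 (inv (s H)) (\<pi>0 (s H) \<eta>) = \<eta>" for \<eta>
    using section_base H_carrier by (metis R0D(3) R0D(4) blinfun_apply_blinfun_compose l_inv)
  then have "ell2_nth (J ?\<xi>) H = ell2_nth w H" by (simp add: J_apply)
  then show "w - J ?\<xi> \<in> off_base"
    using assms J_in closed_csubspaceD(7)[OF closed_csubspace_ell2_on] by (auto simp: off_base_def)
qed simp

lemma J_orthogonal: "w \<in> off_base \<Longrightarrow> cinner (J \<xi>) w = 0"
  by (simp add: J_apply cinner_etensor_delta off_base_def)

lemma base_norm_le:
  assumes xs: "snd ` set xs \<subseteq> H"
  shows "norm (lincomb \<pi>0 xs) \<le> norm (lincomb \<pi> xs)"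
  unfolding norm_blinfun_le_iff
proof (intro conjI allI norm_ge_zero)
  fix \<xi>
  have "norm (lincomb \<pi>0 xs \<xi>) = norm (lincomb \<pi> xs (J \<xi>))"
    using lincomb_intertwine[of J L \<pi>0 \<pi>, OF J_clin] J_intertwine xs by (simp add: J_norm[symmetric])
  then show "norm (lincomb \<pi>0 xs \<xi>) \<le> norm (lincomb \<pi> xs) * norm \<xi>"
    using norm_blinfun[of "lincomb \<pi> xs" "J \<xi>"] by (simp add: J_norm)
qed

lemma induced_norm_le:
  assumes an: "a_normal G H" and xs: "snd ` set xs \<subseteq> H"
  shows "norm (lincomb \<pi> xs) \<le> max (norm (lincomb \<pi>0 xs)) (norm (lincomb (left_regular L) xs))" (is "_ \<le> ?M")
proof (rule norm_ops_le[OF closed_csubspace_ell2_on])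
  show "lincomb \<pi> xs \<in> ops V"
    by (rule lincomb_ops[OF unitary_rep_restrict]) (use xs in simp)
  fix w assume "w \<in> V"
  then obtain \<xi> w' where w: "w = J \<xi> + w'" "w' \<in> off_base" by (rule base_decompose)
  have aJ: "lincomb \<pi> xs (J \<xi>) = J (lincomb \<pi>0 xs \<xi>)"
    using lincomb_intertwine[of J L \<pi>0 \<pi>, OF J_clin] J_intertwine xs by simp
  have aw': "lincomb \<pi> xs w' \<in> off_base"
    by (rule lincomb_invariant[where G = L, OF closed_csubspace_off_base _ _ w(2)])
      (use off_base_invariant xs in auto)
  have "(norm (lincomb \<pi> xs w))\<^sup>2 = (norm (lincomb \<pi> xs (J \<xi>)))\<^sup>2 + (norm (lincomb \<pi> xs w'))\<^sup>2"
    unfolding w(1) blinfun.add_right by (rule norm_add_orthogonal) (simp add: aJ J_orthogonal[OF aw'])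
  also have "\<dots> \<le> (?M * norm (J \<xi>))\<^sup>2 + (?M * norm w')\<^sup>2"
  proof (intro add_mono power_mono norm_ge_zero)
    have "norm (lincomb \<pi>0 xs \<xi>) \<le> norm (lincomb \<pi>0 xs) * norm \<xi>" by (rule norm_blinfun)
    also have "\<dots> \<le> ?M * norm \<xi>" by (intro mult_right_mono) auto
    finally show "norm (lincomb \<pi> xs (J \<xi>)) \<le> ?M * norm (J \<xi>)" by (simp add: aJ J_norm)
    show "norm (lincomb \<pi> xs w') \<le> ?M * norm w'"
      by (rule order_trans[OF off_base_bound[OF an xs w(2)]]) (intro mult_right_mono, auto)
  qed
  also have "\<dots> = (?M * norm w)\<^sup>2"
    unfolding w(1) using norm_add_orthogonal[OF J_orthogonal[OF w(2)], of \<xi>]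
    by (simp add: power_mult_distrib distrib_left)
  finally show "norm (lincomb \<pi> xs w) \<le> ?M * norm w"
    by (rule power2_le_imp_le) (auto simp: le_max_iff_disj)
qed (simp add: le_max_iff_disj)

end


section \<open>The commutant of the induced representation\<close>

lemma commutant_antimono: "S \<subseteq> T \<Longrightarrow> commutant V T \<subseteq> commutant V S"
  by (auto simp: commutant_def)

lemma subset_bicommutant: "S \<subseteq> ops V \<Longrightarrow> S \<subseteq> bicommutant V S"
  by (auto simp: commutant_def)

lemma triple_commutant:
  assumes "S \<subseteq> ops V"
  shows "commutant V (bicommutant V S) = commutant V S"
proof
  show "commutant V (bicommutant V S) \<subseteq> commutant V S"
    by (rule commutant_antimono[OF subset_bicommutant[OF assms]])
  show "commutant V S \<subseteq> commutant V (bicommutant V S)"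
    by (rule subset_bicommutant) (auto simp: commutant_def)
qed

lemma scalar_commutes:
  assumes V: "closed_csubspace V" and T: "T \<in> ops V" "\<And>v. v \<in> V \<Longrightarrow> T v = c *\<^sub>C v" and S: "S \<in> ops V"
  shows "T o\<^sub>L S = S o\<^sub>L T"
proof (rule ops_eqI[OF V ops_simps(3)[OF V T(1) S] ops_simps(3)[OF V S T(1)]])
  fix v assume "v \<in> V"
  then show "(T o\<^sub>L S) v = (S o\<^sub>L T) v"
    using opsD(2)[OF S] by (simp add: T(2) clinD[OF ops_clin[OF S]])
qed

text \<open>The operator \<open>1 \<otimes> T\<close>.\<close>

definition id_tensor :: "'i set \<Rightarrow> ('h::complex_hilbert \<Rightarrow>\<^sub>L 'h) \<Rightarrow> ('i, 'h) ell2 \<Rightarrow>\<^sub>L ('i, 'h) ell2" where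
  "id_tensor X T = wcomp X (\<lambda>i. i) (\<lambda>_. T)"

lemma id_tensor:
  fixes T :: "'h::complex_hilbert \<Rightarrow>\<^sub>L 'h"
  assumes T: "clin T"
  shows id_tensor_ops: "id_tensor X T \<in> ops (ell2_on X)"
    and id_tensor_nth: "ell2_nth (id_tensor X T f) i = (if i \<in> X then T (ell2_nth f i) else 0)"
    and id_tensor_etensor: "h \<in> ell2_on X \<Longrightarrow> id_tensor X T (etensor h \<xi>) = etensor h (T \<xi>)"
proof -
  have w: "inj_on (\<lambda>i. i) X" "\<And>i \<xi>. i \<in> X \<Longrightarrow> norm (T \<xi>) \<le> norm T * norm \<xi>" "0 \<le> norm T"
    by (auto simp: norm_blinfun)
  show "id_tensor X T \<in> ops (ell2_on X)"
    unfolding id_tensor_def by (rule wcomp_ops[OF w]) (use T in auto)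
  show nth: "ell2_nth (id_tensor X T f) i = (if i \<in> X then T (ell2_nth f i) else 0)" for f i
    unfolding id_tensor_def by (rule wcomp_nth[OF w])
  show "id_tensor X T (etensor h \<xi>) = etensor h (T \<xi>)" if "h \<in> ell2_on X"
    by (rule ell2_ext) (use ell2_on_nth[OF that] in \<open>simp add: nth clinD[OF T]\<close>)
qed

text \<open>The matrix unit \<open>f \<mapsto> f(x) \<delta>\<^sub>y\<close>.\<close>

definition matrix_unit :: "'i \<Rightarrow> 'i \<Rightarrow> ('i, complex) ell2 \<Rightarrow>\<^sub>L ('i, complex) ell2" where
  "matrix_unit y x = Blinfun (\<lambda>f. ell2_nth f x *\<^sub>C delta y)"

lemma matrix_unit_apply: "matrix_unit y x f = ell2_nth f x *\<^sub>C delta y"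
proof -
  have "bounded_linear (\<lambda>f. ell2_nth f x *\<^sub>C delta y)"
  proof (rule bounded_linear_intro[where K = 1])
    show "ell2_nth (r *\<^sub>R f) x *\<^sub>C delta y = r *\<^sub>R (ell2_nth f x *\<^sub>C delta y)" for r f
      by (simp add: scaleC_of_real[symmetric] scaleC_scaleC scaleC_complex_def)
  qed (auto simp: scaleC_add_left norm_scaleC ell2_nth_norm_le)
  then show ?thesis by (simp add: matrix_unit_def bounded_linear_Blinfun_apply)
qed

lemma matrix_unit_ops:
  assumes "x \<in> X" "y \<in> X"
  shows "matrix_unit y x \<in> ops (ell2_on X)"
proof (rule opsI)
  show "matrix_unit y x (c *\<^sub>C f) = c *\<^sub>C matrix_unit y x f" for c f
    by (simp add: matrix_unit_apply scaleC_scaleC scaleC_complex_def)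
  show "matrix_unit y x f \<in> ell2_on X" for f
    using assms by (auto simp: ell2_on_def matrix_unit_apply)
  show "matrix_unit y x f = 0" if "\<And>v. v \<in> ell2_on X \<Longrightarrow> cinner v f = 0" for f
    using orthogonal_ell2_on[OF that assms(1)] by (simp add: matrix_unit_apply)
qed

lemma rank_one_projection_matrix_unit:
  assumes x: "x \<in> X"
  shows "rank_one_projection (ell2_on X) (matrix_unit x x)"
  unfolding rank_one_projection_def
proof (intro conjI)
  show "matrix_unit x x \<in> ops (ell2_on X)" by (rule matrix_unit_ops[OF x x])
  show "matrix_unit x x o\<^sub>L matrix_unit x x = matrix_unit x x"
    by (rule blinfun_eqI) (simp add: matrix_unit_apply scaleC_complex_def)
  show "adj (matrix_unit x x) = matrix_unit x x"
  proof (rule adj_eqI)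
    fix f g :: "('a, complex) ell2"
    have "cinner f (delta x) = cnj (ell2_nth f x)"
      using cinner_commute[of f "delta x"] by (simp add: cinner_delta)
    then show "cinner (matrix_unit x x f) g = cinner f (matrix_unit x x g)"
      by (simp add: matrix_unit_apply cinner_scaleC_left cinner_scaleC_right cinner_delta)
  qed
  have "delta x \<noteq> 0" by (metis ell2_nth_simps(1,7) zero_neq_one)
  moreover have "range (blinfun_apply (matrix_unit x x)) = range (\<lambda>c. c *\<^sub>C delta x)"
  proof (intro equalityI subsetI)
    fix f assume "f \<in> range (\<lambda>c. c *\<^sub>C (delta x :: ('a, complex) ell2))"
    then obtain c where "f = c *\<^sub>C delta x" by auto
    then have "f = matrix_unit x x (c *\<^sub>C delta x)"
      by (simp add: matrix_unit_apply scaleC_complex_def)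
    then show "f \<in> range (blinfun_apply (matrix_unit x x))" by blast
  qed (auto simp: matrix_unit_apply)
  ultimately show "\<exists>e. e \<noteq> 0 \<and> range (blinfun_apply (matrix_unit x x)) = range (\<lambda>c. c *\<^sub>C e)"
    by blast
qed

lemma rep_cstar_subgroup:
  assumes "K \<subseteq> carrier G"
  shows "rep_cstar (G\<lparr>carrier := K\<rparr>) V \<pi> \<subseteq> rep_cstar G V \<pi>"
  unfolding rep_cstar_def cstar_generated_def using assms by (intro Inter_anti_mono) auto

context induction
begin

abbreviation "C0 \<equiv> commutant UNIV (\<pi>0 ` H)"

lemma C0_clin: "T \<in> C0 \<Longrightarrow> clin T"
  by (auto simp: commutant_def ops_clin)

lemma rep_vn_base: "rep_vn L UNIV \<pi>0 = commutant UNIV C0"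
  by (simp add: rep_vn_def)

lemma id_tensor_commutant:
  assumes T: "T \<in> C0"
  shows "id_tensor X T \<in> commutant V (\<pi> ` carrier G)"
proof -
  note Tc = C0_clin[OF T]
  have "id_tensor X T o\<^sub>L \<pi> g = \<pi> g o\<^sub>L id_tensor X T" if g: "g \<in> carrier G" for g
  proof (rule ops_ell2_eqI)
    have pg: "\<pi> g \<in> ops V" using unitary_repD(2)[OF unitary_rep_induced g] .
    show "(id_tensor X T o\<^sub>L \<pi> g) \<in> ops V" "(\<pi> g o\<^sub>L id_tensor X T) \<in> ops V"
      by (intro ops_simps(3)[OF closed_csubspace_ell2_on] id_tensor_ops[OF Tc] pg)+
    fix x \<xi> assume x: "x \<in> X"
    have "T o\<^sub>L \<pi>0 (cocycle g x) = \<pi>0 (cocycle g x) o\<^sub>L T"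
      using T cocycle_in[OF g x] by (auto simp: commutant_def)
    then have "T (\<pi>0 (cocycle g x) \<xi>) = \<pi>0 (cocycle g x) (T \<xi>)"
      by (metis blinfun_apply_blinfun_compose)
    then show "(id_tensor X T o\<^sub>L \<pi> g) (etensor (delta x) \<xi>) = (\<pi> g o\<^sub>L id_tensor X T) (etensor (delta x) \<xi>)"
      using g x by (simp add: induced_rep_wcomp(4) id_tensor_etensor[OF Tc])
  qed
  then show ?thesis using id_tensor_ops[OF Tc] by (auto simp: commutant_def)
qed

text \<open>The operators commuting with the \<open>a \<otimes> b\<close>, \<open>b\<close> in \<open>\<pi>0(H)''\<close>, are the \<open>1 \<otimes> T\<close>,
  \<open>T\<close> in \<open>\<pi>0(H)'\<close>; already the matrix units determine the first factor.\<close>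

lemma commutant_tensors:
  "commutant V {tensor_op X a b | a b. a \<in> ops (ell2_on X) \<and> b \<in> rep_vn L UNIV \<pi>0} = id_tensor X ` C0"
  (is "?lhs = ?rhs")
proof (intro equalityI subsetI)
  fix S assume "S \<in> ?rhs"
  then obtain T where T: "T \<in> C0" "S = id_tensor X T" by auto
  note Tc = C0_clin[OF T(1)]
  have "S o\<^sub>L tensor_op X a b = tensor_op X a b o\<^sub>L S"
    if a: "a \<in> ops (ell2_on X)" and b: "b \<in> rep_vn L UNIV \<pi>0" for a b
  proof (rule ops_ell2_eqI)
    have bc: "clin b" using b by (auto simp: rep_vn_def commutant_def ops_clin)
    note t = tensor_op_eq[OF a bc]
    show "(S o\<^sub>L tensor_op X a b) \<in> ops V" "(tensor_op X a b o\<^sub>L S) \<in> ops V"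
      unfolding T(2) by (intro ops_simps(3)[OF closed_csubspace_ell2_on] id_tensor_ops[OF Tc] t)+
    fix x \<xi> assume x: "x \<in> X"
    have "b o\<^sub>L T = T o\<^sub>L b" using b T(1) by (auto simp: rep_vn_base commutant_def)
    then have "b (T \<xi>) = T (b \<xi>)" by (metis blinfun_apply_blinfun_compose)
    then show "(S o\<^sub>L tensor_op X a b) (etensor (delta x) \<xi>) = (tensor_op X a b o\<^sub>L S) (etensor (delta x) \<xi>)"
      using x by (simp add: T(2) t(2) id_tensor_etensor[OF Tc] opsD(2)[OF a])
  qed
  then show "S \<in> ?lhs"
    using id_tensor_ops[OF Tc] by (auto simp: commutant_def T(2))
next
  fix S assume S: "S \<in> ?lhs"
  have S_ops: "S \<in> ops V" using S by (simp add: commutant_def)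
  note Sc = ops_clin[OF S_ops]
  define T where "T = ell2_coord H o\<^sub>L S o\<^sub>L ell2_embed H"
  have T: "T \<xi> = ell2_nth (S (etensor (delta H) \<xi>)) H" for \<xi>
    by (simp add: T_def)
  have Tc: "clin T"
    by (simp add: T_def Sc)
  have ST: "S (etensor (delta y) (b \<xi>)) = etensor (delta y) (b (T \<xi>))"
    if y: "y \<in> X" and b: "b \<in> rep_vn L UNIV \<pi>0" for y b \<xi>
  proof -
    have bc: "clin b" using b by (auto simp: rep_vn_def commutant_def ops_clin)
    note mu = matrix_unit_ops[OF base_coset y]
    note t = tensor_op_eq[OF mu bc]
    have comm: "S o\<^sub>L tensor_op X (matrix_unit y H) b = tensor_op X (matrix_unit y H) b o\<^sub>L S"
      using S mu b unfolding commutant_def by blast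
    have te: "tensor_op X (matrix_unit y H) b v = etensor (delta y) (b (ell2_nth v H))" if "v \<in> V" for v
    proof -
      have "tensor_op X (matrix_unit y H) b v = (ell2_embed y o\<^sub>L b o\<^sub>L ell2_coord H) v"
      proof (rule ell2_on_eqI[OF ops_clin[OF t(1)] _ _ that])
        show "tensor_op X (matrix_unit y H) b (etensor (delta i) \<xi>)
            = (ell2_embed y o\<^sub>L b o\<^sub>L ell2_coord H) (etensor (delta i) \<xi>)" if "i \<in> X" for i \<xi>
          using that by (auto simp: t(2) matrix_unit_apply etensor_simps blinfun.zero_right)
      qed (simp add: bc)
      then show ?thesis by simp
    qed
    have "S (etensor (delta y) (b \<xi>)) = S (tensor_op X (matrix_unit y H) b (etensor (delta H) \<xi>))"
      by (simp add: te)
    also have "\<dots> = tensor_op X (matrix_unit y H) b (S (etensor (delta H) \<xi>))"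
      using comm by (metis blinfun_apply_blinfun_compose)
    also have "\<dots> = etensor (delta y) (b (T \<xi>))"
      using opsD(2)[OF S_ops] by (simp add: te T)
    finally show ?thesis .
  qed
  have id_vn: "id_blinfun \<in> rep_vn L UNIV \<pi>0"
    by (auto simp: rep_vn_def commutant_def ops_UNIV intro: blinfun_eqI)
  have S_eq: "S = id_tensor X T"
    by (rule ops_ell2_eqI[OF S_ops id_tensor_ops[OF Tc]])
      (use ST[OF _ id_vn] in \<open>simp add: id_tensor_etensor[OF Tc]\<close>)
  have "T o\<^sub>L \<pi>0 h = \<pi>0 h o\<^sub>L T" if h: "h \<in> H" for h
  proof (rule blinfun_eqI)
    fix \<xi>
    have "\<pi>0 h \<in> rep_vn L UNIV \<pi>0"
      using rep_cstar_subset_rep_vn[OF group_L R0 rep_cstar_props(4)[OF R0]] h by simp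
    from ST[OF base_coset this, of \<xi>] show "(T o\<^sub>L \<pi>0 h) \<xi> = (\<pi>0 h o\<^sub>L T) \<xi>"
      by (simp add: T)
  qed
  then have "T \<in> C0" using Tc by (auto simp: commutant_def ops_UNIV)
  then show "S \<in> ?rhs" using S_eq by auto
qed

text \<open>If some \<open>x\<close> in \<open>C*(\<pi>(H))\<close> vanishes off the base coset and not on it, then an operator
  commuting with \<open>\<pi>\<close> leaves the copy of \<open>\<pi>0\<close> at the base coset and its complement invariant,
  and it is determined there.\<close>

lemma commutant_induced:
  assumes F: "factorial_rep L UNIV \<pi>0" and x: "x \<in> rep_cstar L V \<pi>" "\<And>w. w \<in> off_base \<Longrightarrow> x w = 0"
    "x (J \<xi>1) \<noteq> 0"
  shows "commutant V (\<pi> ` carrier G) = id_tensor X ` C0"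
proof (intro equalityI subsetI)
  fix S assume "S \<in> id_tensor X ` C0"
  then show "S \<in> commutant V (\<pi> ` carrier G)" using id_tensor_commutant by auto
next
  fix S assume S: "S \<in> commutant V (\<pi> ` carrier G)"
  obtain x0 where x0: "x0 \<in> rep_cstar L UNIV \<pi>0" "\<And>\<xi>. J (x0 \<xi>) = x (J \<xi>)"
    using rep_cstar_intertwine[OF group_L R0 unitary_rep_restrict J_clin J_norm _ x(1)] J_intertwine
    by auto
  have x0_vn: "x0 \<in> rep_vn L UNIV \<pi>0" by (rule rep_cstar_subset_rep_vn[OF group_L R0 x0(1)])
  have x0_nz: "x0 \<noteq> 0" using x(3) x0(2)[of \<xi>1] by (auto simp: blinfun.zero_right)
  have S_ops: "S' \<in> ops V" if "S' \<in> commutant V (\<pi> ` carrier G)" for S'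
    using that by (simp add: commutant_def)
  have off: "S' w \<in> off_base" if S': "S' \<in> commutant V (\<pi> ` carrier G)" and w: "w \<in> off_base" for S' w
  proof -
    obtain \<xi> w' where d: "S' w = J \<xi> + w'" "w' \<in> off_base"
      using base_decompose[OF opsD(2)[OF S_ops[OF S'], of w]] by metis
    have S'L: "S' \<in> commutant V (\<pi> ` H)"
      using S' H_carrier by (auto simp: commutant_def)
    have "x \<in> rep_vn L V \<pi>" by (rule rep_cstar_subset_rep_vn[OF group_L unitary_rep_restrict x(1)])
    then have xS: "x o\<^sub>L S' = S' o\<^sub>L x" using S'L by (auto simp: rep_vn_def commutant_def)
    have "x0 (\<pi>0 h \<xi>) = 0" if h: "h \<in> H" for h
    proof -
      have S\<pi>: "S' o\<^sub>L \<pi> h = \<pi> h o\<^sub>L S'" using S'L h by (auto simp: commutant_def)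
      have "J (x0 (\<pi>0 h \<xi>)) = x (\<pi> h (J \<xi>))" by (simp add: x0(2) J_intertwine[OF h])
      also have "\<dots> = x (\<pi> h (S' w))"
        using x(2)[OF off_base_invariant[OF h d(2)]] by (simp add: d(1) blinfun.add_right)
      also have "\<dots> = S' (x (\<pi> h w))"
        using arg_cong[OF xS, of "\<lambda>T. T (\<pi> h w)"] arg_cong[OF S\<pi>, of "\<lambda>T. T w"] by simp
      also have "\<dots> = 0" using x(2)[OF off_base_invariant[OF h w]] by (simp add: blinfun.zero_right)
      finally show ?thesis using J_norm[of "x0 (\<pi>0 h \<xi>)"] by simp
    qed
    then have "\<xi> = 0" using factorial_rep_orbit[OF group_L F x0_vn x0_nz] by simp
    then show ?thesis using d by (simp add: blinfun.zero_right)
  qed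
  \<comment> \<open>The adjoint of \<open>S\<close> preserves the complement as well, hence \<open>S\<close> preserves the range of \<open>J\<close>.\<close>
  have SJ: "\<exists>\<eta>. S (J \<xi>) = J \<eta>" for \<xi>
  proof -
    obtain \<eta> w' where d: "S (J \<xi>) = J \<eta> + w'" "w' \<in> off_base"
      using base_decompose[OF opsD(2)[OF S_ops[OF S], of "J \<xi>"]] by metis
    have "cinner (adj S w') (J \<xi>) = 0"
      using J_orthogonal[OF off[OF adj_commutant[OF is_group unitary_rep_induced S] d(2)]]
        cinner_eq_0_commute by blast
    then have "cinner w' (S (J \<xi>)) = 0"
      by (simp add: cinner_adj_left ops_clin[OF S_ops[OF S]])
    then have "cinner w' w' = 0"
      using J_orthogonal[OF d(2), of \<eta>] cinner_eq_0_commute[of w' "J \<eta>"] by (simp add: d(1) cinner_add_right)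
    then show ?thesis using d by auto
  qed
  note Sc = ops_clin[OF S_ops[OF S]]
  define T where "T = ell2_coord H o\<^sub>L S o\<^sub>L ell2_embed H"
  have T: "T \<xi> = ell2_nth (S (etensor (delta H) \<xi>)) H" for \<xi>
    by (simp add: T_def)
  have Tc: "clin T"
    by (simp add: T_def Sc)
  have base: "S (etensor (delta H) \<xi>) = etensor (delta H) (T \<xi>)" for \<xi>
  proof -
    have "\<pi>0 (inv (s H)) (\<pi>0 (s H) \<xi>) = \<xi>"
      using section_base H_carrier by (metis R0D(3) R0D(4) blinfun_apply_blinfun_compose l_inv)
    then have "J (\<pi>0 (s H) \<xi>) = etensor (delta H) \<xi>" by (simp add: J_apply)
    then obtain \<eta> where "S (etensor (delta H) \<xi>) = etensor (delta H) \<eta>"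
      using SJ[of "\<pi>0 (s H) \<xi>"] by (auto simp: J_apply)
    then show ?thesis by (simp add: T)
  qed
  have S\<pi>: "S (\<pi> g v) = \<pi> g (S v)" if "g \<in> carrier G" for g v
  proof -
    have "S o\<^sub>L \<pi> g = \<pi> g o\<^sub>L S" using S that by (auto simp: commutant_def)
    then show ?thesis by (metis blinfun_apply_blinfun_compose)
  qed
  have "S = id_tensor X T"
  proof (rule ops_ell2_eqI[OF S_ops[OF S] id_tensor_ops[OF Tc]])
    fix y \<xi> assume y: "y \<in> X"
    \<comment> \<open>This \<open>g\<close> maps the base coset to \<open>y\<close> with trivial cocycle.\<close>
    define g where "g = s y \<otimes> inv (s H)"
    have g: "g \<in> carrier G" using y section_base H_carrier by (simp add: g_def)
    have "g <# H = s y <# (inv (s H) <# H)"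
      using y section_base H_carrier by (simp add: g_def act_mult del: act_base)
    then have gH: "g <# H = y" using section_base(2) section_coset[OF y] by simp
    have "cocycle g H = \<one>"
      using y section_base H_carrier by (simp add: coset_cocycle_def gH) (simp add: g_def m_assoc flip: m_assoc)
    then have e: "\<pi> g (etensor (delta H) \<eta>) = etensor (delta y) \<eta>" for \<eta>
      using g by (simp add: induced_rep_wcomp(4) gH R0D(3))
    show "S (etensor (delta y) \<xi>) = id_tensor X T (etensor (delta y) \<xi>)"
      using S\<pi>[OF g, of "etensor (delta H) \<xi>"] y by (simp add: e base id_tensor_etensor[OF Tc])
  qed
  moreover have "T \<in> C0"
  proof -
    have "T o\<^sub>L \<pi>0 h = \<pi>0 h o\<^sub>L T" if h: "h \<in> H" for h
    proof (rule blinfun_eqI)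
      fix \<xi>
      \<comment> \<open>The element of \<open>H\<close> that acts at the base coset by \<open>\<pi>0 h\<close>.\<close>
      define k where "k = s H \<otimes> h \<otimes> inv (s H)"
      have k: "k \<in> H" unfolding k_def by (intro subgroup.m_closed[OF H] section_base h)
      have "cocycle k H = inv (s H) \<otimes> k \<otimes> s H" by (rule cocycle_base[OF k])
      also have "\<dots> = (inv (s H) \<otimes> s H) \<otimes> h \<otimes> (inv (s H) \<otimes> s H)"
        unfolding k_def using h section_base(1)[THEN H_carrier] H_carrier
        by (simp only: m_assoc m_closed inv_closed)
      also have "\<dots> = h" using h section_base(1)[THEN H_carrier] H_carrier by simp
      finally have "\<pi> k (etensor (delta H) \<eta>) = etensor (delta H) (\<pi>0 h \<eta>)" for \<eta>
        using k by (simp add: induced_rep_wcomp(4) H_carrier)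
      then have "etensor (delta H) (T (\<pi>0 h \<xi>)) = etensor (delta H) (\<pi>0 h (T \<xi>))"
        using S\<pi>[OF H_carrier[OF k], of "etensor (delta H) \<xi>"] by (simp add: base)
      then have "ell2_nth (etensor (delta H) (T (\<pi>0 h \<xi>))) H = ell2_nth (etensor (delta H) (\<pi>0 h (T \<xi>))) H"
        by simp
      then show "(T o\<^sub>L \<pi>0 h) \<xi> = (\<pi>0 h o\<^sub>L T) \<xi>" by simp
    qed
    then show ?thesis using Tc by (auto simp: commutant_def ops_UNIV)
  qed
  ultimately show "S \<in> id_tensor X ` C0" by blast
qed

lemma factor_of_commutant:
  assumes F: "factorial_rep L UNIV \<pi>0" and comm: "commutant V (\<pi> ` carrier G) = id_tensor X ` C0"
  shows "factor V (rep_vn G V \<pi>)"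
proof -
  have pops: "\<pi> ` carrier G \<subseteq> ops V" using unitary_repD(2)[OF unitary_rep_induced] by auto
  have p0ops: "\<pi>0 ` H \<subseteq> ops UNIV" using R0D(1) by (auto simp: ops_UNIV)
  have M': "commutant V (rep_vn G V \<pi>) = id_tensor X ` C0"
    unfolding rep_vn_def triple_commutant[OF pops] by (rule comm)
  have bi: "bicommutant V (rep_vn G V \<pi>) = rep_vn G V \<pi>"
    unfolding M' unfolding rep_vn_def comm ..
  have center: "\<exists>c. \<forall>\<xi>. T \<xi> = c *\<^sub>C \<xi>" if T: "T \<in> C0" and "id_tensor X T \<in> rep_vn G V \<pi>" for T
  proof -
    note Tc = C0_clin[OF T]
    have "T o\<^sub>L S = S o\<^sub>L T" if S: "S \<in> C0" for S
    proof (rule blinfun_eqI)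
      fix \<xi>
      have "id_tensor X T o\<^sub>L id_tensor X S = id_tensor X S o\<^sub>L id_tensor X T"
        using \<open>id_tensor X T \<in> rep_vn G V \<pi>\<close> S
        unfolding rep_vn_def comm commutant_def[of V "id_tensor X ` C0"] by blast
      then have "(id_tensor X T o\<^sub>L id_tensor X S) (etensor (delta H) \<xi>)
          = (id_tensor X S o\<^sub>L id_tensor X T) (etensor (delta H) \<xi>)" by simp
      then have "ell2_nth (etensor (delta H) (T (S \<xi>))) H = ell2_nth (etensor (delta H) (S (T \<xi>))) H"
        by (simp only: blinfun_apply_blinfun_compose id_tensor_etensor[OF Tc] id_tensor_etensor[OF C0_clin[OF S]]
            delta_in_ell2_on base_coset)
      then show "(T o\<^sub>L S) \<xi> = (S o\<^sub>L T) \<xi>" by simp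
    qed
    then have "T \<in> rep_vn L UNIV \<pi>0"
      using Tc by (auto simp: rep_vn_base commutant_def[of _ C0] ops_UNIV)
    moreover have "T \<in> commutant UNIV (rep_vn L UNIV \<pi>0)"
      unfolding rep_vn_base triple_commutant[OF p0ops] by (rule T)
    moreover have "rep_vn L UNIV \<pi>0 \<inter> commutant UNIV (rep_vn L UNIV \<pi>0)
        = {T. T \<in> ops UNIV \<and> (\<exists>c. \<forall>v\<in>UNIV. T v = c *\<^sub>C v)}"
      using F by (simp add: factorial_rep_def factor_def)
    ultimately show ?thesis by blast
  qed
  have "rep_vn G V \<pi> \<inter> commutant V (rep_vn G V \<pi>) = {T. T \<in> ops V \<and> (\<exists>c. \<forall>v\<in>V. T v = c *\<^sub>C v)}"
  proof (intro equalityI subsetI)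
    fix S assume S: "S \<in> rep_vn G V \<pi> \<inter> commutant V (rep_vn G V \<pi>)"
    then obtain T where T: "T \<in> C0" "S = id_tensor X T" unfolding M' by auto
    obtain c where c: "\<And>\<xi>. T \<xi> = c *\<^sub>C \<xi>" using center[OF T(1)] S T(2) by auto
    have "S v = c *\<^sub>C v" if "v \<in> V" for v
      by (rule ell2_ext) (use ell2_on_nth[OF that] in \<open>simp add: T(2) id_tensor_nth[OF C0_clin[OF T(1)]] c\<close>)
    then show "S \<in> {T. T \<in> ops V \<and> (\<exists>c. \<forall>v\<in>V. T v = c *\<^sub>C v)}"
      using S by (auto simp: rep_vn_def commutant_def)
  next
    fix S assume "S \<in> {T. T \<in> ops V \<and> (\<exists>c. \<forall>v\<in>V. T v = c *\<^sub>C v)}"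
    then obtain c where S: "S \<in> ops V" "\<And>v. v \<in> V \<Longrightarrow> S v = c *\<^sub>C v" by auto
    have "S \<in> commutant V B" if "B \<subseteq> ops V" for B
      using scalar_commutes[OF closed_csubspace_ell2_on S] S(1) that by (auto simp: commutant_def)
    then show "S \<in> rep_vn G V \<pi> \<inter> commutant V (rep_vn G V \<pi>)"
      by (auto simp: rep_vn_def) (auto simp: commutant_def)
  qed
  then show ?thesis using bi by (simp add: factor_def)
qed

theorem factorial_induced:
  assumes an: "a_normal G H" and F: "factorial_rep L UNIV \<pi>0"
    and nwc: "\<not> weakly_contained L UNIV \<pi>0 (ell2_on H) (left_regular L)"
  shows "factorial_rep G V \<pi>" "rep_vn G V \<pi> = vn_tensor X (ops (ell2_on X)) (rep_vn L UNIV \<pi>0)"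
    "\<exists>x p0. x \<in> rep_cstar G V \<pi> \<and> x \<noteq> 0 \<and> rank_one_projection (ell2_on X) p0 \<and>
      x o\<^sub>L tensor_op X p0 id_blinfun = x"
proof -
  have LR: "unitary_rep L (ell2_on H) (left_regular L)"
    using unitary_rep_left_regular[OF group_L] by simp
  obtain xs where xs: "snd ` set xs \<subseteq> carrier L" "norm (lincomb (left_regular L) xs) < norm (lincomb \<pi>0 xs)"
    using weakly_containedI[OF group_L R0 LR] nwc by (meson not_less)
  let ?r = "norm (lincomb (left_regular L) xs)"
  obtain \<xi> where \<xi>: "?r * norm \<xi> < norm (lincomb \<pi>0 xs \<xi>)"
    using xs(2) norm_blinfun_le_iff[of "lincomb \<pi>0 xs" ?r] by (auto simp: not_le)
  have aJ: "lincomb \<pi> xs (J \<xi>) = J (lincomb \<pi>0 xs \<xi>)"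
    using lincomb_intertwine[of J L \<pi>0 \<pi>, OF J_clin] J_intertwine xs by simp
  obtain x where x: "x \<in> rep_cstar L V \<pi>" "\<And>w. w \<in> off_base \<Longrightarrow> x w = 0" "x (J \<xi>) \<noteq> 0"
  proof (rule separating_element[OF group_L unitary_rep_restrict xs(1) closed_csubspace_off_base])
    show "off_base \<subseteq> V" by (auto simp: off_base_def)
    show "\<pi> g w \<in> off_base" if "g \<in> carrier L" "w \<in> off_base" for g w
      using off_base_invariant that by simp
    show "norm (lincomb \<pi> xs w) \<le> ?r * norm w" if "w \<in> off_base" for w
      using off_base_bound[OF an _ that] xs(1) by simp
    show "J \<xi> \<in> V" by (rule J_in)
    show "0 \<le> ?r" by simp
    show "?r * norm (J \<xi>) < norm (lincomb \<pi> xs (J \<xi>))" using \<xi> by (simp add: aJ J_norm)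
  qed (rule that)
  have comm: "commutant V (\<pi> ` carrier G) = id_tensor X ` C0"
    by (rule commutant_induced[OF F x])
  show "factorial_rep G V \<pi>"
    using unitary_rep_induced factor_of_commutant[OF F comm] by (simp add: factorial_rep_def)
  show "rep_vn G V \<pi> = vn_tensor X (ops (ell2_on X)) (rep_vn L UNIV \<pi>0)"
    unfolding rep_vn_def[of G] vn_tensor_def commutant_tensors comm ..
  have x_ops: "x \<in> ops V" by (rule star_subalgebraD(1)[OF rep_cstar_props(1)[OF unitary_rep_restrict] x(1)])
  have mu: "matrix_unit H H \<in> ops (ell2_on X)" by (rule matrix_unit_ops) simp_all
  have "clin (id_blinfun :: 'h \<Rightarrow>\<^sub>L 'h)" by simp
  note t = tensor_op_eq[OF mu this]
  have "x o\<^sub>L tensor_op X (matrix_unit H H) id_blinfun = x"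
  proof (rule ops_ell2_eqI[OF ops_simps(3)[OF closed_csubspace_ell2_on x_ops t(1)] x_ops])
    fix i \<eta> assume i: "i \<in> X"
    show "(x o\<^sub>L tensor_op X (matrix_unit H H) id_blinfun) (etensor (delta i) \<eta>) = x (etensor (delta i) \<eta>)"
    proof (cases "i = H")
      case False
      then have "etensor (delta i) \<eta> \<in> off_base" using i by (simp add: off_base_def)
      then show ?thesis
        using i False x(2) by (simp add: t(2) matrix_unit_apply etensor_simps blinfun.zero_right)
    qed (simp add: t(2) matrix_unit_apply)
  qed
  moreover have "x \<in> rep_cstar G V \<pi>"
    using x(1) rep_cstar_subgroup[OF subgroup.subset[OF H]] by blast
  moreover have "x \<noteq> 0" using x(3) by auto
  ultimately show "\<exists>x p0. x \<in> rep_cstar G V \<pi> \<and> x \<noteq> 0 \<and> rank_one_projection (ell2_on X) p0 \<and>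
      x o\<^sub>L tensor_op X p0 id_blinfun = x"
    using rank_one_projection_matrix_unit[OF base_coset] by blast
qed

end


section \<open>Direct sums and prime ideals\<close>

lemma direct_sum_rep_apply: "direct_sum_rep \<pi> \<sigma> g p = (\<pi> g (fst p), \<sigma> g (snd p))"
  unfolding direct_sum_rep_def
  by (subst bounded_linear_Blinfun_apply)
    (auto intro!: bounded_linear_Pair bounded_linear_compose[OF blinfun.bounded_linear_right]
      bounded_linear_fst bounded_linear_snd)

lemma unitary_rep_direct_sum:
  assumes R: "unitary_rep G V \<pi>" and S: "unitary_rep G W \<sigma>"
  shows "unitary_rep G (V \<times> W) (direct_sum_rep \<pi> \<sigma>)"
  unfolding unitary_rep_def
proof (intro conjI ballI)
  note RD = unitary_repD[OF R] and SD = unitary_repD[OF S]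
  show "closed_csubspace (V \<times> W)" by (rule closed_csubspace_Times[OF RD(1) SD(1)])
  fix g assume g: "g \<in> carrier G"
  show "direct_sum_rep \<pi> \<sigma> g \<in> ops (V \<times> W)"
  proof (rule opsI)
    show "direct_sum_rep \<pi> \<sigma> g (c *\<^sub>C x) = c *\<^sub>C direct_sum_rep \<pi> \<sigma> g x" for c x
      by (simp add: direct_sum_rep_apply scaleC_prod_def clinD[OF RD(7)[OF g]] clinD[OF SD(7)[OF g]])
    show "direct_sum_rep \<pi> \<sigma> g x \<in> V \<times> W" for x
      by (simp add: direct_sum_rep_apply RD(8)[OF g] SD(8)[OF g])
    show "direct_sum_rep \<pi> \<sigma> g x = 0" if orth: "\<And>v. v \<in> V \<times> W \<Longrightarrow> cinner v x = 0" for x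
    proof -
      have "\<pi> g (fst x) = 0"
        by (rule opsD(3)[OF RD(2)[OF g]])
          (use orth[of "(_, 0)"] closed_csubspaceD(2)[OF SD(1)] in \<open>auto simp: cinner_prod_def\<close>)
      moreover have "\<sigma> g (snd x) = 0"
        by (rule opsD(3)[OF SD(2)[OF g]])
          (use orth[of "(0, _)"] closed_csubspaceD(2)[OF RD(1)] in \<open>auto simp: cinner_prod_def\<close>)
      ultimately show ?thesis by (simp add: direct_sum_rep_apply zero_prod_def)
    qed
  qed
  show "cinner (direct_sum_rep \<pi> \<sigma> g \<xi>) (direct_sum_rep \<pi> \<sigma> g \<eta>) = cinner \<xi> \<eta>"
    if "\<xi> \<in> V \<times> W" "\<eta> \<in> V \<times> W" for \<xi> \<eta>
    using that g by (auto simp: direct_sum_rep_apply cinner_prod_def RD(3) SD(3))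
next
  fix \<xi> assume "\<xi> \<in> V \<times> W"
  then show "direct_sum_rep \<pi> \<sigma> \<one>\<^bsub>G\<^esub> \<xi> = \<xi>"
    by (auto simp: direct_sum_rep_apply unitary_repD(4)[OF R] unitary_repD(4)[OF S])
next
  fix g h assume "g \<in> carrier G" "h \<in> carrier G"
  then show "direct_sum_rep \<pi> \<sigma> (g \<otimes>\<^bsub>G\<^esub> h) = direct_sum_rep \<pi> \<sigma> g o\<^sub>L direct_sum_rep \<pi> \<sigma> h"
    by (intro blinfun_eqI) (simp add: direct_sum_rep_apply unitary_repD(5)[OF R] unitary_repD(5)[OF S])
qed

lemma lincomb_direct_sum: "lincomb (direct_sum_rep \<pi> \<sigma>) xs p = (lincomb \<pi> xs (fst p), lincomb \<sigma> xs (snd p))"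
  by (induction xs) (auto simp: blinfun.add_left direct_sum_rep_apply scaleC_prod_def zero_prod_def)

lemma norm_lincomb_direct_sum:
  "norm (lincomb \<pi> xs) \<le> norm (lincomb (direct_sum_rep \<pi> \<sigma>) xs)"
  "norm (lincomb \<sigma> xs) \<le> norm (lincomb (direct_sum_rep \<pi> \<sigma>) xs)"
proof -
  have "norm (lincomb \<pi> xs x) \<le> norm (lincomb (direct_sum_rep \<pi> \<sigma>) xs) * norm x" for x
    using norm_blinfun[of "lincomb (direct_sum_rep \<pi> \<sigma>) xs" "(x, 0)"]
    by (simp add: lincomb_direct_sum blinfun.zero_right norm_Pair)
  then show "norm (lincomb \<pi> xs) \<le> norm (lincomb (direct_sum_rep \<pi> \<sigma>) xs)"
    unfolding norm_blinfun_le_iff by simp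
  have "norm (lincomb \<sigma> xs x) \<le> norm (lincomb (direct_sum_rep \<pi> \<sigma>) xs) * norm x" for x
    using norm_blinfun[of "lincomb (direct_sum_rep \<pi> \<sigma>) xs" "(0, x)"]
    by (simp add: lincomb_direct_sum blinfun.zero_right norm_Pair)
  then show "norm (lincomb \<sigma> xs) \<le> norm (lincomb (direct_sum_rep \<pi> \<sigma>) xs)"
    unfolding norm_blinfun_le_iff by simp
qed

text \<open>The kernel of a factor representation is a prime ideal: if \<open>\<pi>\<close> is weakly contained in
  neither \<open>\<sigma>\<close> nor \<open>\<tau>\<close>, there are \<open>x\<close> and \<open>z\<close> in the C*-algebra of \<open>\<pi> \<oplus> \<sigma> \<oplus> \<tau>\<close> which are nonzero
  on \<open>\<pi>\<close> and vanish on \<open>\<sigma>\<close> and on \<open>\<tau>\<close>, respectively. Some product \<open>x g z\<close> is nonzero on \<open>\<pi>\<close>, and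
  it vanishes on \<open>\<sigma> \<oplus> \<tau>\<close>.\<close>

lemma factorial_rep_prime:
  fixes \<pi> :: "'g \<Rightarrow> 'a::complex_hilbert \<Rightarrow>\<^sub>L 'a" and \<sigma> :: "'g \<Rightarrow> 'c::complex_hilbert \<Rightarrow>\<^sub>L 'c"
    and \<tau> :: "'g \<Rightarrow> 'd::complex_hilbert \<Rightarrow>\<^sub>L 'd"
  assumes G: "group G" and F: "factorial_rep G UNIV \<pi>"
    and S: "unitary_rep G V \<sigma>" and T: "unitary_rep G W \<tau>"
    and le: "\<And>xs. snd ` set xs \<subseteq> carrier G \<Longrightarrow> norm (lincomb \<pi> xs) \<le> norm (lincomb (direct_sum_rep \<sigma> \<tau>) xs)"
  shows "weakly_contained G UNIV \<pi> V \<sigma> \<or> weakly_contained G UNIV \<pi> W \<tau>"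
proof (rule ccontr)
  assume neg: "\<not> ?thesis"
  have R: "unitary_rep G UNIV \<pi>" using F by (simp add: factorial_rep_def)
  define \<rho> where "\<rho> = direct_sum_rep \<pi> (direct_sum_rep \<sigma> \<tau>)"
  have ST: "unitary_rep G (V \<times> W) (direct_sum_rep \<sigma> \<tau>)" by (rule unitary_rep_direct_sum[OF S T])
  have U: "unitary_rep G (UNIV \<times> V \<times> W) \<rho>"
    unfolding \<rho>_def by (rule unitary_rep_direct_sum[OF R ST])
  have \<rho>_apply: "\<rho> g p = (\<pi> g (fst p), \<sigma> g (fst (snd p)), \<tau> g (snd (snd p)))" for g p
    by (simp add: \<rho>_def direct_sum_rep_apply)
  have \<rho>_lin: "lincomb \<rho> xs p = (lincomb \<pi> xs (fst p), lincomb \<sigma> xs (fst (snd p)), lincomb \<tau> xs (snd (snd p)))" for xs p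
    by (simp add: \<rho>_def lincomb_direct_sum)
  note SV = unitary_repD[OF S] and TW = unitary_repD[OF T]
  have c0: "closed_csubspace {0 :: 'e::complex_hilbert}" by (simp add: closed_csubspace_def)
  define A where "A = {0 :: 'a} \<times> V \<times> {0 :: 'd}"
  define B where "B = {0 :: 'a} \<times> {0 :: 'c} \<times> W"
  have A: "closed_csubspace A" "A \<subseteq> UNIV \<times> V \<times> W" "\<And>g w. g \<in> carrier G \<Longrightarrow> w \<in> A \<Longrightarrow> \<rho> g w \<in> A"
    unfolding A_def using closed_csubspaceD(2)[OF TW(1)] SV(8)
    by (auto intro!: closed_csubspace_Times SV(1) simp: closed_csubspace_def[of "{0}"] \<rho>_apply blinfun.zero_right)
  have B: "closed_csubspace B" "B \<subseteq> UNIV \<times> V \<times> W" "\<And>g w. g \<in> carrier G \<Longrightarrow> w \<in> B \<Longrightarrow> \<rho> g w \<in> B"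
    unfolding B_def using closed_csubspaceD(2)[OF SV(1)] TW(8)
    by (auto intro!: closed_csubspace_Times TW(1) simp: closed_csubspace_def[of "{0}"] \<rho>_apply blinfun.zero_right)
  have sep: "\<exists>x \<xi>. x \<in> rep_cstar G (UNIV \<times> V \<times> W) \<rho> \<and> (\<forall>w\<in>C. x w = 0) \<and> x (\<xi>, 0, 0) \<noteq> 0"
    if C: "closed_csubspace C" "C \<subseteq> UNIV \<times> V \<times> W" "\<And>g w. g \<in> carrier G \<Longrightarrow> w \<in> C \<Longrightarrow> \<rho> g w \<in> C"
      and xs: "snd ` set xs \<subseteq> carrier G" and r: "0 \<le> r" "r < norm (lincomb \<pi> xs)"
      and small: "\<And>w. w \<in> C \<Longrightarrow> norm (lincomb \<rho> xs w) \<le> r * norm w" for C xs r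
  proof -
    obtain \<xi> where \<xi>: "r * norm \<xi> < norm (lincomb \<pi> xs \<xi>)"
      using r norm_blinfun_le_iff[of "lincomb \<pi> xs" r] by (auto simp: not_le)
    have v: "(\<xi>, 0, 0) \<in> UNIV \<times> V \<times> W"
      using closed_csubspaceD(2)[OF SV(1)] closed_csubspaceD(2)[OF TW(1)] by auto
    have big: "r * norm (\<xi>, 0 :: 'c, 0 :: 'd) < norm (lincomb \<rho> xs (\<xi>, 0, 0))"
      using \<xi> by (simp add: \<rho>_lin blinfun.zero_right norm_Pair)
    show ?thesis
      by (rule separating_element[OF G U xs C small v r(1) big]) blast+
  qed
  obtain xs where xs: "snd ` set xs \<subseteq> carrier G" "norm (lincomb \<sigma> xs) < norm (lincomb \<pi> xs)"
    using weakly_containedI[OF G R S] neg by (meson not_less)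
  have "norm (lincomb \<rho> xs w) \<le> norm (lincomb \<sigma> xs) * norm w" if "w \<in> A" for w
    using that norm_blinfun[of "lincomb \<sigma> xs" "fst (snd w)"]
    by (auto simp: A_def \<rho>_lin blinfun.zero_right norm_Pair)
  then obtain x \<xi> where x: "x \<in> rep_cstar G (UNIV \<times> V \<times> W) \<rho>" "\<forall>w\<in>A. x w = 0" "x (\<xi>, 0, 0) \<noteq> 0"
    using sep[OF A xs(1) norm_ge_zero xs(2)] by blast
  obtain ys where ys: "snd ` set ys \<subseteq> carrier G" "norm (lincomb \<tau> ys) < norm (lincomb \<pi> ys)"
    using weakly_containedI[OF G R T] neg by (meson not_less)
  have "norm (lincomb \<rho> ys w) \<le> norm (lincomb \<tau> ys) * norm w" if "w \<in> B" for w
    using that norm_blinfun[of "lincomb \<tau> ys" "snd (snd w)"]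
    by (auto simp: B_def \<rho>_lin blinfun.zero_right norm_Pair)
  then obtain z \<eta> where z: "z \<in> rep_cstar G (UNIV \<times> V \<times> W) \<rho>" "\<forall>w\<in>B. z w = 0" "z (\<eta>, 0, 0) \<noteq> 0"
    using sep[OF B ys(1) norm_ge_zero ys(2)] by blast
  define J :: "'a \<Rightarrow>\<^sub>L ('a \<times> 'c \<times> 'd)" where "J = Blinfun (\<lambda>\<xi>. (\<xi>, 0))"
  have J: "J \<xi> = (\<xi>, 0, 0)" for \<xi>
    unfolding J_def
    by (subst bounded_linear_Blinfun_apply)
      (auto intro!: bounded_linear_Pair bounded_linear_ident bounded_linear_zero simp: zero_prod_def)
  have J': "clin J" "\<And>\<xi>. norm (J \<xi>) = norm \<xi>" "\<And>g \<xi>. g \<in> carrier G \<Longrightarrow> J (\<pi> g \<xi>) = \<rho> g (J \<xi>)"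
    by (auto simp: clin_def J scaleC_prod_def norm_Pair \<rho>_apply blinfun.zero_right)
  obtain x0 where x0: "x0 \<in> rep_cstar G UNIV \<pi>" "\<And>\<xi>. J (x0 \<xi>) = x (J \<xi>)"
    using rep_cstar_intertwine[OF G R U J' x(1)] by blast
  obtain z0 where z0: "z0 \<in> rep_cstar G UNIV \<pi>" "\<And>\<xi>. J (z0 \<xi>) = z (J \<xi>)"
    using rep_cstar_intertwine[OF G R U J' z(1)] by blast
  have J0: "J 0 = 0" by (simp add: blinfun.zero_right)
  have nz: "x0 \<noteq> 0" "z0 \<eta> \<noteq> 0" using x(3) z(3) x0(2)[of \<xi>] z0(2)[of \<eta>] by (auto simp: J zero_prod_def)
  obtain g where g: "g \<in> carrier G" "x0 (\<pi> g (z0 \<eta>)) \<noteq> 0"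
    using factorial_rep_orbit[OF G F rep_cstar_subset_rep_vn[OF G R x0(1)] nz(1)] nz(2) by blast
  define y where "y = x o\<^sub>L \<rho> g o\<^sub>L z"
  have y: "y \<in> rep_cstar G (UNIV \<times> V \<times> W) \<rho>"
    unfolding y_def
    by (intro star_subalgebraD(5)[OF rep_cstar_props(1)[OF U]] x z rep_cstar_props(4)[OF U g(1)])
  have y_nz: "y (J \<eta>) \<noteq> 0"
  proof -
    have "y (J \<eta>) = J (x0 (\<pi> g (z0 \<eta>)))"
      by (simp add: y_def x0(2) z0(2) J'(3)[OF g(1)])
    then show ?thesis using g(2) J'(2)[of "x0 (\<pi> g (z0 \<eta>))"] by auto
  qed
  have y_zero: "y (0, b) = 0" if b: "b \<in> V \<times> W" for b
  proof -
    have "(0 :: 'a, b) = (0, fst b, 0) + (0, 0, snd b)" by (cases b) simp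
    moreover have "y (0, fst b, 0) = 0"
    proof -
      have bA: "(0, fst b, 0) \<in> A" using b by (auto simp: A_def)
      have "z (0, fst b, 0) \<in> A"
        by (rule rep_cstar_invariant[OF G U z(1) A(1)]) (simp_all add: A(3) bA)
      then show ?thesis using A(3)[OF g(1)] x(2) by (simp add: y_def)
    qed
    moreover have "y (0, 0, snd b) = 0"
    proof -
      have "(0, 0, snd b) \<in> B" using b by (auto simp: B_def)
      then show ?thesis using z(2) by (simp add: y_def blinfun.zero_right)
    qed
    ultimately show ?thesis by (metis add_0 blinfun.add_right)
  qed
  obtain zs where zs: "\<And>n. snd ` set (zs n) \<subseteq> carrier G" "(\<lambda>n. lincomb \<rho> (zs n)) \<longlonglongrightarrow> y"
    using rep_cstar_approx[OF G U y] by metis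
  have bound: "norm (lincomb (direct_sum_rep \<sigma> \<tau>) (zs n)) \<le> norm (lincomb \<rho> (zs n) - y)" for n
  proof (rule norm_ops_le[OF unitary_repD(1)[OF ST] lincomb_ops[OF ST zs(1)] norm_ge_zero])
    fix b assume b: "b \<in> V \<times> W"
    have "(lincomb \<rho> (zs n) - y) (0, b) = (0, lincomb (direct_sum_rep \<sigma> \<tau>) (zs n) b)"
      by (simp add: blinfun.diff_left y_zero[OF b] \<rho>_lin lincomb_direct_sum blinfun.zero_right)
    then show "norm (lincomb (direct_sum_rep \<sigma> \<tau>) (zs n) b) \<le> norm (lincomb \<rho> (zs n) - y) * norm b"
      using norm_blinfun[of "lincomb \<rho> (zs n) - y" "(0, b)"] by (simp add: norm_Pair)
  qed
  have "(\<lambda>n. norm (lincomb \<rho> (zs n) - y)) \<longlonglongrightarrow> 0"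
    using tendsto_norm_zero[OF LIM_zero[OF zs(2)]] .
  then have lim0: "(\<lambda>n. lincomb \<pi> (zs n)) \<longlonglongrightarrow> 0"
    by (rule Lim_null_comparison[rotated]) (use order_trans[OF le[OF zs(1)] bound] in auto)
  have "(\<lambda>n. lincomb \<rho> (zs n) (J \<eta>)) \<longlonglongrightarrow> y (J \<eta>)"
    by (intro tendsto_intros zs)
  moreover have "lincomb \<rho> (zs n) (J \<eta>) = J (lincomb \<pi> (zs n) \<eta>)" for n
    by (rule lincomb_intertwine[where G = G, OF J'(1) _ zs(1), symmetric]) (rule J'(3))
  then have "(\<lambda>n. lincomb \<rho> (zs n) (J \<eta>)) \<longlonglongrightarrow> J ((0 :: 'a \<Rightarrow>\<^sub>L 'a) \<eta>)"
    by (simp only:) (intro tendsto_intros lim0)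
  ultimately show False
    using LIMSEQ_unique y_nz J0 by fastforce
qed


section \<open>Induction from an a-normal subgroup\<close>

lemma inductionI:
  assumes "coset_section G H s" "unitary_rep (G\<lparr>carrier := H\<rparr>) UNIV \<pi>0"
  shows "induction G H s \<pi>0"
  using assms by (simp add: induction_def induction_axioms_def)

theorem proposition1p1:
  fixes \<Gamma> :: "('g, 'b) monoid_scheme" and \<Lambda> :: "'g set" and s :: "'g set \<Rightarrow> 'g"
  defines "X \<equiv> lcosets\<^bsub>\<Gamma>\<^esub> \<Lambda>"
    and "L \<equiv> \<Gamma>\<lparr>carrier := \<Lambda>\<rparr>"
  assumes "group \<Gamma>"
    and "subgroup \<Lambda> \<Gamma>"
    and "\<not> amenable L"
    and "a_normal \<Gamma> \<Lambda>"
    and "is_section \<Gamma> \<Lambda> s"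
  shows
    "(\<forall>\<pi>0 :: 'g \<Rightarrow> 'h::complex_hilbert \<Rightarrow>\<^sub>L 'h.
        factorial_rep L UNIV \<pi>0 \<and>
        \<not> weakly_contained L UNIV \<pi>0 (ell2_on \<Lambda>) (left_regular L) \<longrightarrow>
        factorial_rep \<Gamma> (ell2_on X) (induced_rep \<Gamma> \<Lambda> s \<pi>0) \<and>
        rep_vn \<Gamma> (ell2_on X) (induced_rep \<Gamma> \<Lambda> s \<pi>0) =
          vn_tensor X (ops (ell2_on X)) (rep_vn L UNIV \<pi>0) \<and>
        (\<exists>x p0. x \<in> rep_cstar \<Gamma> (ell2_on X) (induced_rep \<Gamma> \<Lambda> s \<pi>0) \<and> x \<noteq> 0 \<and>
           rank_one_projection (ell2_on X) p0 \<and> x o\<^sub>L tensor_op X p0 id_blinfun = x)) \<and>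
     (\<forall>(\<pi>0 :: 'g \<Rightarrow> 'h \<Rightarrow>\<^sub>L 'h) (\<pi>0' :: 'g \<Rightarrow> 'k::complex_hilbert \<Rightarrow>\<^sub>L 'k).
        unitary_rep L UNIV \<pi>0 \<and> unitary_rep L UNIV \<pi>0' \<and>
        weakly_contained \<Gamma> (ell2_on X) (induced_rep \<Gamma> \<Lambda> s \<pi>0)
          (ell2_on X) (induced_rep \<Gamma> \<Lambda> s \<pi>0') \<longrightarrow>
        weakly_contained L UNIV \<pi>0
          (UNIV \<times> ell2_on \<Lambda>) (direct_sum_rep \<pi>0' (left_regular L)) \<and>
        (factorial_rep L UNIV \<pi>0 \<longrightarrow>
           weakly_contained L UNIV \<pi>0 UNIV \<pi>0' \<or>
           weakly_contained L UNIV \<pi>0 (ell2_on \<Lambda>) (left_regular L)))"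
proof (intro conjI allI impI; (elim conjE)?)
  have cs: "coset_section \<Gamma> \<Lambda> s"
    using assms(3,4,7) by (auto simp: coset_section_def coset_section_axioms_def)
  have LG: "group L" unfolding L_def by (rule coset_section.group_L[OF cs])
  have LR: "unitary_rep L (ell2_on \<Lambda>) (left_regular L)"
    using unitary_rep_left_regular[OF LG] by (simp add: L_def)
  {
    fix \<pi>0 :: "'g \<Rightarrow> 'h \<Rightarrow>\<^sub>L 'h"
    assume F: "factorial_rep L UNIV \<pi>0"
      and nwc: "\<not> weakly_contained L UNIV \<pi>0 (ell2_on \<Lambda>) (left_regular L)"
    have "induction \<Gamma> \<Lambda> s \<pi>0"
      by (rule inductionI[OF cs, folded L_def]) (use F in \<open>simp add: factorial_rep_def\<close>)
    note fi = induction.factorial_induced[OF this assms(6) F[unfolded L_def] nwc[unfolded L_def],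
        folded L_def X_def]
    show "factorial_rep \<Gamma> (ell2_on X) (induced_rep \<Gamma> \<Lambda> s \<pi>0)"
      "rep_vn \<Gamma> (ell2_on X) (induced_rep \<Gamma> \<Lambda> s \<pi>0) = vn_tensor X (ops (ell2_on X)) (rep_vn L UNIV \<pi>0)"
      "\<exists>x p0. x \<in> rep_cstar \<Gamma> (ell2_on X) (induced_rep \<Gamma> \<Lambda> s \<pi>0) \<and> x \<noteq> 0 \<and>
        rank_one_projection (ell2_on X) p0 \<and> x o\<^sub>L tensor_op X p0 id_blinfun = x"
      by (rule fi)+
  }
  fix \<pi>0 :: "'g \<Rightarrow> 'h \<Rightarrow>\<^sub>L 'h" and \<pi>0' :: "'g \<Rightarrow> 'k \<Rightarrow>\<^sub>L 'k"
  assume R: "unitary_rep L UNIV \<pi>0" and R': "unitary_rep L UNIV \<pi>0'"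
    and wc: "weakly_contained \<Gamma> (ell2_on X) (induced_rep \<Gamma> \<Lambda> s \<pi>0) (ell2_on X) (induced_rep \<Gamma> \<Lambda> s \<pi>0')"
  note I = inductionI[OF cs R[unfolded L_def]] and I' = inductionI[OF cs R'[unfolded L_def]]
  have le: "norm (lincomb \<pi>0 xs) \<le> norm (lincomb (direct_sum_rep \<pi>0' (left_regular L)) xs)"
    if xs: "snd ` set xs \<subseteq> carrier L" for xs
  proof -
    have xs': "snd ` set xs \<subseteq> \<Lambda>" "snd ` set xs \<subseteq> carrier \<Gamma>"
      using xs subgroup.subset[OF assms(4)] by (auto simp: L_def)
    have "norm (lincomb \<pi>0 xs) \<le> norm (lincomb (induced_rep \<Gamma> \<Lambda> s \<pi>0) xs)"
      by (rule induction.base_norm_le[OF I xs'(1)])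
    also have "\<dots> \<le> norm (lincomb (induced_rep \<Gamma> \<Lambda> s \<pi>0') xs)"
      using induction.unitary_rep_induced[OF I] induction.unitary_rep_induced[OF I'] wc xs'(2)
      unfolding X_def by (rule weakly_containedD)
    also have "\<dots> \<le> max (norm (lincomb \<pi>0' xs)) (norm (lincomb (left_regular L) xs))"
      unfolding L_def by (rule induction.induced_norm_le[OF I' assms(6) xs'(1)])
    also have "\<dots> \<le> norm (lincomb (direct_sum_rep \<pi>0' (left_regular L)) xs)"
      using norm_lincomb_direct_sum by (rule max.boundedI)
    finally show ?thesis .
  qed
  show "weakly_contained L UNIV \<pi>0 (UNIV \<times> ell2_on \<Lambda>) (direct_sum_rep \<pi>0' (left_regular L))"
    by (rule weakly_containedI[OF LG R unitary_rep_direct_sum[OF R' LR] le])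
  show "weakly_contained L UNIV \<pi>0 UNIV \<pi>0' \<or> weakly_contained L UNIV \<pi>0 (ell2_on \<Lambda>) (left_regular L)"
    if "factorial_rep L UNIV \<pi>0"
    by (rule factorial_rep_prime[OF LG that R' LR le])
qed

end
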